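(* Let $\mathcal{H}$ be a separable infinite-dimensional Hilbert space, let $G$ be a locally compact Polish group with neutral element $1$, and let $M\subseteq G$ be a topological submonoid with $M\neq\{1\}$. Then the closure of $\mathcal{C}_s(M)$ within $(\mathcal{F}^c_w(M),k_{\mathrm{WOT}})$ is convex, whilst $\mathcal{C}_s(M)$ itself is not convex. In particular, $\mathcal{C}_s(M)$ is not a closed subspace within $(\mathcal{F}^c_w(M),k_{\mathrm{WOT}})$.
   Context: Hilbert spaces are complex. $\mathfrak{L}(\mathcal{H})$ denotes the bounded linear operators on $\mathcal{H}$ and $\mathcal{C}(\mathcal{H})$ the contractions (norm $\le 1$). WOT and SOT denote the weak and strong operator topologies. A topological submonoid of a topological group $G$ is a subset $M\subseteq G$, endowed with the subspace topology, which contains the neutral element and is closed under multiplication. A semigroup over $\mathcal{H}$ on a topological monoid $M$ is a function $T:M\to\mathfrak{L}(\mathcal{H})$ with $T(1)=\mathbf{I}$ and $T(st)=T(s)T(t)$ for all $s,t\in M$; it is contractive if it takes values in $\mathcal{C}(\mathcal{H})$. $\mathcal{F}^c_w(M)$ is the set of all WOT-continuous functions $M\to\mathcal{C}(\mathcal{H})$. $\mathcal{C}_s(M)\subseteq\mathcal{F}^c_w(M)$ is the set of all SOT-continuous contractive semigroups over $\mathcal{H}$ on $M$. Convexity is with respect to pointwise convex combinations of operator-valued functions. The topology $k_{\mathrm{WOT}}$ on $\mathcal{F}^c_w(M)$ is determined by the convergence condition for nets: $T_i\to T$ iff for all $\xi,\eta\in\mathcal{H}$ and all compact $K\subseteq M$,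 $\sup_{t\in K}|\langle (T_i(t)-T(t))\xi,\eta\rangle|\to 0$. *)

theory Defs
  imports "HOL-Analysis.Analysis"
begin

section \<open>Complex Hilbert spaces\<close>

text \<open>
  The inner product is linear in the first argument. Completeness and the compatibility of norm,
  distance and topology come from \<^class>\<open>banach\<close>; positive definiteness is contained in
  \<open>cinner_self\<close>.
\<close>

class chilbert_space = banach +
  fixes scaleC :: "complex \<Rightarrow> 'a \<Rightarrow> 'a" (infixr \<open>*\<^sub>C\<close> 75)
    and cinner :: "'a \<Rightarrow> 'a \<Rightarrow> complex"
  assumes scaleC_add_right: "a *\<^sub>C (x + y) = a *\<^sub>C x + a *\<^sub>C y"
    and scaleC_add_left: "(a + b) *\<^sub>C x = a *\<^sub>C x + b *\<^sub>C x"
    and scaleC_scaleC: "a *\<^sub>C (b *\<^sub>C x) = (a * b) *\<^sub>C x"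
    and scaleR_eq_scaleC: "r *\<^sub>R x = complex_of_real r *\<^sub>C x"
    and cinner_commute: "cinner x y = cnj (cinner y x)"
    and cinner_add_left: "cinner (x + y) z = cinner x z + cinner y z"
    and cinner_scaleC_left: "cinner (a *\<^sub>C x) y = a * cinner x y"
    and cinner_self: "cinner x x = complex_of_real ((norm x)\<^sup>2)"

global_interpretation complex_vector:
  vector_space "scaleC :: complex \<Rightarrow> 'a \<Rightarrow> 'a::chilbert_space"
proof unfold_locales
  fix x :: 'a
  show "1 *\<^sub>C x = x"
    using scaleR_eq_scaleC[of 1 x] by simp
qed (simp_all add: scaleC_add_right scaleC_add_left scaleC_scaleC)

lemma cinner_scaleR_left:
  fixes x y :: "'a::chilbert_space"
  shows "cinner (r *\<^sub>R x) y = complex_of_real r * cinner x y"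
  by (simp add: scaleR_eq_scaleC cinner_scaleC_left)

lemma cinner_minus_left:
  fixes x y :: "'a::chilbert_space"
  shows "cinner (- x) y = - cinner x y"
  using cinner_scaleR_left[of "-1" x y] by simp

lemma cinner_diff_left:
  fixes x y z :: "'a::chilbert_space"
  shows "cinner (x - y) z = cinner x z - cinner y z"
  using cinner_add_left[of x "- y" z] by (simp add: cinner_minus_left)

lemma Cauchy_Schwarz_cinner:
  fixes x y :: "'a::chilbert_space"
  shows "cmod (cinner x y) \<le> norm x * norm y"
proof (cases "y = 0")
  case True
  have "cinner x (0::'a) = 0"
    using cinner_commute[of x 0] cinner_scaleR_left[of 0 0 x] by simp
  with True show ?thesis by simp
next
  case False
  define c where "c = cinner x y / of_real ((norm y)\<^sup>2)"
  define z where "z = x - c *\<^sub>C y"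
  have zy: "cinner z y = 0"
    using False by (simp add: z_def c_def cinner_diff_left cinner_scaleC_left cinner_self)
  have yz: "cinner y z = 0"
    using cinner_commute[of y z] zy by simp
  have zx: "cinner z x = of_real ((norm z)\<^sup>2)"
  proof -
    have "cinner x z = cinner z z + c * cinner y z"
      by (simp add: z_def flip: cinner_add_left cinner_scaleC_left)
    then show ?thesis
      using cinner_commute[of z x] yz by (simp add: cinner_self)
  qed
  have "cinner z x = cinner x x - c * cinner y x"
    unfolding z_def by (simp add: cinner_diff_left cinner_scaleC_left)
  then have "cinner x x = of_real ((norm z)\<^sup>2) + c * cinner y x"
    unfolding zx by (metis diff_add_cancel)
  also have "c * cinner y x = of_real ((cmod (cinner x y))\<^sup>2 / (norm y)\<^sup>2)"
    using cinner_commute[of y x] by (simp add: c_def complex_norm_square del: of_real_power)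
  finally have "complex_of_real ((norm x)\<^sup>2)
      = complex_of_real ((norm z)\<^sup>2 + (cmod (cinner x y))\<^sup>2 / (norm y)\<^sup>2)"
    by (simp add: cinner_self)
  then have "(norm x)\<^sup>2 = (norm z)\<^sup>2 + (cmod (cinner x y))\<^sup>2 / (norm y)\<^sup>2"
    by (simp only: of_real_eq_iff)
  then have "(cmod (cinner x y))\<^sup>2 / (norm y)\<^sup>2 \<le> (norm x)\<^sup>2"
    by simp
  then have "(cmod (cinner x y))\<^sup>2 \<le> (norm x * norm y)\<^sup>2"
    using False by (simp add: field_simps)
  then show ?thesis
    by (rule power2_le_imp_le) simp
qed

lemma bounded_linear_cinner_left:
  "bounded_linear (\<lambda>x::'a::chilbert_space. cinner x y)"
  by (rule bounded_linear_intro[where K = "norm y"])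
    (simp_all add: cinner_add_left cinner_scaleR_left scaleR_conv_of_real Cauchy_Schwarz_cinner)


section \<open>Operators and operator topologies\<close>

text \<open>
  Bounded complex-linear operators are the \<^typ>\<open>'a \<Rightarrow>\<^sub>L 'a\<close> that commute with complex scalars;
  the norm of this type is the operator norm.
\<close>

definition bounded_operators :: "('h::chilbert_space \<Rightarrow>\<^sub>L 'h) set" where
  "bounded_operators = {A. \<forall>c x. blinfun_apply A (c *\<^sub>C x) = c *\<^sub>C blinfun_apply A x}"

definition contractions :: "('h::chilbert_space \<Rightarrow>\<^sub>L 'h) set" where
  "contractions = {A \<in> bounded_operators. norm A \<le> 1}"

text \<open>
  Initial topology of the maps \<open>A \<mapsto> \<langle>A \<xi>, \<eta>\<rangle>\<close>, in the style of
  \<^const>\<open>strong_operator_topology\<close>.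
\<close>

definition weak_operator_topology :: "('h::chilbert_space \<Rightarrow>\<^sub>L 'h) topology" where
  "weak_operator_topology =
     pullback_topology UNIV (\<lambda>A (\<xi>, \<eta>). cinner (blinfun_apply A \<xi>) \<eta>) euclidean"

lemma continuous_map_weak_operator_topology_iff:
  "continuous_map X weak_operator_topology f \<longleftrightarrow>
     (\<forall>\<xi> \<eta>. continuous_map X euclidean (\<lambda>t. cinner (blinfun_apply (f t) \<xi>) \<eta>))"
proof -
  have "continuous_map X weak_operator_topology f \<longleftrightarrow>
      continuous_map X euclidean ((\<lambda>A (\<xi>, \<eta>). cinner (blinfun_apply A \<xi>) \<eta>) \<circ> f)"
  proof
    assume "continuous_map X weak_operator_topology f"
    moreover have "continuous_map weak_operator_topology euclidean
        ((\<lambda>g. g) \<circ> (\<lambda>(A :: 'b \<Rightarrow>\<^sub>L 'b) (\<xi>, \<eta>). cinner (blinfun_apply A \<xi>) \<eta>))"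
      unfolding weak_operator_topology_def by (rule continuous_map_pullback) simp
    ultimately show "continuous_map X euclidean ((\<lambda>A (\<xi>, \<eta>). cinner (blinfun_apply A \<xi>) \<eta>) \<circ> f)"
      using continuous_map_compose by (fastforce simp: o_def)
  next
    assume "continuous_map X euclidean ((\<lambda>A (\<xi>, \<eta>). cinner (blinfun_apply A \<xi>) \<eta>) \<circ> f)"
    then show "continuous_map X weak_operator_topology f"
      unfolding weak_operator_topology_def by (rule continuous_map_pullback') simp
  qed
  also have "\<dots> \<longleftrightarrow>
      (\<forall>p. continuous_map X euclidean (\<lambda>t. (case p of (\<xi>, \<eta>) \<Rightarrow> cinner (blinfun_apply (f t) \<xi>) \<eta>)))"
    by (simp add: o_def euclidean_product_topology[symmetric] continuous_map_componentwise_UNIV)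
  finally show ?thesis by simp
qed


section \<open>Semigroups over topological monoids\<close>

text \<open>
  Topological groups are rendered by \<^class>\<open>topological_group_add\<close>: the group operation is written
  \<open>+\<close> and the neutral element \<open>0\<close>, but commutativity is not assumed.
\<close>

definition submonoid_add :: "'g::group_add set \<Rightarrow> bool" where
  "submonoid_add M \<longleftrightarrow> 0 \<in> M \<and> (\<forall>s\<in>M. \<forall>t\<in>M. s + t \<in> M)"

text \<open>
  Functions on \<open>M\<close> are total functions with value \<^const>\<open>undefined\<close> outside \<open>M\<close>, so that equality
  of such functions is equality on \<open>M\<close>.
\<close>

definition wot_functions ::
    "'g::topological_space set \<Rightarrow> ('g \<Rightarrow> ('h::chilbert_space \<Rightarrow>\<^sub>L 'h)) set" where
  "wot_functions M =
     {T \<in> M \<rightarrow>\<^sub>E contractions. continuous_map (top_of_set M) weak_operator_topology T}"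

definition contractive_semigroups ::
    "'g::topological_group_add set \<Rightarrow> ('g \<Rightarrow> ('h::chilbert_space \<Rightarrow>\<^sub>L 'h)) set" where
  "contractive_semigroups M =
     {T \<in> M \<rightarrow>\<^sub>E contractions.
        T 0 = id_blinfun \<and> (\<forall>s\<in>M. \<forall>t\<in>M. T (s + t) = T s o\<^sub>L T t) \<and>
        continuous_map (top_of_set M) strong_operator_topology T}"

lemma contractive_semigroups_subset: "contractive_semigroups M \<subseteq> wot_functions M"
  by (auto simp: contractive_semigroups_def wot_functions_def
      continuous_map_weak_operator_topology_iff continuous_on_strong_operator_topo_iff_coordinatewise
      intro!: bounded_linear.continuous_on[OF bounded_linear_cinner_left])

definition pointwise_convex ::
    "'g set \<Rightarrow> ('g \<Rightarrow> ('h::chilbert_space \<Rightarrow>\<^sub>L 'h)) set \<Rightarrow> bool" where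
  "pointwise_convex M A \<longleftrightarrow>
     (\<forall>S\<in>A. \<forall>T\<in>A. \<forall>u\<ge>0. \<forall>v\<ge>0. u + v = 1 \<longrightarrow> (\<lambda>t\<in>M. u *\<^sub>R S t + v *\<^sub>R T t) \<in> A)"


section \<open>The topology of uniform weak convergence on compact sets\<close>

definition kwot_nbhd ::
    "'g::topological_space set \<Rightarrow> ('g \<Rightarrow> ('h::chilbert_space \<Rightarrow>\<^sub>L 'h)) \<Rightarrow> 'g set \<Rightarrow> 'h \<Rightarrow> 'h \<Rightarrow> real
      \<Rightarrow> ('g \<Rightarrow> ('h \<Rightarrow>\<^sub>L 'h)) set" where
  "kwot_nbhd M S K \<xi> \<eta> e =
     {T \<in> wot_functions M. \<forall>t\<in>K. cmod (cinner (blinfun_apply (T t - S t) \<xi>) \<eta>) < e}"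

definition kwot :: "'g::topological_space set \<Rightarrow> ('g \<Rightarrow> ('h::chilbert_space \<Rightarrow>\<^sub>L 'h)) topology" where
  "kwot M = topology_generated_by
     {kwot_nbhd M S K \<xi> \<eta> e | S K \<xi> \<eta> e. S \<in> wot_functions M \<and> compact K \<and> K \<subseteq> M \<and> e > 0}"

lemma openin_kwot_nbhd:
  assumes "S \<in> wot_functions M" "compact K" "K \<subseteq> M" "e > 0"
  shows "openin (kwot M) (kwot_nbhd M S K \<xi> \<eta> e)"
  unfolding kwot_def
  by (rule topology_generated_by_Basis, rule CollectI, intro exI conjI, rule refl) (fact assms)+

lemma topspace_kwot: "topspace (kwot M) = wot_functions M"
proof
  show "wot_functions M \<subseteq> topspace (kwot M)"
  proof
    fix S
    assume S: "S \<in> wot_functions M"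
    then have "S \<in> kwot_nbhd M S {} 0 0 1"
      by (simp add: kwot_nbhd_def)
    moreover have "kwot_nbhd M S {} 0 0 1 \<subseteq> topspace (kwot M)"
      using S by (intro openin_subset openin_kwot_nbhd) auto
    ultimately show "S \<in> topspace (kwot M)" by (rule rev_subsetD)
  qed
  show "topspace (kwot M) \<subseteq> wot_functions M"
    unfolding kwot_def topology_generated_by_topspace by (auto simp: kwot_nbhd_def)
qed

text \<open>
  The topology has the intended convergence. Filters subsume nets, and \<^const>\<open>uniform_limit\<close> on \<open>K\<close>
  says that the supremum over \<open>K\<close> tends to \<open>0\<close> without a side condition for empty \<open>K\<close>.
\<close>

lemma limitin_kwot_iff:
  "limitin (kwot M) f T F \<longleftrightarrow>
     T \<in> wot_functions M \<and> (\<forall>\<^sub>F i in F. f i \<in> wot_functions M) \<and>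
     (\<forall>\<xi> \<eta> K. compact K \<and> K \<subseteq> M \<longrightarrow>
        uniform_limit K (\<lambda>i t. cinner (blinfun_apply (f i t) \<xi>) \<eta>)
          (\<lambda>t. cinner (blinfun_apply (T t) \<xi>) \<eta>) F)"
  (is "?L \<longleftrightarrow> ?R")
proof
  assume L: ?L
  have T: "T \<in> wot_functions M"
    using L by (simp add: limitin_def topspace_kwot)
  have ev: "\<forall>\<^sub>F i in F. f i \<in> wot_functions M"
    using L T unfolding limitin_def by (metis openin_topspace topspace_kwot)
  have "\<forall>\<^sub>F i in F. \<forall>t\<in>K. dist (cinner (blinfun_apply (f i t) \<xi>) \<eta>) (cinner (blinfun_apply (T t) \<xi>) \<eta>) < e"
    if K: "compact K" "K \<subseteq> M" and e: "e > 0" for \<xi> \<eta> K and e :: real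
  proof -
    have "openin (kwot M) (kwot_nbhd M T K \<xi> \<eta> e)"
      using K e T by (intro openin_kwot_nbhd)
    moreover have "T \<in> kwot_nbhd M T K \<xi> \<eta> e"
      using T e cinner_minus_left[of 0 \<eta>] by (auto simp: kwot_nbhd_def)
    ultimately have "\<forall>\<^sub>F i in F. f i \<in> kwot_nbhd M T K \<xi> \<eta> e"
      using L by (simp add: limitin_def)
    then show ?thesis
      by eventually_elim (simp add: kwot_nbhd_def dist_norm blinfun.diff_left cinner_diff_left)
  qed
  then show ?R
    using T ev by (auto simp: uniform_limit_iff)
next
  assume R: ?R
  let ?B = "{kwot_nbhd M S K \<xi> \<eta> e | S K \<xi> \<eta> e.
    S \<in> wot_functions M \<and> compact K \<and> K \<subseteq> M \<and> e > 0}"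
  have basic: "\<forall>\<^sub>F i in F. f i \<in> U" if "U \<in> ?B" "T \<in> U" for U
  proof -
    obtain S K \<xi> \<eta> e where U: "U = kwot_nbhd M S K \<xi> \<eta> e" and S: "S \<in> wot_functions M"
      and K: "compact K" "K \<subseteq> M" and e: "e > 0"
      using \<open>U \<in> ?B\<close> by blast
    let ?g = "\<lambda>t. cmod (cinner (blinfun_apply (T t - S t) \<xi>) \<eta>)"
    have cont: "continuous_on M (\<lambda>t. cinner (blinfun_apply (A t) \<xi>) \<eta>)"
      if "A \<in> wot_functions M" for A
      using that by (simp add: wot_functions_def continuous_map_weak_operator_topology_iff)
    have gK: "continuous_on K ?g"
      using cont[OF S] cont[of T] R K(2)
      by (auto simp: blinfun.diff_left cinner_diff_left
          intro!: continuous_on_norm continuous_on_diff intro: continuous_on_subset)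
    obtain r where r: "r < e" "\<And>t. t \<in> K \<Longrightarrow> ?g t \<le> r"
    proof (cases "K = {}")
      case True
      then show ?thesis using that[of 0] e by simp
    next
      case False
      then obtain t0 where "t0 \<in> K" "\<forall>t\<in>K. ?g t \<le> ?g t0"
        using continuous_attains_sup[OF K(1) _ gK] by blast
      then show ?thesis
        using that[of "?g t0"] \<open>T \<in> U\<close> by (auto simp: U kwot_nbhd_def)
    qed
    have "\<forall>\<^sub>F i in F. \<forall>t\<in>K. dist (cinner (blinfun_apply (f i t) \<xi>) \<eta>)
        (cinner (blinfun_apply (T t) \<xi>) \<eta>) < e - r"
      using R K r(1) by (simp add: uniform_limit_iff)
    moreover have "\<forall>\<^sub>F i in F. f i \<in> wot_functions M"
      using R by blast
    ultimately show ?thesis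
    proof eventually_elim
      case (elim i)
      have "cmod (cinner (blinfun_apply (f i t - S t) \<xi>) \<eta>) < e" if t: "t \<in> K" for t
      proof -
        have "cinner (blinfun_apply (f i t - S t) \<xi>) \<eta> =
            (cinner (blinfun_apply (f i t) \<xi>) \<eta> - cinner (blinfun_apply (T t) \<xi>) \<eta>)
            + cinner (blinfun_apply (T t - S t) \<xi>) \<eta>"
          by (simp add: blinfun.diff_left cinner_diff_left)
        moreover have "cmod (cinner (blinfun_apply (f i t) \<xi>) \<eta> - cinner (blinfun_apply (T t) \<xi>) \<eta>) < e - r"
          using elim(1) t by (simp add: dist_norm)
        moreover note r(2)[OF t]
        ultimately show ?thesis
          by (simp only:) (rule norm_triangle_lt, linarith)
      qed
      then show ?case
        using elim(2) by (simp add: U kwot_nbhd_def)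
    qed
  qed
  have "\<forall>\<^sub>F i in F. f i \<in> U" if "generate_topology_on ?B U" "T \<in> U" for U
    using that
  proof (induction rule: generate_topology_on.induct)
    case (Int a b)
    then show ?case by (simp add: eventually_conj_iff)
  next
    case (UN K)
    then obtain k where "k \<in> K" "T \<in> k" by blast
    with UN have "\<forall>\<^sub>F i in F. f i \<in> k" by blast
    then show ?case
      by eventually_elim (use \<open>k \<in> K\<close> in blast)
  qed (use basic in auto)
  then show ?L
    using R by (simp add: limitin_def topspace_kwot)
      (simp add: kwot_def openin_topology_generated_by_iff)
qed

end

theory Submission
  imports Defs
begin

text \<open>
  The closure is convex. Let \<open>S\<close> and \<open>T\<close> be contractive semigroups and \<open>u + v = 1\<close>. The isometry
  \<open>V x = (sqrt u x, sqrt v x)\<close> of \<open>H\<close> into \<open>H \<oplus> H\<close> compresses the semigroup \<open>S \<oplus> T\<close> to the convex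
  combination: \<open>V\<^sup>* (S t \<oplus> T t) V = u S t + v T t\<close>. A compression is not multiplicative, but if \<open>J\<close> is an
  isometry of \<open>H \<oplus> H\<close> into \<open>H\<close>, then \<open>J (S t \<oplus> T t) J\<^sup>* + (Id - J J\<^sup>*)\<close> is a contractive semigroup. Since
  \<open>H\<close> is infinite-dimensional, there are such isometries \<open>J\<^sub>k\<close> with \<open>J\<^sub>k\<^sup>* \<longlonglongrightarrow> V\<close> strongly, and the
  resulting semigroups converge to \<open>u S + v T\<close> weakly and uniformly on all of \<open>M\<close>
  (\<open>convex_combination_limit_of_semigroups\<close>). Forming convex combinations respects limits, so the same
  follows for \<open>S\<close> and \<open>T\<close> in the closure (\<open>closure_of_pointwise_convex\<close>).

  The set itself is not convex. If the midpoint of a contractive semigroup \<open>T\<close> and the constant semigroup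
  \<open>Id\<close> is a semigroup, then \<open>(Id - T t)\<^sup>2 = 0\<close>. With \<open>N = T t - Id\<close> this gives \<open>(T t)\<^sup>n = Id + n N\<close>, and these
  powers are bounded only for \<open>N = 0\<close> (\<open>midpoint_with_identity_not_semigroup\<close>). So it suffices to have a
  contractive semigroup with \<open>T t\<^sub>0 \<noteq> Id\<close> for some \<open>t\<^sub>0 \<in> M\<close> different from the neutral element
  (\<open>nontrivial_semigroup_exists\<close>), and the restriction to \<open>M\<close> of a part of the left regular
  representation of the group serves.

  That representation is obtained without measure theory. Haar's covering numbers give a left-invariant
  positive functional \<open>I\<close> on the nonnegative continuous functions with compact support
  (\<open>haar_functional_exists\<close>). For a bump function \<open>f\<close> near the neutral element, with left translates
  \<open>L\<^sub>s f\<close>, the kernel \<open>k s t = I (L\<^sub>s f \<cdot> L\<^sub>t f)\<close> is positive semidefinite, invariant and continuous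
  (\<open>invariant_kernel_exists\<close>). A Cholesky decomposition realises it by vectors of \<open>H\<close>,
  \<open>\<langle>v s, v t\<rangle> = k s t\<close> (\<open>kernel_vectors\<close>), and \<open>v s \<mapsto> v (t + s)\<close> extends to a representation that is
  the identity on the orthogonal complement of the \<open>v s\<close> (\<open>orbit_representation\<close>). If \<open>f\<close> and its
  translate by \<open>t\<^sub>0\<close> have disjoint supports, then \<open>v t\<^sub>0\<close> is orthogonal to \<open>v 0 \<noteq> 0\<close>, so \<open>t\<^sub>0\<close> acts
  nontrivially.

  Finally, the set is not closed, since otherwise it would coincide with its convex closure.
\<close>

section \<open>Inner products and contractions\<close>

lemma cinner_zero_left [simp]: "cinner 0 (y::'a::chilbert_space) = 0"
  using cinner_diff_left[of 0 0 y] by simp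

lemma cinner_zero_right [simp]: "cinner (x::'a::chilbert_space) 0 = 0"
  using cinner_commute[of x 0] by simp

lemma cinner_add_right: "cinner (z::'a::chilbert_space) (x + y) = cinner z x + cinner z y"
  by (metis cinner_add_left cinner_commute complex_cnj_add)

lemma cinner_scaleC_right: "cinner (x::'a::chilbert_space) (a *\<^sub>C y) = cnj a * cinner x y"
  by (metis cinner_scaleC_left cinner_commute complex_cnj_mult)

lemma cinner_minus_right: "cinner (x::'a::chilbert_space) (- y) = - cinner x y"
  by (metis cinner_minus_left cinner_commute complex_cnj_minus)

lemma cinner_diff_right: "cinner (z::'a::chilbert_space) (x - y) = cinner z x - cinner z y"
  using cinner_add_right[of z x "- y"] by (simp add: cinner_minus_right)

lemma cinner_scaleR_right: "cinner (x::'a::chilbert_space) (r *\<^sub>R y) = of_real r * cinner x y"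
  by (simp add: scaleR_eq_scaleC cinner_scaleC_right)

lemmas cinner_simps = cinner_add_left cinner_add_right cinner_diff_left cinner_diff_right
  cinner_scaleC_left cinner_scaleC_right cinner_scaleR_left cinner_scaleR_right
  cinner_minus_left cinner_minus_right

lemma bounded_linear_cinner_right:
  "bounded_linear (\<lambda>y::'a::chilbert_space. cinner x y)"
  by (rule bounded_linear_intro[where K = "norm x"])
    (simp_all add: cinner_add_right cinner_scaleR_right scaleR_conv_of_real
       Cauchy_Schwarz_cinner mult.commute[of "norm _" "norm x"])

lemmas cinner_sum_left = bounded_linear.linear[OF bounded_linear_cinner_left, THEN linear_sum]
lemmas cinner_sum_right = bounded_linear.linear[OF bounded_linear_cinner_right, THEN linear_sum]

lemma norm_sq_cinner: "(norm (x::'a::chilbert_space))\<^sup>2 = Re (cinner x x)"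
  by (simp add: cinner_self)

lemma cinner_eq_0_commute: "cinner x y = 0 \<longleftrightarrow> cinner y (x::'a::chilbert_space) = 0"
  by (metis cinner_commute complex_cnj_zero)

lemma norm_scaleC: "norm (a *\<^sub>C (x::'a::chilbert_space)) = cmod a * norm x"
proof -
  have "cinner (a *\<^sub>C x) (a *\<^sub>C x) = of_real ((cmod a * norm x)\<^sup>2)"
  proof -
    have "cinner (a *\<^sub>C x) (a *\<^sub>C x) = (a * cnj a) * of_real ((norm x)\<^sup>2)"
      by (simp only: cinner_scaleC_left cinner_scaleC_right cinner_self[of x] mult_ac)
    also have "\<dots> = of_real ((cmod a * norm x)\<^sup>2)"
      by (simp add: power_mult_distrib flip: complex_norm_square)
    finally show ?thesis .
  qed
  then have "(norm (a *\<^sub>C x))\<^sup>2 = (cmod a * norm x)\<^sup>2"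
    by (simp only: cinner_self of_real_eq_iff)
  then show ?thesis by simp
qed

lemma bounded_linear_scaleC_right: "bounded_linear (\<lambda>x::'a::chilbert_space. c *\<^sub>C x)"
  by (rule bounded_linear_intro[where K = "cmod c"])
    (simp_all add: scaleC_add_right scaleR_eq_scaleC scaleC_scaleC norm_scaleC mult.commute)

lemma pythagoras:
  assumes "cinner x (y::'a::chilbert_space) = 0"
  shows "(norm (x + y))\<^sup>2 = (norm x)\<^sup>2 + (norm y)\<^sup>2"
  using assms cinner_eq_0_commute[of x y] by (simp add: norm_sq_cinner cinner_simps)

lemma bounded_operators_scaleC:
  "A \<in> bounded_operators \<Longrightarrow> blinfun_apply A (c *\<^sub>C x) = c *\<^sub>C blinfun_apply A x"
  by (simp add: bounded_operators_def)

lemma contractions_norm_le: "A \<in> contractions \<Longrightarrow> norm (blinfun_apply A x) \<le> norm x"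
  using norm_blinfun[of A x] mult_left_le_one_le[of "norm x" "norm A"]
  by (simp add: contractions_def)

lemma contractionsI:
  assumes "\<And>c x. blinfun_apply A (c *\<^sub>C x) = c *\<^sub>C blinfun_apply A x"
    and "\<And>x. norm (blinfun_apply A x) \<le> norm x"
  shows "A \<in> contractions"
  using assms norm_blinfun_bound[of 1 A] by (simp add: contractions_def bounded_operators_def)

lemma contractions_compose:
  assumes "A \<in> contractions" "B \<in> contractions"
  shows "A o\<^sub>L B \<in> contractions"
proof (rule contractionsI)
  show "norm ((A o\<^sub>L B) x) \<le> norm x" for x
    using contractions_norm_le[OF assms(1), of "B x"] contractions_norm_le[OF assms(2), of x]
    by simp
qed (use assms in \<open>simp add: contractions_def bounded_operators_def\<close>)

section \<open>Orthogonal systems and partial isometries\<close>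

text \<open>
  Zero vectors are admitted so that Gram-Schmidt applied to a sequence with linear dependencies
  keeps its indexing: a vector that depends on its predecessors contributes \<open>0\<close> and none has to be
  skipped.
\<close>
definition orthogonal_system :: "(nat \<Rightarrow> 'a::chilbert_space) \<Rightarrow> bool" where
  "orthogonal_system f \<longleftrightarrow> (\<forall>m n. m \<noteq> n \<longrightarrow> cinner (f m) (f n) = 0) \<and> (\<forall>n. norm (f n) \<in> {0, 1})"

lemma orthogonal_system_norm: "orthogonal_system f \<Longrightarrow> norm (f n) = 0 \<or> norm (f n) = 1"
  by (auto simp: orthogonal_system_def)

lemma orthogonal_system_norm_le: "orthogonal_system f \<Longrightarrow> norm (f n) \<le> 1"
  using orthogonal_system_norm[of f n] by auto

lemma orthogonal_system_cinner:
  assumes "orthogonal_system f"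
  shows "cinner (f m) (f n) = (if m = n then of_real (norm (f n)) else 0)"
proof (cases "m = n")
  case True
  then show ?thesis
    using orthogonal_system_norm[OF assms, of n] by (elim disjE) (simp_all add: cinner_self)
next
  case False
  then show ?thesis using assms by (simp add: orthogonal_system_def)
qed

lemma norm_sum_orthogonal_system:
  assumes f: "orthogonal_system f" and A: "finite A"
  shows "(norm (\<Sum>n\<in>A. c n *\<^sub>C f n))\<^sup>2 = (\<Sum>n\<in>A. (cmod (c n))\<^sup>2 * norm (f n))"
proof -
  have "cinner (\<Sum>n\<in>A. c n *\<^sub>C f n) (\<Sum>n\<in>A. c n *\<^sub>C f n)
      = (\<Sum>n\<in>A. \<Sum>m\<in>A. c n * (cnj (c m) * cinner (f n) (f m)))"
    by (simp only: cinner_sum_left) (simp add: cinner_sum_right cinner_simps sum_distrib_left mult_ac)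
  also have "\<dots> = (\<Sum>n\<in>A. \<Sum>m\<in>A. if n = m then of_real ((cmod (c n))\<^sup>2 * norm (f n)) else 0)"
    by (intro sum.cong refl)
      (simp add: orthogonal_system_cinner[OF f] complex_norm_square mult.assoc del: of_real_power)
  also have "\<dots> = of_real (\<Sum>n\<in>A. (cmod (c n))\<^sup>2 * norm (f n))"
    using A by simp
  finally show ?thesis
    by (simp add: norm_sq_cinner)
qed

text \<open>
  The partial sum \<open>y\<close> of the expansion of \<open>x\<close> satisfies \<open>\<langle>x, y\<rangle> = \<parallel>y\<parallel>\<^sup>2\<close>, so Cauchy-Schwarz gives
  \<open>\<parallel>y\<parallel> \<le> \<parallel>x\<parallel>\<close>.
\<close>
lemma bessel:
  assumes f: "orthogonal_system f" and A: "finite A"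
  shows "(\<Sum>n\<in>A. (cmod (cinner x (f n)))\<^sup>2) \<le> (norm x)\<^sup>2"
proof -
  define y where "y = (\<Sum>n\<in>A. cinner x (f n) *\<^sub>C f n)"
  let ?s = "\<Sum>n\<in>A. (cmod (cinner x (f n)))\<^sup>2"
  have "cinner x y = of_real ?s"
    unfolding y_def by (simp add: cinner_sum_right cinner_simps complex_norm_square mult.commute
        del: of_real_power)
  then have xy: "cmod (cinner x y) = ?s"
    by (simp add: norm_of_real sum_nonneg del: of_real_sum)
  have "(norm y)\<^sup>2 = (\<Sum>n\<in>A. (cmod (cinner x (f n)))\<^sup>2 * norm (f n))"
    unfolding y_def by (rule norm_sum_orthogonal_system[OF f A])
  also have "\<dots> = ?s"
  proof (intro sum.cong refl)
    show "(cmod (cinner x (f n)))\<^sup>2 * norm (f n) = (cmod (cinner x (f n)))\<^sup>2" for n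
      using orthogonal_system_norm[OF f, of n] by auto
  qed
  finally have y: "(norm y)\<^sup>2 = ?s" .
  then have "norm y * norm y \<le> norm x * norm y"
    using Cauchy_Schwarz_cinner[of x y] by (simp add: xy power2_eq_square)
  then have "norm y \<le> norm x"
    by (cases "norm y = 0") (simp_all add: mult_le_cancel_right)
  then show ?thesis
    using y power_mono[of "norm y" "norm x" 2] by simp
qed

lemma bessel_summable:
  assumes "orthogonal_system f"
  shows "summable (\<lambda>n. (cmod (cinner x (f n)))\<^sup>2)"
  using bessel[OF assms] by (intro bounded_imp_summable[where B = "(norm x)\<^sup>2"]) auto

lemma summable_orthogonal_system:
  assumes f: "orthogonal_system f" and c: "summable (\<lambda>n. (cmod (c n))\<^sup>2)"
  shows "summable (\<lambda>n. c n *\<^sub>C f n)"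
proof (subst summable_Cauchy, intro allI impI)
  fix e :: real assume e: "e > 0"
  then obtain N where N: "\<And>m n. m \<ge> N \<Longrightarrow> norm (\<Sum>i\<in>{m..<n}. (cmod (c i))\<^sup>2) < e\<^sup>2"
    using c[unfolded summable_Cauchy] by (meson zero_less_power)
  have "norm (\<Sum>i\<in>{m..<n}. c i *\<^sub>C f i) < e" if "m \<ge> N" for m n
  proof -
    have "(norm (\<Sum>i\<in>{m..<n}. c i *\<^sub>C f i))\<^sup>2 = (\<Sum>i\<in>{m..<n}. (cmod (c i))\<^sup>2 * norm (f i))"
      by (rule norm_sum_orthogonal_system[OF f]) simp
    also have "\<dots> \<le> (\<Sum>i\<in>{m..<n}. (cmod (c i))\<^sup>2 * 1)"
      by (intro sum_mono mult_left_mono orthogonal_system_norm_le[OF f]) auto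
    also have "\<dots> < e\<^sup>2"
      using N[OF that, of n] by simp
    finally show ?thesis
      using e by (simp add: power2_less_imp_less)
  qed
  then show "\<exists>N. \<forall>m\<ge>N. \<forall>n. norm (\<Sum>i\<in>{m..<n}. c i *\<^sub>C f i) < e" by blast
qed

text \<open>
  If \<open>f\<close> and \<open>g\<close> are orthogonal systems with zeros in the same places, this is the partial isometry
  that maps \<open>f n\<close> to \<open>g n\<close> and vanishes on the orthogonal complement of \<open>f\<close>. In particular
  \<open>partial_isometry f f\<close> is the projection onto the closed span of \<open>f\<close>, so that completeness of
  \<open>f\<close> reads \<open>partial_isometry f f = id_blinfun\<close>. Its adjoint is \<open>partial_isometry g f\<close>; hence
  all adjoints below are available explicitly.
\<close>
definition partial_isometry :: "(nat \<Rightarrow> 'a) \<Rightarrow> (nat \<Rightarrow> 'a) \<Rightarrow> 'a::chilbert_space \<Rightarrow>\<^sub>L 'a" where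
  "partial_isometry f g = Blinfun (\<lambda>x. \<Sum>n. cinner x (f n) *\<^sub>C g n)"

lemma partial_isometry_series:
  assumes f: "orthogonal_system f" and g: "orthogonal_system g"
  shows "norm (\<Sum>n. cinner x (f n) *\<^sub>C g n) \<le> norm x"
    and "(\<lambda>n. cinner x (f n) *\<^sub>C g n) sums blinfun_apply (partial_isometry f g) x"
proof -
  have S: "summable (\<lambda>n. cinner x (f n) *\<^sub>C g n)" for x
    by (rule summable_orthogonal_system[OF g bessel_summable[OF f]])
  have le: "norm (\<Sum>n. cinner x (f n) *\<^sub>C g n) \<le> norm x" for x
  proof (rule LIMSEQ_le_const2)
    show "(\<lambda>N. norm (\<Sum>n<N. cinner x (f n) *\<^sub>C g n)) \<longlonglongrightarrow> norm (\<Sum>n. cinner x (f n) *\<^sub>C g n)"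
      by (intro tendsto_norm summable_LIMSEQ S)
    have "norm (\<Sum>n<N. cinner x (f n) *\<^sub>C g n) \<le> norm x" for N
    proof (rule power2_le_imp_le)
      have "(norm (\<Sum>n<N. cinner x (f n) *\<^sub>C g n))\<^sup>2
          = (\<Sum>n<N. (cmod (cinner x (f n)))\<^sup>2 * norm (g n))"
        by (rule norm_sum_orthogonal_system[OF g]) simp
      also have "\<dots> \<le> (\<Sum>n<N. (cmod (cinner x (f n)))\<^sup>2 * 1)"
        by (intro sum_mono mult_left_mono orthogonal_system_norm_le[OF g]) auto
      also have "\<dots> \<le> (norm x)\<^sup>2" using bessel[OF f, of "{..<N}" x] by simp
      finally show "(norm (\<Sum>n<N. cinner x (f n) *\<^sub>C g n))\<^sup>2 \<le> (norm x)\<^sup>2" .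
    qed simp
    then show "\<exists>N. \<forall>n\<ge>N. norm (\<Sum>n<n. cinner x (f n) *\<^sub>C g n) \<le> norm x" by blast
  qed
  then show "norm (\<Sum>n. cinner x (f n) *\<^sub>C g n) \<le> norm x" .
  have "bounded_linear (\<lambda>x. \<Sum>n. cinner x (f n) *\<^sub>C g n)"
  proof (rule bounded_linear_intro[where K = 1])
    show "(\<Sum>n. cinner (x + y) (f n) *\<^sub>C g n)
        = (\<Sum>n. cinner x (f n) *\<^sub>C g n) + (\<Sum>n. cinner y (f n) *\<^sub>C g n)" for x y
      by (simp add: cinner_add_left scaleC_add_left suminf_add S)
    show "(\<Sum>n. cinner (r *\<^sub>R x) (f n) *\<^sub>C g n) = r *\<^sub>R (\<Sum>n. cinner x (f n) *\<^sub>C g n)" for r x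
    proof -
      have "cinner (r *\<^sub>R x) (f n) *\<^sub>C g n = r *\<^sub>R (cinner x (f n) *\<^sub>C g n)" for n
        by (simp add: scaleR_eq_scaleC scaleC_scaleC cinner_scaleC_left)
      then show ?thesis
        by (simp only: suminf_scaleR_right[OF S])
    qed
  qed (simp add: le)
  then show "(\<lambda>n. cinner x (f n) *\<^sub>C g n) sums blinfun_apply (partial_isometry f g) x"
    unfolding partial_isometry_def using S by (simp add: bounded_linear_Blinfun_apply summable_sums)
qed

lemmas partial_isometry_sums = partial_isometry_series(2)

lemma partial_isometry_contraction:
  assumes f: "orthogonal_system f" and g: "orthogonal_system g"
  shows "partial_isometry f g \<in> contractions"
proof (rule contractionsI)
  fix c x
  have "(\<lambda>n. c *\<^sub>C (cinner x (f n) *\<^sub>C g n)) sums (c *\<^sub>C partial_isometry f g x)"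
    by (intro bounded_linear.sums[OF bounded_linear_scaleC_right] partial_isometry_sums f g)
  with partial_isometry_sums[OF f g, of "c *\<^sub>C x"] 
  show "partial_isometry f g (c *\<^sub>C x) = c *\<^sub>C partial_isometry f g x"
    by (simp add: cinner_scaleC_left scaleC_scaleC sums_iff)
next
  show "norm (partial_isometry f g x) \<le> norm x" for x
    using partial_isometry_sums[OF f g, of x] partial_isometry_series(1)[OF f g, of x] by (simp add: sums_iff)
qed

lemma partial_isometry_scaleC:
  assumes f: "orthogonal_system f" and g: "orthogonal_system g"
  shows "partial_isometry f g (c *\<^sub>C x) = c *\<^sub>C partial_isometry f g x"
  using partial_isometry_contraction[OF assms] by (simp add: contractions_def bounded_operators_scaleC)

lemma partial_isometry_adjoint:
  assumes f: "orthogonal_system f" and g: "orthogonal_system g"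
  shows "cinner (partial_isometry f g x) z = cinner x (partial_isometry g f z)"
proof -
  have "(\<lambda>n. cinner (cinner x (f n) *\<^sub>C g n) z) sums cinner (partial_isometry f g x) z"
    by (intro bounded_linear.sums[OF bounded_linear_cinner_left] partial_isometry_sums f g)
  moreover have "(\<lambda>n. cinner x (cinner z (g n) *\<^sub>C f n)) sums cinner x (partial_isometry g f z)"
    by (intro bounded_linear.sums[OF bounded_linear_cinner_right] partial_isometry_sums f g)
  moreover have "cinner (cinner x (f n) *\<^sub>C g n) z = cinner x (cinner z (g n) *\<^sub>C f n)" for n
    using cinner_commute[of "g n" z] by (simp add: cinner_simps)
  ultimately show ?thesis
    using sums_unique2 by force
qed

lemma partial_isometry_apply_system:
  assumes f: "orthogonal_system f" and g: "orthogonal_system g"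
    and fg: "norm (f n) = norm (g n)"
  shows "partial_isometry f g (f n) = g n"
proof -
  have "(\<lambda>m. if m = n then g n else 0) sums g n"
    by (rule sums_single)
  moreover have "cinner (f n) (f m) *\<^sub>C g m = (if m = n then g n else 0)" for m
    using fg orthogonal_system_norm[OF g, of n]
    by (elim disjE) (simp_all add: orthogonal_system_cinner[OF f])
  ultimately show ?thesis
    using partial_isometry_sums[OF f g, of "f n"] sums_unique2 by force
qed

lemma partial_isometry_coeff:
  assumes f: "orthogonal_system f" and g: "orthogonal_system g"
    and fg: "norm (f n) = norm (g n)"
  shows "cinner (partial_isometry f g x) (g n) = cinner x (f n)"
  using partial_isometry_adjoint[OF f g, of x "g n"] partial_isometry_apply_system[OF g f] fg by simp

lemma partial_isometry_compose:
  assumes f: "orthogonal_system f" and g: "orthogonal_system g" and h: "orthogonal_system h"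
    and fg: "\<And>n. norm (f n) = norm (g n)"
  shows "partial_isometry g h (partial_isometry f g x) = partial_isometry f h x"
  using partial_isometry_sums[OF g h, of "partial_isometry f g x"] partial_isometry_sums[OF f h, of x]
  by (simp add: partial_isometry_coeff[OF f g fg] sums_iff)

lemma cinner_partial_isometry_0:
  assumes f: "orthogonal_system f" and g: "orthogonal_system g"
    and "\<And>n. cinner (g n) z = 0"
  shows "cinner (partial_isometry f g x) z = 0"
proof -
  have "(\<lambda>n. cinner (cinner x (f n) *\<^sub>C g n) z) sums cinner (partial_isometry f g x) z"
    by (intro bounded_linear.sums[OF bounded_linear_cinner_left] partial_isometry_sums f g)
  then show ?thesis
    by (simp add: assms(3) cinner_scaleC_left sums_iff)
qed

lemma partial_isometry_residual:
  assumes f: "orthogonal_system f"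
  shows "cinner (x - partial_isometry f f x) (f n) = 0"
  by (simp add: cinner_diff_left partial_isometry_coeff[OF f f])

section \<open>Gram-Schmidt orthogonalisation\<close>

text \<open>
  The signum of a vector is its normalisation, and \<open>0\<close> for the zero vector; hence the result is an
  orthogonal system even for linearly dependent input.
\<close>
fun gram_schmidt :: "(nat \<Rightarrow> 'a::chilbert_space) \<Rightarrow> nat \<Rightarrow> 'a" where
  "gram_schmidt x n =
     sgn (x n - (\<Sum>j<n. cinner (x n) (gram_schmidt x j) *\<^sub>C gram_schmidt x j))"

declare gram_schmidt.simps [simp del]

definition residual :: "(nat \<Rightarrow> 'a::chilbert_space) \<Rightarrow> nat \<Rightarrow> 'a" where
  "residual x n = x n - (\<Sum>j<n. cinner (x n) (gram_schmidt x j) *\<^sub>C gram_schmidt x j)"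

lemma gram_schmidt_residual: "gram_schmidt x n = sgn (residual x n)"
  by (simp add: residual_def gram_schmidt.simps[of x n])

lemma norm_gram_schmidt: "norm (gram_schmidt x n) \<in> {0, 1}"
  by (simp add: gram_schmidt_residual norm_sgn)

lemma gram_schmidt_orthogonal_aux:
  "m < n \<Longrightarrow> cinner (residual x n) (gram_schmidt x m) = 0 \<and> cinner (gram_schmidt x n) (gram_schmidt x m) = 0"
proof (induction n arbitrary: m rule: less_induct)
  case (less n)
  let ?g = "gram_schmidt x"
  have orth: "cinner (?g j) (?g m) = (if j = m then of_real (norm (?g m)) else 0)" if "j < n" for j
  proof -
    consider "j = m" | "j < m" | "m < j" by linarith
    then show ?thesis
    proof cases
      case 1
      then show ?thesis using norm_gram_schmidt[of x m] by (auto simp: cinner_self)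
    next
      case 2
      then show ?thesis using less.IH[OF less.prems, of j] by (simp add: cinner_eq_0_commute)
    next
      case 3
      then show ?thesis using less.IH[OF that] by simp
    qed
  qed
  have "cinner (residual x n) (?g m)
      = cinner (x n) (?g m) - (\<Sum>j<n. cinner (x n) (?g j) * cinner (?g j) (?g m))"
    by (simp add: residual_def cinner_simps cinner_sum_left)
  also have "(\<Sum>j<n. cinner (x n) (?g j) * cinner (?g j) (?g m))
      = (\<Sum>j<n. if j = m then cinner (x n) (?g m) * of_real (norm (?g m)) else 0)"
    by (intro sum.cong refl) (simp add: orth)
  also have "\<dots> = cinner (x n) (?g m)"
    using less.prems norm_gram_schmidt[of x m] by auto
  finally have 0: "cinner (residual x n) (?g m) = 0" by simp
  then show ?case
    by (simp add: gram_schmidt_residual[of x n] sgn_div_norm cinner_scaleR_left)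
qed

lemma orthogonal_system_gram_schmidt: "orthogonal_system (gram_schmidt x)"
  unfolding orthogonal_system_def
proof (intro conjI allI impI norm_gram_schmidt)
  fix m n :: nat assume "m \<noteq> n"
  then consider "m < n" | "n < m" by linarith
  then show "cinner (gram_schmidt x m) (gram_schmidt x n) = 0"
    by cases (use gram_schmidt_orthogonal_aux cinner_eq_0_commute in blast)+
qed

lemma gram_schmidt_projection_fixes: "partial_isometry (gram_schmidt x) (gram_schmidt x) (x n) = x n"
proof -
  let ?g = "gram_schmidt x" and ?P = "partial_isometry (gram_schmidt x) (gram_schmidt x)"
  note G = orthogonal_system_gram_schmidt[of x]
  have C: "?P (c *\<^sub>C z) = c *\<^sub>C ?P z" for c z
    using partial_isometry_contraction[OF G G] by (simp add: contractions_def bounded_operators_scaleC)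
  have r: "residual x n = norm (residual x n) *\<^sub>R ?g n"
    by (cases "residual x n = 0") (auto simp: gram_schmidt_residual sgn_div_norm)
  define z where "z = norm (residual x n) *\<^sub>R ?g n + (\<Sum>j<n. cinner (x n) (?g j) *\<^sub>C ?g j)"
  have x: "x n = z"
    unfolding z_def
    unfolding r[symmetric] by (simp add: residual_def)
  have "?P z = z"
    unfolding z_def
    by (simp add: blinfun.add_right blinfun.scaleR_right blinfun.sum_right C partial_isometry_apply_system[OF G G])
  then show ?thesis by (simp only: x)
qed

lemma gram_schmidt_in_span: "gram_schmidt x n \<in> complex_vector.span (range x)"
proof (induction n rule: less_induct)
  case (less n)
  have "residual x n \<in> complex_vector.span (range x)"
    unfolding residual_def
    by (intro complex_vector.span_diff complex_vector.span_sum complex_vector.span_scale less)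
      (auto intro: complex_vector.span_base)
  then show ?case
    by (auto simp: gram_schmidt_residual sgn_div_norm scaleR_eq_scaleC intro: complex_vector.span_scale)
qed

text \<open>
  Every coefficient in the recursion is determined by inner products of the input vectors. This is
  how equality of Gram matrices turns into an isometry: the two orthogonalised systems correspond to
  each other.
\<close>
lemma gram_schmidt_cong_gram:
  fixes x y :: "nat \<Rightarrow> 'a::chilbert_space"
  assumes "\<And>m n. cinner (x m) (x n) = cinner (y m) (y n)"
  shows "cinner (x m) (gram_schmidt x n) = cinner (y m) (gram_schmidt y n)"
    and "norm (gram_schmidt x n) = norm (gram_schmidt y n)"
proof -
  have *: "(\<forall>m. cinner (x m) (gram_schmidt x n) = cinner (y m) (gram_schmidt y n)) \<and>
      norm (residual x n) = norm (residual y n)" for n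
  proof (induction n rule: less_induct)
    case (less n)
    have c: "cinner (x m) (residual x n) = cinner (y m) (residual y n)" for m
      using less by (simp add: residual_def cinner_simps cinner_sum_right assms)
    have nr: "complex_of_real ((norm (residual z n))\<^sup>2) = cinner (z n) (residual z n)" for z :: "nat \<Rightarrow> 'a"
    proof -
      have "cinner (gram_schmidt z j) (residual z n) = 0" if "j < n" for j
        using gram_schmidt_orthogonal_aux[OF that, of z] cinner_eq_0_commute by blast
      then have "cinner (\<Sum>j<n. cinner (z n) (gram_schmidt z j) *\<^sub>C gram_schmidt z j) (residual z n) = 0"
        by (simp add: cinner_sum_left cinner_simps)
      then show ?thesis
        unfolding cinner_self[symmetric]
        by (subst residual_def) (simp add: cinner_diff_left)
    qed
    have "complex_of_real ((norm (residual x n))\<^sup>2) = complex_of_real ((norm (residual y n))\<^sup>2)"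
      by (simp only: nr c)
    then have "norm (residual x n) = norm (residual y n)"
      by (simp only: of_real_eq_iff) simp
    then show ?case
      using c by (simp add: gram_schmidt_residual sgn_div_norm cinner_simps)
  qed
  show "cinner (x m) (gram_schmidt x n) = cinner (y m) (gram_schmidt y n)"
    using * by blast
  show "norm (gram_schmidt x n) = norm (gram_schmidt y n)"
    using *[of n] norm_eq_zero[of "residual x n"] norm_eq_zero[of "residual y n"]
    by (simp add: gram_schmidt_residual norm_sgn del: norm_eq_zero)
qed

lemma partial_isometry_gram_schmidt:
  fixes x y :: "nat \<Rightarrow> 'a::chilbert_space"
  assumes "\<And>m n. cinner (x m) (x n) = cinner (y m) (y n)"
  shows "partial_isometry (gram_schmidt x) (gram_schmidt y) (x n) = y n"
proof -
  note G = orthogonal_system_gram_schmidt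
  have "(\<lambda>j. cinner (y n) (gram_schmidt y j) *\<^sub>C gram_schmidt y j) sums y n"
    using partial_isometry_sums[OF G G, of "y n" y y] by (simp add: gram_schmidt_projection_fixes)
  then show ?thesis
    using partial_isometry_sums[OF G G, of "x n" x y] sums_unique2
    by (simp add: gram_schmidt_cong_gram(1)[of x y, OF assms]) blast
qed

lemma closed_fixed_points_blinfun:
  fixes A :: "'a::real_normed_vector \<Rightarrow>\<^sub>L 'a"
  shows "closed {x. blinfun_apply A x = x}"
  by (intro closed_Collect_eq continuous_intros)

text \<open>
  Gram-Schmidt applied to a dense sequence gives a complete system. It has infinitely many nonzero
  members, since finitely many would span the space; enumerating these gives the basis.
\<close>
lemma orthonormal_basis_exists:
  assumes sep: "separable_space (euclidean :: 'h::chilbert_space topology)"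
    and inf: "\<nexists>B :: 'h::chilbert_space set. finite B \<and> complex_vector.span B = UNIV"
  obtains e :: "nat \<Rightarrow> 'h::chilbert_space" where
    "orthogonal_system e" "\<And>n. norm (e n) = 1" "partial_isometry e e = id_blinfun"
proof -
  obtain D :: "'h::chilbert_space set" where D: "countable D" "closure D = UNIV"
    using sep by (auto simp: separable_space_def)
  then have "D \<noteq> {}" by auto
  define x where "x = from_nat_into D"
  have x: "range x = D"
    unfolding x_def using D(1) \<open>D \<noteq> {}\<close> by (rule range_from_nat_into[rotated])
  let ?f = "gram_schmidt x"
  note F = orthogonal_system_gram_schmidt[of x]
  have "D \<subseteq> {z. partial_isometry ?f ?f z = z}"
    using gram_schmidt_projection_fixes[of x] x by auto
  then have "closure D \<subseteq> {z. partial_isometry ?f ?f z = z}"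
    by (rule closure_minimal[OF _ closed_fixed_points_blinfun])
  then have full: "partial_isometry ?f ?f z = z" for z
    using D(2) by auto
  have infN: "infinite {n. ?f n \<noteq> 0}" (is "infinite ?N")
  proof
    assume fin: "finite ?N"
    have "z \<in> complex_vector.span (?f ` ?N)" for z
    proof -
      have "(\<lambda>n. cinner z (?f n) *\<^sub>C ?f n) sums (\<Sum>n\<in>?N. cinner z (?f n) *\<^sub>C ?f n)"
        by (rule sums_finite[OF fin]) auto
      then have "z = (\<Sum>n\<in>?N. cinner z (?f n) *\<^sub>C ?f n)"
        using partial_isometry_sums[OF F F, of z] full sums_unique2 by metis
      moreover have "(\<Sum>n\<in>?N. cinner z (?f n) *\<^sub>C ?f n) \<in> complex_vector.span (?f ` ?N)"
        by (intro complex_vector.span_sum complex_vector.span_scale complex_vector.span_base) blast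
      ultimately show ?thesis by simp
    qed
    then show False using inf fin by (metis UNIV_eq_I finite_imageI)
  qed
  define e where "e = (\<lambda>n. ?f (enumerate ?N n))"
  have inj: "inj (enumerate ?N)" 
    using infN by (simp add: strict_mono_enumerate strict_mono_imp_inj_on)
  have e1: "norm (e n) = 1" for n
    using enumerate_in_set[OF infN, of n] norm_gram_schmidt[of x "enumerate ?N n"]
    by (auto simp: e_def)
  have E: "orthogonal_system e"
    using F inj e1 unfolding orthogonal_system_def e_def by (simp add: inj_eq)
  have "partial_isometry e e z = z" for z
  proof -
    define y where "y = z - partial_isometry e e z"
    have "cinner y (?f n) = 0" for n
    proof (cases "n \<in> ?N")
      case True
      then obtain k where "n = enumerate ?N k"
        using infN by (metis enumerate_Ex)
      then show ?thesis using partial_isometry_residual[OF E, of z k] by (simp add: y_def e_def)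
    qed simp
    then have "y = 0"
      using partial_isometry_sums[OF F F, of y] by (simp add: full sums_iff)
    then show ?thesis by (simp add: y_def)
  qed
  then have "partial_isometry e e = id_blinfun" by (intro blinfun_eqI) simp
  with E e1 show thesis by (rule that)
qed

section \<open>Convex combinations of semigroups as limits of semigroups\<close>

lemma norm_partial_isometry_total:
  assumes e: "orthogonal_system e" "partial_isometry e e = id_blinfun" and f: "orthogonal_system f"
    and ef: "\<And>n. norm (e n) = norm (f n)"
  shows "norm (partial_isometry e f x) = norm x"
proof (rule antisym)
  show "norm (partial_isometry e f x) \<le> norm x"
    by (intro contractions_norm_le partial_isometry_contraction e f)
  have "norm (partial_isometry f e (partial_isometry e f x)) \<le> norm (partial_isometry e f x)"
    by (intro contractions_norm_le partial_isometry_contraction e f)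
  then show "norm x \<le> norm (partial_isometry e f x)"
    by (simp add: partial_isometry_compose[OF e(1) f e(1) ef] e)
qed

text \<open>
  The maps are contractions, so it is enough that they eventually agree with the scalar \<open>c\<close> on each
  member of a complete system.
\<close>
lemma partial_isometry_tendsto_diagonal:
  assumes e: "orthogonal_system e" "partial_isometry e e = id_blinfun"
    and f: "\<And>k. orthogonal_system (f k)"
    and fe: "\<And>k n. n < k \<Longrightarrow> partial_isometry (f k) e (e n) = c *\<^sub>R e n"
  shows "(\<lambda>k. partial_isometry (f k) e x) \<longlonglongrightarrow> c *\<^sub>R x"
proof (rule LIMSEQ_I)
  fix r :: real assume r: "r > 0"
  define p where "p N = (\<Sum>n<N. cinner x (e n) *\<^sub>C e n)" for N
  have "p \<longlonglongrightarrow> x"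
    using partial_isometry_sums[OF e(1) e(1), of x] by (simp add: sums_def p_def[abs_def] e)
  then obtain N where N: "norm (p N - x) < r / (1 + \<bar>c\<bar>)"
    using LIMSEQ_D[of p x "r / (1 + \<bar>c\<bar>)"] r by fastforce
  have "norm (partial_isometry (f k) e x - c *\<^sub>R x) < r" if "k \<ge> N" for k
  proof -
    note C = partial_isometry_contraction[OF f[of k] e(1)]
    have "partial_isometry (f k) e (p N) = c *\<^sub>R p N"
      using that C
      by (simp add: p_def blinfun.sum_right contractions_def bounded_operators_scaleC fe
          scaleR_sum_right) (simp add: scaleR_eq_scaleC scaleC_scaleC mult.commute)
    then have "partial_isometry (f k) e x - c *\<^sub>R x
        = partial_isometry (f k) e (x - p N) + c *\<^sub>R (p N - x)"
      by (simp add: blinfun.diff_right scaleR_diff_right)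
    also have "norm \<dots> \<le> norm (x - p N) + \<bar>c\<bar> * norm (p N - x)"
      by (rule order_trans[OF norm_triangle_ineq]) (simp add: contractions_norm_le[OF C])
    also have "\<dots> = (1 + \<bar>c\<bar>) * norm (p N - x)"
      by (simp add: norm_minus_commute algebra_simps)
    also have "\<dots> < r"
      using N by (simp add: field_simps)
    finally show ?thesis .
  qed
  then show "\<exists>N. \<forall>k\<ge>N. norm (partial_isometry (f k) e x - c *\<^sub>R x) < r" by blast
qed

text \<open>
  Since \<open>e\<close> is complete, \<open>partial_isometry e f\<close> and \<open>partial_isometry e g\<close> are isometries of the
  whole space with orthogonal ranges. Together they form an isometry \<open>J\<close> of \<open>H \<oplus> H\<close> into \<open>H\<close>; the
  space \<open>H \<oplus> H\<close> itself never has to be constructed.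
\<close>
locale isometry_pair =
  fixes e f g :: "nat \<Rightarrow> 'h::chilbert_space"
  assumes e: "orthogonal_system e" "partial_isometry e e = id_blinfun"
    and f: "orthogonal_system f" and g: "orthogonal_system g"
    and ef: "\<And>n. norm (e n) = norm (f n)" and eg: "\<And>n. norm (e n) = norm (g n)"
    and fg: "\<And>m n. cinner (f m) (g n) = 0"
begin

definition remainder :: "'h \<Rightarrow> 'h" where
  "remainder x = x - partial_isometry f f x - partial_isometry g g x"

text \<open>
  In terms of the isometry \<open>J\<close> of \<open>H \<oplus> H\<close> into \<open>H\<close> this is \<open>J (A \<oplus> B) J\<^sup>* + (I - J J\<^sup>*)\<close>,
  and \<open>remainder\<close> is the projection \<open>I - J J\<^sup>*\<close>.
\<close>
definition dilation :: "('h \<Rightarrow>\<^sub>L 'h) \<Rightarrow> ('h \<Rightarrow>\<^sub>L 'h) \<Rightarrow> 'h \<Rightarrow>\<^sub>L 'h" where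
  "dilation A B = (partial_isometry e f o\<^sub>L A o\<^sub>L partial_isometry f e)
     + (partial_isometry e g o\<^sub>L B o\<^sub>L partial_isometry g e)
     + (id_blinfun - partial_isometry f f - partial_isometry g g)"

lemma dilation_apply:
  "dilation A B x = partial_isometry e f (A (partial_isometry f e x))
     + partial_isometry e g (B (partial_isometry g e x)) + remainder x"
  by (simp add: dilation_def remainder_def blinfun.add_left blinfun.diff_left)

lemma fg_swapped: "cinner (g m) (f n) = 0"
  using fg cinner_eq_0_commute by blast

lemma partial_isometry_cross_0: "partial_isometry f e (partial_isometry e g x) = 0"
    "partial_isometry g e (partial_isometry e f x) = 0"
  using partial_isometry_sums[OF f e(1), of "partial_isometry e g x"]
    partial_isometry_sums[OF g e(1), of "partial_isometry e f x"]
    cinner_partial_isometry_0[OF e(1) g fg_swapped] cinner_partial_isometry_0[OF e(1) f fg]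
  by (simp_all add: sums_iff)

lemma partial_isometry_inverse: "partial_isometry f e (partial_isometry e f x) = x"
    "partial_isometry g e (partial_isometry e g x) = x"
  by (simp_all add: partial_isometry_compose[OF e(1) f e(1) ef]
      partial_isometry_compose[OF e(1) g e(1) eg] e(2))

lemma split_identity:
  "x = partial_isometry e f (partial_isometry f e x)
     + partial_isometry e g (partial_isometry g e x) + remainder x"
  using partial_isometry_compose[OF f e(1) f ef[symmetric], of x]
    partial_isometry_compose[OF g e(1) g eg[symmetric], of x]
  by (simp add: remainder_def)

lemma partial_isometry_remainder_0: "partial_isometry f e (remainder x) = 0"
    "partial_isometry g e (remainder x) = 0"
proof -
  have "partial_isometry f e x = partial_isometry f e 
      (partial_isometry e f (partial_isometry f e x) + partial_isometry e g (partial_isometry g e x)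
        + remainder x)"
    using split_identity[of x] by simp
  then show "partial_isometry f e (remainder x) = 0"
    by (simp add: blinfun.add_right partial_isometry_inverse partial_isometry_cross_0)
  have "partial_isometry g e x = partial_isometry g e 
      (partial_isometry e f (partial_isometry f e x) + partial_isometry e g (partial_isometry g e x)
        + remainder x)"
    using split_identity[of x] by simp
  then show "partial_isometry g e (remainder x) = 0"
    by (simp add: blinfun.add_right partial_isometry_inverse partial_isometry_cross_0)
qed

lemma remainder_partial_isometry: "remainder (partial_isometry e f x) = 0"
    "remainder (partial_isometry e g x) = 0"
  using split_identity[of "partial_isometry e f x"] split_identity[of "partial_isometry e g x"]
  by (simp_all add: partial_isometry_inverse partial_isometry_cross_0)

lemma remainder_remainder: "remainder (remainder x) = remainder x"
  using split_identity[of "remainder x"] by (simp add: partial_isometry_remainder_0)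

lemma remainder_add: "remainder (x + y) = remainder x + remainder y"
  by (simp add: remainder_def blinfun.add_right)

lemma dilation_compose: "dilation (A o\<^sub>L A') (B o\<^sub>L B') = dilation A B o\<^sub>L dilation A' B'"
  by (rule blinfun_eqI)
    (simp add: dilation_apply blinfun.add_right remainder_add partial_isometry_inverse
      partial_isometry_cross_0 partial_isometry_remainder_0 remainder_partial_isometry
      remainder_remainder)

lemma dilation_id: "dilation id_blinfun id_blinfun = id_blinfun"
  by (rule blinfun_eqI) (simp add: dilation_apply split_identity[symmetric])

lemma norm_split:
  "(norm (partial_isometry e f a + partial_isometry e g b + remainder x))\<^sup>2
     = (norm a)\<^sup>2 + (norm b)\<^sup>2 + (norm (remainder x))\<^sup>2"
proof -
  have ab: "cinner (partial_isometry e f a) (partial_isometry e g b) = 0"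
    by (simp add: partial_isometry_adjoint[OF e(1) f] partial_isometry_cross_0)
  have "cinner (partial_isometry e f a + partial_isometry e g b) (remainder x) = 0"
    by (simp add: cinner_add_left partial_isometry_adjoint[OF e(1) f]
        partial_isometry_adjoint[OF e(1) g] partial_isometry_remainder_0)
  then show ?thesis
    by (simp add: pythagoras ab norm_partial_isometry_total[OF e f ef]
      norm_partial_isometry_total[OF e g eg])
qed

lemma norm_split_identity:
  "(norm x)\<^sup>2 = (norm (partial_isometry f e x))\<^sup>2 + (norm (partial_isometry g e x))\<^sup>2 + (norm (remainder x))\<^sup>2"
  by (subst (1) split_identity) (rule norm_split)

lemma dilation_contraction:
  assumes A: "A \<in> contractions" and B: "B \<in> contractions"
  shows "dilation A B \<in> contractions"
proof (rule contractionsI)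
  fix x
  have "(norm (dilation A B x))\<^sup>2
      = (norm (A (partial_isometry f e x)))\<^sup>2 + (norm (B (partial_isometry g e x)))\<^sup>2 + (norm (remainder x))\<^sup>2"
    by (simp add: dilation_apply norm_split)
  also have "\<dots> \<le> (norm x)\<^sup>2"
    unfolding norm_split_identity[of x]
    by (intro add_mono power_mono contractions_norm_le A B order_refl norm_ge_zero)
  finally show "norm (dilation A B x) \<le> norm x"
    by (rule power2_le_imp_le) simp
next
  fix c x
  show "dilation A B (c *\<^sub>C x) = c *\<^sub>C dilation A B x"
    using A B by (simp add: dilation_apply remainder_def partial_isometry_scaleC e f g contractions_def
        bounded_operators_scaleC complex_vector.scale_right_distrib complex_vector.scale_right_diff_distrib)
qed

lemma cinner_dilation:
  "cinner (dilation A B x) y = cinner (A (partial_isometry f e x)) (partial_isometry f e y)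
     + cinner (B (partial_isometry g e x)) (partial_isometry g e y) + cinner (remainder x) y"
  by (simp add: dilation_apply cinner_add_left partial_isometry_adjoint[OF e(1) f]
      partial_isometry_adjoint[OF e(1) g])

lemma dilation_semigroup:
  assumes S: "S \<in> contractive_semigroups M" and T: "T \<in> contractive_semigroups M"
    and M: "submonoid_add M"
  shows "(\<lambda>t\<in>M. dilation (S t) (T t)) \<in> contractive_semigroups M"
proof -
  have "continuous_on M (\<lambda>t. S t y)" "continuous_on M (\<lambda>t. T t y)" for y
    using S T
    by (simp_all add: contractive_semigroups_def continuous_on_strong_operator_topo_iff_coordinatewise)
  then have "continuous_on M (\<lambda>t. dilation (S t) (T t) x)" for x
    unfolding dilation_apply
    by (intro continuous_on_add continuous_on_const
        bounded_linear.continuous_on[OF blinfun.bounded_linear_right])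
  then have "continuous_map (top_of_set M) strong_operator_topology (\<lambda>t\<in>M. dilation (S t) (T t))"
    unfolding continuous_on_strong_operator_topo_iff_coordinatewise continuous_map_iff_continuous
    by (auto intro: continuous_on_eq)
  moreover have "dilation (S t) (T t) \<in> contractions" if "t \<in> M" for t
    using S T that by (intro dilation_contraction) (auto simp: contractive_semigroups_def)
  ultimately show ?thesis
    using S T M by (auto simp: contractive_semigroups_def submonoid_add_def dilation_id dilation_compose)
qed

end

text \<open>
  The systems \<open>e \<circ> s\<close> and \<open>e \<circ> t\<close> are orthonormal and orthogonal to each other, so combining
  them with coefficients \<open>a\<close>, \<open>b\<close> on the unit circle gives an orthonormal system.
\<close>
lemma rotated_system:
  assumes e: "orthogonal_system e" "\<And>n. norm (e n) = 1"
    and s: "inj s" and t: "inj t" and st: "range s \<inter> range t = {}"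
    and uv: "a\<^sup>2 + b\<^sup>2 = 1"
  shows "orthogonal_system (\<lambda>n. a *\<^sub>R e (s n) + b *\<^sub>R e (t n))"
    and "norm (a *\<^sub>R e (s n) + b *\<^sub>R e (t n)) = 1"
proof -
  have ne: "s m \<noteq> t n" "t n \<noteq> s m" for m n
    using st by (auto simp: disjoint_iff)
  have E: "cinner (e m) (e n) = (if m = n then 1 else 0)" for m n
    using orthogonal_system_cinner[OF e(1), of m n] by (simp add: e(2))
  have "complex_of_real (a\<^sup>2 + b\<^sup>2) = 1"
    by (simp only: uv of_real_1)
  then have *: "cinner (a *\<^sub>R e (s m) + b *\<^sub>R e (t m)) (a *\<^sub>R e (s n) + b *\<^sub>R e (t n))
      = (if m = n then 1 else 0)" for m n
    using s t by (simp add: cinner_simps E ne inj_eq power2_eq_square)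
  have 1: "norm (a *\<^sub>R e (s n) + b *\<^sub>R e (t n)) = 1" for n
  proof -
    have "(norm (a *\<^sub>R e (s n) + b *\<^sub>R e (t n)))\<^sup>2 = 1"
      using *[of n n] by (simp only: norm_sq_cinner) simp
    then show ?thesis
      using power2_eq_1_iff[of "norm (a *\<^sub>R e (s n) + b *\<^sub>R e (t n))"]
        norm_ge_zero[of "a *\<^sub>R e (s n) + b *\<^sub>R e (t n)"] by linarith
  qed
  then show "norm (a *\<^sub>R e (s n) + b *\<^sub>R e (t n)) = 1" .
  show "orthogonal_system (\<lambda>n. a *\<^sub>R e (s n) + b *\<^sub>R e (t n))"
    using * 1 by (simp add: orthogonal_system_def)
qed

text \<open>
  Let \<open>X\<close> and \<open>Y\<close> be isometries with orthogonal ranges, given by injections of the index set, where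
  \<open>X\<close> fixes \<open>e n\<close> for \<open>n < k\<close>. Then \<open>J\<^sub>1 = a X + b Y\<close> and \<open>J\<^sub>2 = b X - a Y\<close> are
  isometries with orthogonal ranges and \<open>a J\<^sub>1 + b J\<^sub>2 = X\<close>. For \<open>n < k\<close> this gives
  \<open>J\<^sub>1\<^sup>* (e n) = a e n\<close> and \<open>J\<^sub>2\<^sup>* (e n) = b e n\<close>, and both adjoints converge strongly
  to scalars as \<open>k\<close> grows.
\<close>
lemma approximating_isometry_pairs:
  fixes e :: "nat \<Rightarrow> 'h::chilbert_space"
  assumes e: "orthogonal_system e" "\<And>n. norm (e n) = 1" "partial_isometry e e = id_blinfun"
    and ab: "a\<^sup>2 + b\<^sup>2 = 1"
  obtains f g where "\<And>k. isometry_pair e (f k) (g k)"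
    "\<And>x. (\<lambda>k. partial_isometry (f k) e x) \<longlonglongrightarrow> a *\<^sub>R x" "\<And>x. (\<lambda>k. partial_isometry (g k) e x) \<longlonglongrightarrow> b *\<^sub>R x"
proof -
  \<comment> \<open>The map \<open>s k\<close> is the identity below \<open>k\<close> and even from \<open>2 k\<close> on; the map \<open>t k\<close>
    takes odd values above \<open>2 k\<close>. So their ranges are disjoint, and an index below \<open>k\<close>
    is the image of itself under \<open>s k\<close> only.\<close>
  define s :: "nat \<Rightarrow> nat \<Rightarrow> nat" where "s k n = (if n < k then n else 2 * n)" for k n
  define t :: "nat \<Rightarrow> nat \<Rightarrow> nat" where "t k n = 2 * (n + k) + 1" for k n
  define f where "f k n = a *\<^sub>R e (s k n) + b *\<^sub>R e (t k n)" for k n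
  define g where "g k n = b *\<^sub>R e (s k n) + (- a) *\<^sub>R e (t k n)" for k n
  have s: "inj (s k)" for k by (auto simp: inj_def s_def)
  have t: "inj (t k)" for k by (auto simp: inj_def t_def)
  have ne: "s k m \<noteq> t k n" for k m n by (auto simp: s_def t_def) presburger+
  then have st: "range (s k) \<inter> range (t k) = {}" for k by auto
  have E: "cinner (e m) (e n) = (if m = n then 1 else 0)" for m n
    using orthogonal_system_cinner[OF e(1), of m n] by (simp add: e(2))
  have ba: "b\<^sup>2 + (- a)\<^sup>2 = 1" using ab by simp
  note F = rotated_system[OF e(1,2) s t st ab, folded f_def]
  note G = rotated_system[OF e(1,2) s t st ba, folded g_def]
  have F1: "orthogonal_system (f k)" for k
    using F(1)[of k] by (simp add: f_def[abs_def])
  have G1: "orthogonal_system (g k)" for k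
    using G(1)[of k] by (simp add: g_def[abs_def])
  have fg: "cinner (f k m) (g k n) = 0" for k m n
    using inj_eq[OF s] inj_eq[OF t] ne ne[symmetric]
    by (simp add: f_def g_def cinner_simps E)
  have pair: "isometry_pair e (f k) (g k)" for k
    by unfold_locales (use e F1 G1 F(2) G(2) fg in simp_all)
  have small: "(s k m = n) = (m = n)" "t k m \<noteq> n" if "n < k" for k m n
    using that by (auto simp: s_def t_def)
  have diag: "partial_isometry p e (e n) = c *\<^sub>R e n"
    if "orthogonal_system p" "\<And>m. cinner (e n) (p m) = (if m = n then of_real c else 0)" for p c n
  proof -
    have "(\<lambda>m. if m = n then c *\<^sub>R e n else 0) sums (c *\<^sub>R e n)"
      by (rule sums_single)
    moreover have "cinner (e n) (p m) *\<^sub>C e m = (if m = n then c *\<^sub>R e n else 0)" for m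
      by (simp add: that(2) scaleR_eq_scaleC)
    ultimately show ?thesis
      using partial_isometry_sums[OF that(1) e(1), of "e n"] sums_unique2 by force
  qed
  have ne': "n \<noteq> t k m" "(n = s k m) = (m = n)" if "n < k" for k m n
    using small[OF that, of m] by auto
  have "(\<lambda>k. partial_isometry (f k) e x) \<longlonglongrightarrow> a *\<^sub>R x" for x
    by (intro partial_isometry_tendsto_diagonal e F1 diag)
      (simp add: f_def cinner_simps E ne')
  moreover have "(\<lambda>k. partial_isometry (g k) e x) \<longlonglongrightarrow> b *\<^sub>R x" for x
    by (intro partial_isometry_tendsto_diagonal e G1 diag)
      (simp add: g_def cinner_simps E ne')
  ultimately show thesis using pair that by blast
qed

lemma contraction_form_diff:
  assumes "A \<in> contractions"
  shows "cmod (cinner (A x) y - cinner (A x') y') \<le> norm (x - x') * norm y + norm x' * norm (y - y')"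
proof -
  have "cinner (A x) y - cinner (A x') y' = cinner (A (x - x')) y + cinner (A x') (y - y')"
    by (simp add: blinfun.diff_right cinner_diff_left cinner_diff_right)
  also have "cmod \<dots> \<le> norm (A (x - x')) * norm y + norm (A x') * norm (y - y')"
    by (rule order_trans[OF norm_triangle_ineq]) (intro add_mono Cauchy_Schwarz_cinner)
  also have "\<dots> \<le> norm (x - x') * norm y + norm x' * norm (y - y')"
    by (intro add_mono mult_right_mono contractions_norm_le assms) auto
  finally show ?thesis .
qed

lemma convex_combination_wot_functions:
  assumes S: "S \<in> wot_functions M" and T: "T \<in> wot_functions M"
    and uv: "u \<ge> 0" "v \<ge> 0" "u + v = (1::real)"
  shows "(\<lambda>t\<in>M. u *\<^sub>R S t + v *\<^sub>R T t) \<in> wot_functions M"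
proof -
  have "u *\<^sub>R A + v *\<^sub>R B \<in> contractions" if A: "A \<in> contractions" and B: "B \<in> contractions"
    for A B :: "'b \<Rightarrow>\<^sub>L 'b"
  proof -
    have "norm (u *\<^sub>R A + v *\<^sub>R B) \<le> u * norm A + v * norm B"
      using uv by (intro order_trans[OF norm_triangle_ineq]) simp
    also have "\<dots> \<le> u * 1 + v * 1"
      using A B uv by (intro add_mono mult_left_mono) (auto simp: contractions_def)
    finally have "norm (u *\<^sub>R A + v *\<^sub>R B) \<le> 1" using uv by simp
    moreover have "u *\<^sub>R A + v *\<^sub>R B \<in> bounded_operators"
      using A B by (auto simp: contractions_def bounded_operators_def blinfun.add_left
          blinfun.scaleR_left scaleR_eq_scaleC scaleC_scaleC scaleC_add_right mult.commute)
    ultimately show ?thesis by (simp add: contractions_def)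
  qed
  then have "(\<lambda>t\<in>M. u *\<^sub>R S t + v *\<^sub>R T t) \<in> M \<rightarrow>\<^sub>E contractions"
    using S T by (auto simp: wot_functions_def)
  moreover have "continuous_on M (\<lambda>t. cinner ((\<lambda>t\<in>M. u *\<^sub>R S t + v *\<^sub>R T t) t x) y)" for x y
  proof (rule continuous_on_eq)
    show "continuous_on M (\<lambda>t. of_real u * cinner (S t x) y + of_real v * cinner (T t x) y)"
      using S T by (intro continuous_intros)
        (simp_all add: wot_functions_def continuous_map_weak_operator_topology_iff)
  qed (simp add: blinfun.add_left blinfun.scaleR_left cinner_simps)
  ultimately show ?thesis
    by (simp add: wot_functions_def continuous_map_weak_operator_topology_iff)
qed

text \<open>
  The matrix coefficients of the dilated semigroups are those of \<open>S\<close> and \<open>T\<close> at the vectors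
  \<open>J\<^sub>1\<^sup>* x\<close>, \<open>J\<^sub>2\<^sup>* x\<close>, which converge to \<open>sqrt u x\<close> and \<open>sqrt v x\<close>. As \<open>S t\<close> and \<open>T t\<close> are
  contractions, the error has a bound that does not depend on \<open>t\<close>.
\<close>
lemma convex_combination_limit_of_semigroups:
  fixes S T :: "'g::topological_group_add \<Rightarrow> 'h::chilbert_space \<Rightarrow>\<^sub>L 'h"
  assumes e: "orthogonal_system (e :: nat \<Rightarrow> 'h)" "\<And>n. norm (e n) = 1" "partial_isometry e e = id_blinfun"
    and S: "S \<in> contractive_semigroups M" and T: "T \<in> contractive_semigroups M"
    and M: "submonoid_add M"
    and uv: "u \<ge> 0" "v \<ge> 0" "u + v = (1::real)"
  obtains R where "\<And>k. R k \<in> contractive_semigroups M"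
    "limitin (kwot M) R (\<lambda>t\<in>M. u *\<^sub>R S t + v *\<^sub>R T t) sequentially"
proof -
  have "(sqrt u)\<^sup>2 + (sqrt v)\<^sup>2 = 1" using uv by simp
  from approximating_isometry_pairs[OF e this]
  obtain f g where fg: "\<And>k. isometry_pair e (f k) (g k)"
    and limf: "\<And>x. (\<lambda>k. partial_isometry (f k) e x) \<longlonglongrightarrow> sqrt u *\<^sub>R x"
    and limg: "\<And>x. (\<lambda>k. partial_isometry (g k) e x) \<longlonglongrightarrow> sqrt v *\<^sub>R x" by blast
  define R where "R k = (\<lambda>t\<in>M. isometry_pair.dilation e (f k) (g k) (S t) (T t))" for k
  have R: "R k \<in> contractive_semigroups M" for k
    unfolding R_def by (rule isometry_pair.dilation_semigroup[OF fg S T M])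
  let ?Z = "\<lambda>t\<in>M. u *\<^sub>R S t + v *\<^sub>R T t"
  have "uniform_limit K (\<lambda>k t. cinner (R k t x) y) (\<lambda>t. cinner (?Z t x) y) sequentially"
    if K: "K \<subseteq> M" for K x y
  proof -
    define F G where "F k z = partial_isometry (f k) e z" and "G k z = partial_isometry (g k) e z" for k z
    define Q where "Q k = isometry_pair.remainder (f k) (g k) x" for k
    define d where "d k = norm (F k x - sqrt u *\<^sub>R x) * norm (F k y)
        + norm (sqrt u *\<^sub>R x) * norm (F k y - sqrt u *\<^sub>R y)
        + (norm (G k x - sqrt v *\<^sub>R x) * norm (G k y)
        + norm (sqrt v *\<^sub>R x) * norm (G k y - sqrt v *\<^sub>R y)) + norm (Q k) * norm y" for k
    have F: "(\<lambda>k. F k z) \<longlonglongrightarrow> sqrt u *\<^sub>R z" and G: "(\<lambda>k. G k z) \<longlonglongrightarrow> sqrt v *\<^sub>R z" for z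
      using limf limg by (simp_all add: F_def G_def)
    \<comment> \<open>By Pythagoras the squared norm of the part of \<open>x\<close> orthogonal to both ranges tends to
      \<open>(1 - u - v) \<parallel>x\<parallel>\<^sup>2 = 0\<close>.\<close>
    have "(\<lambda>k. (norm x)\<^sup>2 - (norm (F k x))\<^sup>2 - (norm (G k x))\<^sup>2)
        \<longlonglongrightarrow> (norm x)\<^sup>2 - (norm (sqrt u *\<^sub>R x))\<^sup>2 - (norm (sqrt v *\<^sub>R x))\<^sup>2"
      by (intro tendsto_intros F G)
    also have "(\<lambda>k. (norm x)\<^sup>2 - (norm (F k x))\<^sup>2 - (norm (G k x))\<^sup>2) = (\<lambda>k. (norm (Q k))\<^sup>2)"
      unfolding F_def G_def Q_def using isometry_pair.norm_split_identity[OF fg, of x]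
      by (intro ext) (simp add: algebra_simps)
    also have "(norm x)\<^sup>2 - (norm (sqrt u *\<^sub>R x))\<^sup>2 - (norm (sqrt v *\<^sub>R x))\<^sup>2
        = (1 - u - v) * (norm x)\<^sup>2"
      using uv(1,2) by (simp add: power_mult_distrib algebra_simps)
    also have "\<dots> = 0" using uv by simp
    finally have "(\<lambda>k. sqrt ((norm (Q k))\<^sup>2)) \<longlonglongrightarrow> sqrt 0"
      by (rule tendsto_real_sqrt)
    then have Q: "(\<lambda>k. norm (Q k)) \<longlonglongrightarrow> 0" by simp
    have nF: "(\<lambda>k. norm (F k z - sqrt u *\<^sub>R z)) \<longlonglongrightarrow> 0"
      and nG: "(\<lambda>k. norm (G k z - sqrt v *\<^sub>R z)) \<longlonglongrightarrow> 0" for z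
      using tendsto_norm_zero[OF LIM_zero[OF F]] tendsto_norm_zero[OF LIM_zero[OF G]] by auto
    have "d \<longlonglongrightarrow> 0 * norm (sqrt u *\<^sub>R y) + norm (sqrt u *\<^sub>R x) * 0
        + (0 * norm (sqrt v *\<^sub>R y) + norm (sqrt v *\<^sub>R x) * 0) + 0 * norm y"
      unfolding d_def[abs_def] by (intro tendsto_intros nF nG F G Q)
    then have d: "d \<longlonglongrightarrow> 0" by simp
    have le: "dist (cinner (R k t x) y) (cinner (?Z t x) y) \<le> d k" if "t \<in> K" for k t
    proof -
      have t: "t \<in> M" using that K by blast
      have St: "S t \<in> contractions" and Tt: "T t \<in> contractions"
        using S T t by (auto simp: contractive_semigroups_def)
      have root: "cinner (A (sqrt w *\<^sub>R x)) (sqrt w *\<^sub>R y) = of_real w * cinner (A x) y"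
        if "w \<ge> 0" for w and A :: "'h \<Rightarrow>\<^sub>L 'h"
        using that by (simp add: blinfun.scaleR_right cinner_simps flip: mult.assoc of_real_mult)
      have "cinner (R k t x) y - cinner (?Z t x) y
          = (cinner (S t (F k x)) (F k y) - cinner (S t (sqrt u *\<^sub>R x)) (sqrt u *\<^sub>R y))
          + (cinner (T t (G k x)) (G k y) - cinner (T t (sqrt v *\<^sub>R x)) (sqrt v *\<^sub>R y))
          + cinner (Q k) y"
        using t root[OF uv(1), of "S t"] root[OF uv(2), of "T t"]
        by (simp add: R_def isometry_pair.cinner_dilation[OF fg] F_def G_def Q_def
            blinfun.add_left blinfun.scaleR_left[of _ "_ :: 'h \<Rightarrow>\<^sub>L 'h"] cinner_add_left cinner_scaleR_left)
      also have "cmod \<dots> \<le> d k"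
        unfolding d_def
        by (intro order_trans[OF norm_triangle_ineq] add_mono contraction_form_diff St Tt
            Cauchy_Schwarz_cinner)
      finally show ?thesis by (simp add: dist_norm)
    qed
    show ?thesis
    proof (rule uniform_limitI)
      fix r :: real assume "r > 0"
      with d have "\<forall>\<^sub>F k in sequentially. d k < r"
        by (rule order_tendstoD(2))
      then show "\<forall>\<^sub>F k in sequentially. \<forall>t\<in>K. dist (cinner (R k t x) y) (cinner (?Z t x) y) < r"
        by eventually_elim (blast intro: le_less_trans[OF le])
    qed
  qed
  moreover have "?Z \<in> wot_functions M"
    using S T contractive_semigroups_subset by (intro convex_combination_wot_functions uv) blast+
  moreover have "R k \<in> wot_functions M" for k
    using R contractive_semigroups_subset by blast
  ultimately have "limitin (kwot M) R ?Z sequentially"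
    unfolding limitin_kwot_iff by simp
  with R show thesis by (rule that)
qed

section \<open>Convexity of the closure\<close>

text \<open>
  Closure points are limits along filters; this makes the description of the topology by convergence
  applicable to closures.
\<close>
lemma closure_of_filter:
  assumes "x \<in> X closure_of S"
  obtains F where "F \<noteq> bot" "\<forall>\<^sub>F y in F. y \<in> S" "limitin X (\<lambda>y. y) x F"
proof
  define F where "F = inf (nhdsin X x) (principal S)"
  have x: "x \<in> topspace X" "\<And>U. openin X U \<Longrightarrow> x \<in> U \<Longrightarrow> \<exists>y\<in>S. y \<in> U"
    using assms by (auto simp: in_closure_of)
  have ev: "eventually P F \<longleftrightarrow> (\<exists>U. openin X U \<and> x \<in> U \<and> (\<forall>y\<in>U. y \<in> S \<longrightarrow> P y))" for P
    using x(1) by (simp add: F_def eventually_inf_principal eventually_nhdsin)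
  show "F \<noteq> bot"
    using x(2) by (force simp: trivial_limit_def ev)
  show "\<forall>\<^sub>F y in F. y \<in> S"
    using x(1) by (auto simp: ev intro!: exI[of _ "topspace X"])
  show "limitin X (\<lambda>y. y) x F"
    using x(1) by (auto simp: limitin_def ev)
qed

lemma limitin_compose_filterlim:
  assumes "limitin X f l F" "filterlim g F G"
  shows "limitin X (\<lambda>x. f (g x)) l G"
  using assms by (auto simp: limitin_def intro: eventually_compose_filterlim)

lemma limitin_kwot_convex_combination:
  assumes f: "limitin (kwot M) f S F" and g: "limitin (kwot M) g T F"
    and uv: "u \<ge> 0" "v \<ge> 0" "u + v = (1::real)"
  shows "limitin (kwot M) (\<lambda>i. \<lambda>t\<in>M. u *\<^sub>R f i t + v *\<^sub>R g i t) (\<lambda>t\<in>M. u *\<^sub>R S t + v *\<^sub>R T t) F"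
  unfolding limitin_kwot_iff
proof (intro conjI allI impI)
  note f' = f[unfolded limitin_kwot_iff] and g' = g[unfolded limitin_kwot_iff]
  show "(\<lambda>t\<in>M. u *\<^sub>R S t + v *\<^sub>R T t) \<in> wot_functions M"
    using f' g' uv by (intro convex_combination_wot_functions) auto
  have "\<forall>\<^sub>F i in F. f i \<in> wot_functions M" "\<forall>\<^sub>F i in F. g i \<in> wot_functions M"
    using f' g' by auto
  then show "\<forall>\<^sub>F i in F. (\<lambda>t\<in>M. u *\<^sub>R f i t + v *\<^sub>R g i t) \<in> wot_functions M"
    by eventually_elim (intro convex_combination_wot_functions uv)
  fix x y :: 'b and K assume K: "compact K \<and> K \<subseteq> M"
  have "uniform_limit K (\<lambda>i t. of_real u * cinner (f i t x) y + of_real v * cinner (g i t x) y)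
     (\<lambda>t. of_real u * cinner (S t x) y + of_real v * cinner (T t x) y) F"
    using f' g' K
    by (intro uniform_limit_add bounded_linear.uniform_limit[OF bounded_linear_mult_right]) auto
  then show "uniform_limit K (\<lambda>i t. cinner ((\<lambda>t\<in>M. u *\<^sub>R f i t + v *\<^sub>R g i t) t x) y)
     (\<lambda>t. cinner ((\<lambda>t\<in>M. u *\<^sub>R S t + v *\<^sub>R T t) t x) y) F"
    by (rule uniform_limit_cong'[THEN iffD1, rotated 2])
      (use K in \<open>auto simp: blinfun.add_left blinfun.scaleR_left cinner_simps\<close>)
qed

text \<open>
  Two filters converging to \<open>S\<close> and \<open>T\<close> have a product filter along which the convex combinations
  converge, and a closed set contains the limits of its members.
\<close>
lemma closure_of_pointwise_convex:
  fixes A :: "('g::topological_space \<Rightarrow> 'h::chilbert_space \<Rightarrow>\<^sub>L 'h) set"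
  assumes A: "\<And>S T u v. S \<in> A \<Longrightarrow> T \<in> A \<Longrightarrow> u \<ge> 0 \<Longrightarrow> v \<ge> 0 \<Longrightarrow> u + v = (1::real) \<Longrightarrow>
      (\<lambda>t\<in>M. u *\<^sub>R S t + v *\<^sub>R T t) \<in> kwot M closure_of A"
  shows "pointwise_convex M (kwot M closure_of A)"
  unfolding pointwise_convex_def
proof (intro ballI allI impI)
  fix S T and u v :: real
  assume S: "S \<in> kwot M closure_of A" and T: "T \<in> kwot M closure_of A"
    and uv: "0 \<le> u" "0 \<le> v" "u + v = 1"
  obtain F where F: "F \<noteq> bot" "\<forall>\<^sub>F y in F. y \<in> A" "limitin (kwot M) (\<lambda>y. y) S F"
    using closure_of_filter[OF S] .
  obtain G where G: "G \<noteq> bot" "\<forall>\<^sub>F y in G. y \<in> A" "limitin (kwot M) (\<lambda>y. y) T G"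
    using closure_of_filter[OF T] .
  let ?Z = "\<lambda>p. \<lambda>t\<in>M. u *\<^sub>R fst p t + v *\<^sub>R snd p t"
  have "limitin (kwot M) ?Z (\<lambda>t\<in>M. u *\<^sub>R S t + v *\<^sub>R T t) (F \<times>\<^sub>F G)"
    by (intro limitin_kwot_convex_combination uv limitin_compose_filterlim[OF F(3) filterlim_fst]
        limitin_compose_filterlim[OF G(3) filterlim_snd])
  moreover have "\<forall>\<^sub>F p in F \<times>\<^sub>F G. ?Z p \<in> kwot M closure_of A"
    using eventually_prodI[OF F(2) G(2)] by eventually_elim (auto intro: A uv)
  moreover have "F \<times>\<^sub>F G \<noteq> bot"
    using F(1) G(1) by (simp add: prod_filter_eq_bot)
  ultimately show "(\<lambda>t\<in>M. u *\<^sub>R S t + v *\<^sub>R T t) \<in> kwot M closure_of A"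
    by (intro limitin_closedin[OF _ closedin_closure_of]) auto
qed

section \<open>Compactly supported functions on a group\<close>

definition nonneg_Cc :: "('g::topological_space \<Rightarrow> real) set" where
  "nonneg_Cc = {f. continuous_on UNIV f \<and> (\<forall>x. 0 \<le> f x) \<and> (\<exists>K. compact K \<and> (\<forall>x. x \<notin> K \<longrightarrow> f x = 0))}"

text \<open>
  With this sign and order \<open>translate\<close> is a left action of the group, which need not be commutative.
\<close>
definition translate :: "'g::group_add \<Rightarrow> ('g \<Rightarrow> real) \<Rightarrow> 'g \<Rightarrow> real" where
  "translate s f = (\<lambda>x. f (- s + x))"

lemma translate_translate: "translate s (translate t f) = translate (s + t) f"
  by (simp add: translate_def minus_add add.assoc del: add_uminus_conv_diff)

lemma translate_0 [simp]: "translate 0 f = f"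
  by (simp add: translate_def)

lemma nonneg_CcI:
  assumes "continuous_on UNIV f" "\<And>x. 0 \<le> f x" "compact K" "\<And>x. x \<notin> K \<Longrightarrow> f x = 0"
  shows "f \<in> nonneg_Cc"
  using assms unfolding nonneg_Cc_def by blast

lemma nonneg_CcE:
  assumes "f \<in> nonneg_Cc"
  obtains K where "compact K" "\<And>x. x \<notin> K \<Longrightarrow> f x = 0"
  using assms unfolding nonneg_Cc_def by blast

lemma nonneg_Cc_continuous: "f \<in> nonneg_Cc \<Longrightarrow> continuous_on A f"
  by (auto simp: nonneg_Cc_def intro: continuous_on_subset)

lemma nonneg_Cc_nonneg: "f \<in> nonneg_Cc \<Longrightarrow> 0 \<le> f x"
  by (simp add: nonneg_Cc_def)

lemma nonneg_Cc_zero [simp]: "(\<lambda>x. 0) \<in> nonneg_Cc"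
  by (rule nonneg_CcI[of _ "{}"]) auto

lemma nonneg_Cc_add: 
  assumes "f \<in> nonneg_Cc" "g \<in> nonneg_Cc"
  shows "(\<lambda>x. f x + g x) \<in> nonneg_Cc"
proof -
  obtain K where K: "compact K" "\<And>x. x \<notin> K \<Longrightarrow> f x = 0" using nonneg_CcE[OF assms(1)] by blast
  obtain L where L: "compact L" "\<And>x. x \<notin> L \<Longrightarrow> g x = 0" using nonneg_CcE[OF assms(2)] by blast
  show ?thesis
    by (rule nonneg_CcI[of _ "K \<union> L"])
      (use assms K L in \<open>auto simp: nonneg_Cc_def intro!: continuous_on_add\<close>)
qed

lemma nonneg_Cc_mult_continuous:
  assumes "f \<in> nonneg_Cc" "continuous_on UNIV g" "\<And>x. 0 \<le> g x"
  shows "(\<lambda>x. g x * f x) \<in> nonneg_Cc"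
proof -
  obtain K where K: "compact K" "\<And>x. x \<notin> K \<Longrightarrow> f x = 0" using nonneg_CcE[OF assms(1)] by blast
  show ?thesis
    by (rule nonneg_CcI[of _ K])
      (use assms K in \<open>auto simp: nonneg_Cc_def intro!: continuous_on_mult\<close>)
qed

lemma nonneg_Cc_mult: "f \<in> nonneg_Cc \<Longrightarrow> g \<in> nonneg_Cc \<Longrightarrow> (\<lambda>x. g x * f x) \<in> nonneg_Cc"
  by (rule nonneg_Cc_mult_continuous) (auto simp: nonneg_Cc_def)

lemma nonneg_Cc_scale: "f \<in> nonneg_Cc \<Longrightarrow> 0 \<le> c \<Longrightarrow> (\<lambda>x. c * f x) \<in> nonneg_Cc"
  by (rule nonneg_Cc_mult_continuous) auto

lemma nonneg_Cc_sum:
  "(\<And>i. i \<in> A \<Longrightarrow> f i \<in> nonneg_Cc) \<Longrightarrow> (\<lambda>x. \<Sum>i\<in>A. f i x) \<in> nonneg_Cc"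
  by (induction A rule: infinite_finite_induct) (simp_all add: nonneg_Cc_add)

lemma nonneg_Cc_translate:
  fixes f :: "'g::topological_group_add \<Rightarrow> real"
  assumes "f \<in> nonneg_Cc"
  shows "translate s f \<in> nonneg_Cc"
proof -
  obtain K where K: "compact K" "\<And>x. x \<notin> K \<Longrightarrow> f x = 0" using nonneg_CcE[OF assms(1)] by blast
  show ?thesis
  proof (rule nonneg_CcI)
    show "continuous_on UNIV (translate s f)"
      unfolding translate_def
      by (rule continuous_on_compose2[OF nonneg_Cc_continuous[OF assms, of UNIV]])
        (auto intro!: continuous_intros)
    show "compact ((\<lambda>x. s + x) ` K)"
      by (intro compact_continuous_image K continuous_intros)
    fix x assume x: "x \<notin> (\<lambda>x. s + x) ` K"
    have "x = s + (- s + x)" by (simp add: add.assoc[symmetric])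
    with x have "- s + x \<notin> K" by blast
    then show "translate s f x = 0" by (simp add: translate_def K)
  qed (use assms in \<open>simp add: translate_def nonneg_Cc_nonneg\<close>)
qed

lemma nonneg_Cc_bounded:
  assumes "f \<in> nonneg_Cc"
  obtains B where "B > 0" "\<And>x. f x \<le> B"
proof -
  obtain K where K: "compact K" "\<And>x. x \<notin> K \<Longrightarrow> f x = 0" using nonneg_CcE[OF assms(1)] by blast
  have "compact (f ` K)"
    by (intro compact_continuous_image nonneg_Cc_continuous assms K)
  then obtain B where B: "\<And>x. x \<in> K \<Longrightarrow> norm (f x) \<le> B"
    by (meson bounded_iff compact_imp_bounded imageI)
  have "f x \<le> max B 1" for x
    using B[of x] K(2)[of x] by (cases "x \<in> K") auto
  then show thesis by (intro that[of "max B 1"]) auto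
qed

text \<open>
  The metric need not be invariant, so this is continuity with respect to the group structure. A
  point that lies in the support before or after translation by an element of a fixed compact ball
  belongs to a fixed compact set, and there ordinary uniform continuity applies.
\<close>
lemma nonneg_Cc_uniformly_continuous:
  fixes f :: "'g::{topological_group_add, metric_space} \<Rightarrow> real"
  assumes f: "f \<in> nonneg_Cc" and lc: "r0 > 0" "compact (cball (0::'g) r0)" and e: "e > 0"
  obtains r where "r > 0"
    "\<And>x z. dist z 0 < r \<Longrightarrow> \<bar>f (x + z) - f x\<bar> < e"
    "\<And>x z. dist z 0 < r \<Longrightarrow> \<bar>f (z + x) - f x\<bar> < e"
proof -
  obtain K where K: "compact K" "\<And>x. x \<notin> K \<Longrightarrow> f x = 0" using nonneg_CcE[OF f] by blast
  let ?B = "cball (0::'g) r0"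
  \<comment> \<open>Both sides are treated at once: \<open>op x z\<close> stands for \<open>x + z\<close> or \<open>z + x\<close>.\<close>
  have aux: "\<exists>r>0. \<forall>x z. dist z 0 < r \<longrightarrow> \<bar>f (op x z) - f x\<bar> < e"
    if op: "continuous_on UNIV (\<lambda>p. op (fst p) (snd p))" and unop: "continuous_on UNIV (\<lambda>p. unop (fst p) (snd p))"
      and inv: "\<And>x z. unop (op x z) z = x" and op0: "\<And>x. op x 0 = x"
    for op unop :: "'g \<Rightarrow> 'g \<Rightarrow> 'g"
  proof -
    define X where "X = K \<union> (\<lambda>p. unop (fst p) (snd p)) ` (K \<times> ?B)"
    have X: "compact (X \<times> ?B)"
      unfolding X_def
      by (intro compact_Times compact_Un compact_continuous_image K lc continuous_on_subset[OF unop]) auto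
    have "continuous_on (X \<times> ?B) (\<lambda>p. f (op (fst p) (snd p)) - f (fst p))"
      by (intro continuous_on_diff continuous_on_compose2[OF nonneg_Cc_continuous[OF f, of UNIV]]
          continuous_on_subset[OF op] continuous_intros) auto
    then have "uniformly_continuous_on (X \<times> ?B) (\<lambda>p. f (op (fst p) (snd p)) - f (fst p))"
      using X by (rule compact_uniformly_continuous)
    then obtain d where d: "d > 0" and D: "\<And>p q. p \<in> X \<times> ?B \<Longrightarrow> q \<in> X \<times> ?B \<Longrightarrow> dist q p < d \<Longrightarrow>
        dist (f (op (fst q) (snd q)) - f (fst q)) (f (op (fst p) (snd p)) - f (fst p)) < e"
      using e unfolding uniformly_continuous_on_def by blast
    have "\<bar>f (op x z) - f x\<bar> < e" if z: "dist z 0 < min d r0" for x z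
    proof (cases "x \<in> X")
      case True
      then have "dist (f (op x z) - f x) (f (op x 0) - f x) < e"
        using D[of "(x, 0)" "(x, z)"] z lc by (simp add: dist_Pair_Pair dist_commute)
      then show ?thesis by (simp add: op0 dist_real_def)
    next
      case False
      then have "x \<notin> K" by (simp add: X_def)
      moreover have "op x z \<notin> K"
      proof
        assume "op x z \<in> K"
        then have "unop (op x z) z \<in> X"
          using z unfolding X_def by (force simp: dist_commute)
        with False inv show False by simp
      qed
      ultimately show ?thesis using K e by simp
    qed
    then show ?thesis using d lc by (intro exI[of _ "min d r0"]) auto
  qed
  have "\<exists>r>0. \<forall>x z. dist z 0 < r \<longrightarrow> \<bar>f (x + z) - f x\<bar> < e"
    by (rule aux[where unop = "\<lambda>y z. y - z"]) (auto intro!: continuous_intros)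
  moreover have "\<exists>r>0. \<forall>x z. dist z 0 < r \<longrightarrow> \<bar>f (z + x) - f x\<bar> < e"
    by (rule aux[where unop = "\<lambda>y z. - z + y"]) (auto intro!: continuous_intros simp: add.assoc[symmetric])
  ultimately obtain r r' where r: "r > 0" "r' > 0"
    "\<And>x z. dist z 0 < r \<Longrightarrow> \<bar>f (x + z) - f x\<bar> < e"
    "\<And>x z. dist z 0 < r' \<Longrightarrow> \<bar>f (z + x) - f x\<bar> < e" by blast
  then show thesis by (intro that[of "min r r'"]) auto
qed

section \<open>Covering numbers\<close>

text \<open>
  A list of pairs \<open>(c, s)\<close> stands for the combination of left translates of a function \<open>\<phi>\<close> by \<open>s\<close>
  with weights \<open>c\<close>. The covering number of \<open>f\<close> by \<open>\<phi>\<close> is Haar's \<open>(f : \<phi>)\<close>, the least total weight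
  of such a combination that dominates \<open>f\<close>. It is sublinear and left-invariant in \<open>f\<close>, and nearly
  additive when \<open>\<phi>\<close> has small support.
\<close>
definition total_weight :: "(real \<times> 'g) list \<Rightarrow> real" where
  "total_weight ps = (\<Sum>p\<leftarrow>ps. fst p)"

definition weighted_translates :: "(real \<times> 'g::group_add) list \<Rightarrow> ('g \<Rightarrow> real) \<Rightarrow> 'g \<Rightarrow> real" where
  "weighted_translates ps \<phi> x = (\<Sum>p\<leftarrow>ps. fst p * \<phi> (- snd p + x))"

definition coverings :: "('g::group_add \<Rightarrow> real) \<Rightarrow> ('g \<Rightarrow> real) \<Rightarrow> (real \<times> 'g) list set" where
  "coverings f \<phi> = {ps. (\<forall>p\<in>set ps. 0 \<le> fst p) \<and> (\<forall>x. f x \<le> weighted_translates ps \<phi> x)}"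

definition covering_number :: "('g::group_add \<Rightarrow> real) \<Rightarrow> ('g \<Rightarrow> real) \<Rightarrow> real" where
  "covering_number f \<phi> = Inf (total_weight ` coverings f \<phi>)"

lemma total_weight_nonneg: "ps \<in> coverings f \<phi> \<Longrightarrow> 0 \<le> total_weight ps"
  by (auto simp: coverings_def total_weight_def intro!: sum_list_nonneg)

lemma covering_number_le: "ps \<in> coverings f \<phi> \<Longrightarrow> covering_number f \<phi> \<le> total_weight ps"
  unfolding covering_number_def
  by (intro cInf_lower bdd_belowI[of _ 0]) (auto dest: total_weight_nonneg)

lemma covering_number_ge:
  assumes "coverings f \<phi> \<noteq> {}" "\<And>ps. ps \<in> coverings f \<phi> \<Longrightarrow> c \<le> total_weight ps"
  shows "c \<le> covering_number f \<phi>"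
  unfolding covering_number_def using assms by (intro cInf_greatest) auto

lemma covering_number_ge_mult:
  assumes ne: "coverings f \<phi> \<noteq> {}" and a: "0 \<le> a"
    and le: "\<And>ps. ps \<in> coverings f \<phi> \<Longrightarrow> c \<le> a * total_weight ps"
  shows "c \<le> a * covering_number f \<phi>"
proof (cases "a = 0")
  case True
  then show ?thesis using le ne by auto
next
  case False
  then have "c / a \<le> covering_number f \<phi>"
    using a le by (intro covering_number_ge ne) (simp add: field_simps)
  then show ?thesis using False a by (simp add: field_simps)
qed

text \<open>
  The set where \<open>\<phi>\<close> exceeds half of \<open>\<phi> y\<close> is open, finitely many of its translates cover \<open>K\<close>, and
  the weight \<open>2 / \<phi> y\<close> suffices for each.
\<close>
lemma covers_compact:
  fixes \<phi> :: "'g::topological_group_add \<Rightarrow> real"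
  assumes \<phi>: "\<phi> \<in> nonneg_Cc" "\<phi> y > 0" and K: "compact K"
  obtains ps where "\<And>p. p \<in> set ps \<Longrightarrow> 0 \<le> fst p" "\<And>x. x \<in> K \<Longrightarrow> 1 \<le> weighted_translates ps \<phi> x"
proof -
  define V where "V s = {x. \<phi> y / 2 < \<phi> (- s + x)}" for s
  have "open (V s)" for s
    unfolding V_def
    by (intro open_Collect_less continuous_on_const
        continuous_on_compose2[OF nonneg_Cc_continuous[OF \<phi>(1), of UNIV]] continuous_intros) auto
  moreover have "x \<in> V (x - y)" for x
    using \<phi>(2) by (simp add: V_def)
  then have "K \<subseteq> (\<Union>s\<in>UNIV. V s)" by blast
  ultimately obtain S where S: "finite S" "K \<subseteq> (\<Union>s\<in>S. V s)"
    using compactE_image[OF K, of UNIV V] by metis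
  obtain ss where ss: "set ss = S" using finite_list[OF S(1)] by blast
  let ?ps = "map (\<lambda>s. (2 / \<phi> y, s)) ss"
  show thesis
  proof (rule that[of ?ps])
    show "0 \<le> fst p" if "p \<in> set ?ps" for p
      using that \<phi>(2) by auto
    fix x assume "x \<in> K"
    then obtain s where s: "s \<in> set ss" "\<phi> y / 2 < \<phi> (- s + x)"
      using S(2) ss by (auto simp: V_def)
    have "1 \<le> 2 / \<phi> y * \<phi> (- s + x)"
      using s(2) \<phi>(2) by (simp add: field_simps)
    also have "\<dots> \<le> weighted_translates ?ps \<phi> x"
      unfolding weighted_translates_def
      using s(1) \<phi> by (intro member_le_sum_list) (auto simp: nonneg_Cc_nonneg o_def)
    finally show "1 \<le> weighted_translates ?ps \<phi> x" .
  qed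
qed

definition scale_weights :: "real \<Rightarrow> (real \<times> 'g) list \<Rightarrow> (real \<times> 'g) list" where
  "scale_weights c ps = map (\<lambda>p. (c * fst p, snd p)) ps"

lemma total_weight_scale: "total_weight (scale_weights c ps) = c * total_weight ps"
  by (simp add: total_weight_def scale_weights_def o_def sum_list_const_mult)

lemma weighted_translates_scale:
  "weighted_translates (scale_weights c ps) \<phi> x = c * weighted_translates ps \<phi> x"
  by (simp add: weighted_translates_def scale_weights_def o_def sum_list_const_mult mult.assoc)

lemma coverings_nonempty:
  fixes \<phi> :: "'g::topological_group_add \<Rightarrow> real"
  assumes f: "f \<in> nonneg_Cc" and \<phi>: "\<phi> \<in> nonneg_Cc" "\<phi> y > 0"
  shows "coverings f \<phi> \<noteq> {}"
proof -
  obtain K where K: "compact K" "\<And>x. x \<notin> K \<Longrightarrow> f x = 0" using nonneg_CcE[OF f] by blast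
  obtain B where B: "B > 0" "\<And>x. f x \<le> B" using nonneg_Cc_bounded[OF f] by blast
  obtain ps where ps: "\<And>p. p \<in> set ps \<Longrightarrow> 0 \<le> fst p" "\<And>x. x \<in> K \<Longrightarrow> 1 \<le> weighted_translates ps \<phi> x"
    using covers_compact[OF \<phi> K(1)] by blast
  have nn: "0 \<le> weighted_translates ps \<phi> x" for x
    unfolding weighted_translates_def using ps(1) \<phi>
    by (intro sum_list_nonneg) (auto simp: nonneg_Cc_nonneg)
  have "f x \<le> B * weighted_translates ps \<phi> x" for x
  proof (cases "x \<in> K")
    case True
    then show ?thesis
      using ps(2)[OF True] B mult_left_mono[of 1 "weighted_translates ps \<phi> x" B] by (fastforce intro: order_trans)
  qed (use nn B K in simp)
  then have "scale_weights B ps \<in> coverings f \<phi>"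
    using ps(1) B(1) by (auto simp: coverings_def weighted_translates_scale) (auto simp: scale_weights_def)
  then show ?thesis by blast
qed

lemma covering_number_nonneg:
  fixes \<phi> :: "'g::topological_group_add \<Rightarrow> real"
  assumes "f \<in> nonneg_Cc" "\<phi> \<in> nonneg_Cc" "\<phi> y > 0"
  shows "0 \<le> covering_number f \<phi>"
  by (intro covering_number_ge coverings_nonempty[OF assms] total_weight_nonneg)

lemma covering_number_mono:
  fixes \<phi> :: "'g::topological_group_add \<Rightarrow> real"
  assumes g: "g \<in> nonneg_Cc" "\<phi> \<in> nonneg_Cc" "\<phi> y > 0" and le: "\<And>x. f x \<le> g x"
  shows "covering_number f \<phi> \<le> covering_number g \<phi>"
proof (intro covering_number_ge coverings_nonempty[OF g])
  fix ps assume "ps \<in> coverings g \<phi>"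
  then have "ps \<in> coverings f \<phi>"
    using le by (auto simp: coverings_def intro: order_trans)
  then show "covering_number f \<phi> \<le> total_weight ps" by (rule covering_number_le)
qed

lemma covering_number_add:
  fixes \<phi> :: "'g::topological_group_add \<Rightarrow> real"
  assumes f: "f \<in> nonneg_Cc" and g: "g \<in> nonneg_Cc" and \<phi>: "\<phi> \<in> nonneg_Cc" "\<phi> y > 0"
  shows "covering_number (\<lambda>x. f x + g x) \<phi> \<le> covering_number f \<phi> + covering_number g \<phi>"
proof -
  let ?n = "covering_number (\<lambda>x. f x + g x) \<phi>"
  have *: "?n \<le> total_weight ps + total_weight qs"
    if "ps \<in> coverings f \<phi>" "qs \<in> coverings g \<phi>" for ps qs
  proof -
    have "ps @ qs \<in> coverings (\<lambda>x. f x + g x) \<phi>"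
      using that by (auto simp: coverings_def weighted_translates_def intro: add_mono)
    then have "?n \<le> total_weight (ps @ qs)"
      by (rule covering_number_le)
    then show ?thesis by (simp add: total_weight_def)
  qed
  have "?n - total_weight ps \<le> covering_number g \<phi>" if "ps \<in> coverings f \<phi>" for ps
    by (intro covering_number_ge coverings_nonempty[OF g \<phi>]) (use *[OF that] in \<open>simp add: algebra_simps\<close>)
  then have "?n - covering_number g \<phi> \<le> covering_number f \<phi>"
    by (intro covering_number_ge coverings_nonempty[OF f \<phi>]) (simp add: algebra_simps)
  then show ?thesis by simp
qed

lemma covering_number_scale_le:
  fixes \<phi> :: "'g::topological_group_add \<Rightarrow> real"
  assumes f: "f \<in> nonneg_Cc" and \<phi>: "\<phi> \<in> nonneg_Cc" "\<phi> y > 0" and c: "0 \<le> c"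
  shows "covering_number (\<lambda>x. c * f x) \<phi> \<le> c * covering_number f \<phi>"
proof (rule covering_number_ge_mult[OF coverings_nonempty[OF f \<phi>] c])
  fix ps assume "ps \<in> coverings f \<phi>"
  then have "scale_weights c ps \<in> coverings (\<lambda>x. c * f x) \<phi>"
    using c by (auto simp: coverings_def weighted_translates_scale mult_left_mono) (auto simp: scale_weights_def)
  then show "covering_number (\<lambda>x. c * f x) \<phi> \<le> c * total_weight ps"
    unfolding total_weight_scale[symmetric] by (rule covering_number_le)
qed

lemma covering_number_scale:
  fixes \<phi> :: "'g::topological_group_add \<Rightarrow> real"
  assumes f: "f \<in> nonneg_Cc" and \<phi>: "\<phi> \<in> nonneg_Cc" "\<phi> y > 0" and c: "0 < c"
  shows "covering_number (\<lambda>x. c * f x) \<phi> = c * covering_number f \<phi>"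
proof (rule antisym)
  show "covering_number (\<lambda>x. c * f x) \<phi> \<le> c * covering_number f \<phi>"
    using c by (intro covering_number_scale_le[OF f \<phi>]) simp
  have "covering_number (\<lambda>x. inverse c * (c * f x)) \<phi> \<le> inverse c * covering_number (\<lambda>x. c * f x) \<phi>"
    using c by (intro covering_number_scale_le[OF nonneg_Cc_scale[OF f] \<phi>]) auto
  then show "c * covering_number f \<phi> \<le> covering_number (\<lambda>x. c * f x) \<phi>"
    using c by (simp add: field_simps)
qed

lemma covering_number_translate_le:
  fixes \<phi> :: "'g::topological_group_add \<Rightarrow> real"
  assumes f: "f \<in> nonneg_Cc" and \<phi>: "\<phi> \<in> nonneg_Cc" "\<phi> y > 0"
  shows "covering_number (translate s f) \<phi> \<le> covering_number f \<phi>"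
proof (intro covering_number_ge coverings_nonempty[OF f \<phi>])
  fix ps assume ps: "ps \<in> coverings f \<phi>"
  let ?qs = "map (\<lambda>p. (fst p, s + snd p)) ps"
  have "weighted_translates ?qs \<phi> x = weighted_translates ps \<phi> (- s + x)" for x
    by (simp add: weighted_translates_def o_def minus_add add.assoc del: add_uminus_conv_diff)
  then have "?qs \<in> coverings (translate s f) \<phi>"
    using ps by (auto simp: coverings_def translate_def)
  then have "covering_number (translate s f) \<phi> \<le> total_weight ?qs"
    by (rule covering_number_le)
  then show "covering_number (translate s f) \<phi> \<le> total_weight ps"
    by (simp add: total_weight_def o_def)
qed

lemma covering_number_translate:
  fixes \<phi> :: "'g::topological_group_add \<Rightarrow> real"
  assumes f: "f \<in> nonneg_Cc" and \<phi>: "\<phi> \<in> nonneg_Cc" "\<phi> y > 0"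
  shows "covering_number (translate s f) \<phi> = covering_number f \<phi>"
  using covering_number_translate_le[OF f \<phi>, of s]
    covering_number_translate_le[OF nonneg_Cc_translate[OF f] \<phi>, of "- s" s]
  by (simp add: translate_translate)

lemma sum_list_concat_map:
  "sum_list (map h (concat (map k ps))) = (\<Sum>p\<leftarrow>ps. \<Sum>q\<leftarrow>k p. h q)"
  by (induction ps) auto

text \<open>
  Substituting a covering of \<open>g\<close> by \<open>\<phi>\<close> into one of \<open>f\<close> by \<open>g\<close> multiplies the total weights. This
  bounds \<open>(f : \<phi>) / (f\<^sub>0 : \<phi>)\<close> from above and, for \<open>f \<noteq> 0\<close>, away from \<open>0\<close>, independently of
  \<open>\<phi>\<close>.
\<close>
lemma covering_number_trans:
  fixes \<phi> :: "'g::topological_group_add \<Rightarrow> real"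
  assumes f: "f \<in> nonneg_Cc" and g: "g \<in> nonneg_Cc" "g z > 0" and \<phi>: "\<phi> \<in> nonneg_Cc" "\<phi> y > 0"
  shows "covering_number f \<phi> \<le> covering_number f g * covering_number g \<phi>"
proof -
  have *: "covering_number f \<phi> \<le> total_weight ps * total_weight qs"
    if ps: "ps \<in> coverings f g" and qs: "qs \<in> coverings g \<phi>" for ps qs
  proof -
    let ?rs = "concat (map (\<lambda>p. map (\<lambda>q. (fst p * fst q, snd p + snd q)) qs) ps)"
    have "weighted_translates ?rs \<phi> x = (\<Sum>p\<leftarrow>ps. fst p * weighted_translates qs \<phi> (- snd p + x))" for x
      by (simp add: weighted_translates_def sum_list_concat_map o_def minus_add add.assoc mult.assoc
          sum_list_const_mult del: add_uminus_conv_diff)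
    moreover have "f x \<le> (\<Sum>p\<leftarrow>ps. fst p * weighted_translates qs \<phi> (- snd p + x))" for x
    proof -
      have "f x \<le> weighted_translates ps g x"
        using ps by (simp add: coverings_def)
      also have "\<dots> \<le> (\<Sum>p\<leftarrow>ps. fst p * weighted_translates qs \<phi> (- snd p + x))"
        unfolding weighted_translates_def[of ps]
        using ps qs by (intro sum_list_mono mult_left_mono) (auto simp: coverings_def)
      finally show ?thesis .
    qed
    moreover have "\<forall>p\<in>set ?rs. 0 \<le> fst p"
      using ps qs by (auto simp: coverings_def)
    ultimately have "?rs \<in> coverings f \<phi>"
      by (simp add: coverings_def)
    then have "covering_number f \<phi> \<le> total_weight ?rs"
      by (rule covering_number_le)
    also have "\<dots> = total_weight ps * total_weight qs"
      by (simp add: total_weight_def sum_list_concat_map o_def sum_list_const_mult sum_list_mult_const)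
    finally show ?thesis .
  qed
  have "covering_number f \<phi> \<le> total_weight ps * covering_number g \<phi>" if "ps \<in> coverings f g" for ps
    by (intro covering_number_ge_mult coverings_nonempty[OF g(1) \<phi>] total_weight_nonneg[OF that] *[OF that])
  then have "covering_number f \<phi> \<le> covering_number g \<phi> * covering_number f g"
    by (intro covering_number_ge_mult coverings_nonempty[OF f g] covering_number_nonneg[OF g(1) \<phi>])
      (simp add: mult.commute)
  then show ?thesis by (simp add: mult.commute)
qed

lemma covering_number_pos:
  fixes \<phi> :: "'g::topological_group_add \<Rightarrow> real"
  assumes f: "f \<in> nonneg_Cc" "f z > 0" and \<phi>: "\<phi> \<in> nonneg_Cc" "\<phi> y > 0"
  shows "0 < covering_number f \<phi>"
proof -
  obtain B where B: "B > 0" "\<And>x. \<phi> x \<le> B" using nonneg_Cc_bounded[OF \<phi>(1)] by blast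
  have "f z / B \<le> covering_number f \<phi>"
  proof (intro covering_number_ge coverings_nonempty[OF f(1) \<phi>])
    fix ps assume ps: "ps \<in> coverings f \<phi>"
    then have "f z \<le> weighted_translates ps \<phi> z" by (simp add: coverings_def)
    also have "\<dots> \<le> (\<Sum>p\<leftarrow>ps. fst p * B)"
      unfolding weighted_translates_def
      using ps B by (intro sum_list_mono mult_left_mono) (auto simp: coverings_def)
    also have "\<dots> = total_weight ps * B"
      by (simp add: total_weight_def sum_list_mult_const)
    finally show "f z / B \<le> total_weight ps"
      using B(1) by (simp add: field_simps)
  qed
  then show ?thesis using f B(1) by (meson divide_pos_pos less_le_trans)
qed

text \<open>
  The quotient is continuous where \<open>h\<close> is positive, vanishes off \<open>K\<close>, and these two open sets cover
  everything.
\<close>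
lemma nonneg_Cc_divide:
  assumes f: "f \<in> nonneg_Cc" and h: "h \<in> nonneg_Cc"
    and K: "compact K" "\<And>x. x \<notin> K \<Longrightarrow> f x = 0" "\<And>x. x \<in> K \<Longrightarrow> 0 < h x" and "closed K"
  shows "(\<lambda>x. f x / h x) \<in> nonneg_Cc"
proof (rule nonneg_CcI[OF _ _ K(1)])
  let ?U = "{x. 0 < h x}"
  have U: "open ?U"
    by (intro open_Collect_less continuous_on_const nonneg_Cc_continuous h)
  have "continuous_on ?U (\<lambda>x. f x / h x)"
    by (intro continuous_on_divide nonneg_Cc_continuous f h) auto
  moreover have "continuous_on (- K) (\<lambda>x. f x / h x)"
    by (rule continuous_on_eq[of _ "\<lambda>x. 0"]) (auto simp: K)
  ultimately have "continuous_on (?U \<union> - K) (\<lambda>x. f x / h x)"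
    using U \<open>closed K\<close> by (intro continuous_on_open_Un) auto
  moreover have "?U \<union> - K = UNIV" using K(3) by auto
  ultimately show "continuous_on UNIV (\<lambda>x. f x / h x)" by simp
qed (use f h K in \<open>auto simp: nonneg_Cc_nonneg\<close>)

lemma nonneg_Cc_weighted_translates:
  fixes \<phi> :: "'g::topological_group_add \<Rightarrow> real"
  assumes "\<phi> \<in> nonneg_Cc" "\<And>p. p \<in> set ps \<Longrightarrow> 0 \<le> fst p"
  shows "weighted_translates ps \<phi> \<in> nonneg_Cc"
  using assms(2)
proof (induction ps)
  case Nil
  then show ?case by (simp add: weighted_translates_def[abs_def])
next
  case (Cons p ps)
  have "(\<lambda>x. fst p * translate (snd p) \<phi> x + weighted_translates ps \<phi> x) \<in> nonneg_Cc"
    by (intro nonneg_Cc_add nonneg_Cc_scale nonneg_Cc_translate assms Cons) (use Cons.prems in auto)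
  then show ?case
    by (simp add: weighted_translates_def[abs_def] translate_def)
qed

text \<open>
  Given a covering of \<open>h\<close>, multiplying the weight at \<open>s\<close> by \<open>f\<^sub>i s / h s + d\<close> gives a covering
  of \<open>f\<^sub>i\<close>: where the translate by \<open>s\<close> of \<open>\<phi>\<close> is nonzero, the quotient \<open>f\<^sub>i / h\<close> differs from its
  value at \<open>s\<close> by less than \<open>d\<close>. Since \<open>f\<^sub>1 / h + f\<^sub>2 / h \<le> 1\<close>, the two total weights add up
  to at most \<open>1 + 2 d\<close> times the given one.
\<close>
lemma covering_number_almost_additive_partition:
  fixes f1 f2 h :: "'g::{topological_group_add, metric_space} \<Rightarrow> real"
  assumes h: "h \<in> nonneg_Cc" and \<phi>: "\<phi> \<in> nonneg_Cc" "\<phi> y > 0"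
    and f: "\<And>x. 0 \<le> f1 x" "\<And>x. 0 \<le> f2 x" "\<And>x. f1 x + f2 x \<le> h x"
    and small: "\<And>z. \<phi> z \<noteq> 0 \<Longrightarrow> dist z 0 < r" and d: "0 < d"
    and r1: "\<And>x z. dist z 0 < r \<Longrightarrow> \<bar>f1 (x + z) / h (x + z) - f1 x / h x\<bar> < d"
    and r2: "\<And>x z. dist z 0 < r \<Longrightarrow> \<bar>f2 (x + z) / h (x + z) - f2 x / h x\<bar> < d"
  shows "covering_number f1 \<phi> + covering_number f2 \<phi> \<le> (1 + 2 * d) * covering_number h \<phi>"
proof (rule covering_number_ge_mult[OF coverings_nonempty[OF h \<phi>]])
  fix ps assume ps: "ps \<in> coverings h \<phi>"
  have *: "covering_number k \<phi> \<le> (\<Sum>p\<leftarrow>ps. fst p * (k (snd p) / h (snd p) + d))"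
    if k: "\<And>x. 0 \<le> k x" "\<And>x. k x \<le> h x"
      and kr: "\<And>x z. dist z 0 < r \<Longrightarrow> \<bar>k (x + z) / h (x + z) - k x / h x\<bar> < d" for k
  proof -
    let ?qs = "map (\<lambda>p. (fst p * (k (snd p) / h (snd p) + d), snd p)) ps"
    have "k x \<le> weighted_translates ?qs \<phi> x" for x
    proof -
      have "h x = 0 \<Longrightarrow> k x = 0" using k[of x] by simp
      then have "k x = h x * (k x / h x)" by auto
      also have "\<dots> \<le> weighted_translates ps \<phi> x * (k x / h x)"
        using ps k[of x] by (intro mult_right_mono) (auto simp: coverings_def intro: divide_nonneg_nonneg order_trans)
      also have "\<dots> = (\<Sum>p\<leftarrow>ps. fst p * \<phi> (- snd p + x) * (k x / h x))"
        by (simp only: weighted_translates_def sum_list_mult_const)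
      also have "\<dots> \<le> (\<Sum>p\<leftarrow>ps. fst p * (k (snd p) / h (snd p) + d) * \<phi> (- snd p + x))"
      proof (rule sum_list_mono)
        fix p assume p: "p \<in> set ps"
        show "fst p * \<phi> (- snd p + x) * (k x / h x) \<le> fst p * (k (snd p) / h (snd p) + d) * \<phi> (- snd p + x)"
        proof (cases "\<phi> (- snd p + x) = 0")
          case False
          have "snd p + (- snd p + x) = x" by (simp add: add.assoc[symmetric])
          then have "k x / h x \<le> k (snd p) / h (snd p) + d"
            using kr[OF small[OF False], of "snd p"] by simp
          then have "fst p * \<phi> (- snd p + x) * (k x / h x)
              \<le> fst p * \<phi> (- snd p + x) * (k (snd p) / h (snd p) + d)"
            using p ps \<phi> by (intro mult_left_mono mult_nonneg_nonneg) (auto simp: coverings_def nonneg_Cc_nonneg)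
          then show ?thesis by (simp only: mult_ac)
        qed simp
      qed
      finally show ?thesis by (simp add: weighted_translates_def o_def)
    qed
    moreover have "\<forall>q\<in>set ?qs. 0 \<le> fst q"
      using ps k d h by (auto simp: coverings_def nonneg_Cc_nonneg
          intro!: mult_nonneg_nonneg add_nonneg_nonneg divide_nonneg_nonneg)
    ultimately have "?qs \<in> coverings k \<phi>" by (simp add: coverings_def)
    then have "covering_number k \<phi> \<le> total_weight ?qs" by (rule covering_number_le)
    then show ?thesis by (simp add: total_weight_def o_def)
  qed
  have le: "f1 x \<le> h x" "f2 x \<le> h x" for x
    using f(1,2,3)[of x] by linarith+
  have "covering_number f1 \<phi> + covering_number f2 \<phi>
      \<le> (\<Sum>p\<leftarrow>ps. fst p * (f1 (snd p) / h (snd p) + d)) + (\<Sum>p\<leftarrow>ps. fst p * (f2 (snd p) / h (snd p) + d))"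
    by (intro add_mono * f le r1 r2)
  also have "\<dots> = (\<Sum>p\<leftarrow>ps. fst p * ((f1 (snd p) + f2 (snd p)) / h (snd p) + 2 * d))"
    by (simp add: sum_list_addf[symmetric] algebra_simps add_divide_distrib)
  also have "\<dots> \<le> (\<Sum>p\<leftarrow>ps. fst p * (1 + 2 * d))"
  proof (intro sum_list_mono mult_left_mono add_right_mono)
    fix p
    show "(f1 (snd p) + f2 (snd p)) / h (snd p) \<le> 1"
      using f(3)[of "snd p"] nonneg_Cc_nonneg[OF h, of "snd p"]
      by (cases "h (snd p) = 0") (auto simp: divide_le_eq)
  qed (use ps in \<open>auto simp: coverings_def\<close>)
  also have "\<dots> = (1 + 2 * d) * total_weight ps"
    by (simp add: total_weight_def sum_list_mult_const mult.commute)
  finally show "covering_number f1 \<phi> + covering_number f2 \<phi> \<le> (1 + 2 * d) * total_weight ps" .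
qed (use d in simp)

text \<open>
  The quotients \<open>f\<^sub>i / (f\<^sub>1 + f\<^sub>2)\<close> need not be continuous at the boundary of the supports.
  Adding a small multiple \<open>c g\<close> of a function that is positive on the supports makes them so, at a
  cost proportional to \<open>c\<close>.
\<close>
lemma covering_number_almost_additive:
  fixes f1 f2 :: "'g::{topological_group_add, metric_space} \<Rightarrow> real"
  assumes lc: "r0 > 0" "compact (cball (0::'g) r0)"
    and f: "f1 \<in> nonneg_Cc" "f2 \<in> nonneg_Cc" and f0: "f0 \<in> nonneg_Cc" "f0 y0 > 0" and e: "e > 0"
  obtains r where "r > 0"
    "\<And>\<phi> y. \<phi> \<in> nonneg_Cc \<Longrightarrow> \<phi> y > 0 \<Longrightarrow> (\<And>z. \<phi> z \<noteq> 0 \<Longrightarrow> dist z 0 < r) \<Longrightarrow>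
      covering_number f1 \<phi> + covering_number f2 \<phi>
        \<le> covering_number (\<lambda>x. f1 x + f2 x) \<phi> + e * covering_number f0 \<phi>"
proof -
  let ?f = "\<lambda>x. f1 x + f2 x"
  have F: "?f \<in> nonneg_Cc" by (intro nonneg_Cc_add f)
  obtain K1 where K1: "compact K1" "\<And>x. x \<notin> K1 \<Longrightarrow> f1 x = 0" using nonneg_CcE[OF f(1)] by blast
  obtain K2 where K2: "compact K2" "\<And>x. x \<notin> K2 \<Longrightarrow> f2 x = 0" using nonneg_CcE[OF f(2)] by blast
  define K where "K = K1 \<union> K2"
  have K: "compact K" "\<And>x. x \<notin> K \<Longrightarrow> f1 x = 0" "\<And>x. x \<notin> K \<Longrightarrow> f2 x = 0"
    using K1 K2 by (auto simp: K_def)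
  obtain ps where ps: "\<And>p. p \<in> set ps \<Longrightarrow> 0 \<le> fst p" "\<And>x. x \<in> K \<Longrightarrow> 1 \<le> weighted_translates ps f0 x"
    using covers_compact[OF f0 K(1)] by blast
  define g where "g = weighted_translates ps f0"
  have g: "g \<in> nonneg_Cc" "\<And>x. x \<in> K \<Longrightarrow> 1 \<le> g x"
    using ps unfolding g_def by (auto intro: nonneg_Cc_weighted_translates[OF f0(1)])
  define A where "A = covering_number ?f f0"
  define B where "B = covering_number g f0"
  have AB: "0 \<le> A" "0 \<le> B"
    unfolding A_def B_def by (rule covering_number_nonneg[OF F f0], rule covering_number_nonneg[OF g(1) f0])
  \<comment> \<open>The errors \<open>2 d (f\<^sub>1 + f\<^sub>2 : \<phi>)\<close> and \<open>2 c (g : \<phi>)\<close> are to be at most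
    \<open>e/2 (f\<^sub>0 : \<phi>)\<close> each, and \<open>A\<close>, \<open>B\<close> compare these covering numbers with
    \<open>(f\<^sub>0 : \<phi>)\<close>.\<close>
  define d where "d = min (1/2) (e / (4 * (A + 1)))"
  define c where "c = e / (4 * (B + 1))"
  have d: "0 < d" "2 * d \<le> 1" "2 * d * A \<le> e / 2"
  proof -
    show "0 < d" "2 * d \<le> 1" using e AB by (auto simp: d_def)
    have "2 * d * A \<le> 2 * (e / (4 * (A + 1))) * A"
      using AB by (intro mult_right_mono mult_left_mono) (auto simp: d_def)
    also have "\<dots> \<le> e / 2"
      using AB e by (simp add: field_simps)
    finally show "2 * d * A \<le> e / 2" .
  qed
  have c: "0 < c" "2 * c * B \<le> e / 2"
    using e AB by (auto simp: c_def field_simps)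
  define h where "h x = f1 x + f2 x + c * g x" for x
  have h: "h \<in> nonneg_Cc"
    unfolding h_def[abs_def] using c by (intro nonneg_Cc_add nonneg_Cc_scale f g) auto
  have hK: "0 < h x" if "x \<in> K" for x
    using g(2)[OF that] c nonneg_Cc_nonneg[OF f(1), of x] nonneg_Cc_nonneg[OF f(2), of x]
    by (auto simp: h_def intro!: add_nonneg_pos)
  have "closed K" using K(1) by (rule compact_imp_closed)
  then have h1: "(\<lambda>x. f1 x / h x) \<in> nonneg_Cc" and h2: "(\<lambda>x. f2 x / h x) \<in> nonneg_Cc"
    by (auto intro!: nonneg_Cc_divide[OF f(1) h K(1)] nonneg_Cc_divide[OF f(2) h K(1)] K hK)
  obtain r1 where r1: "r1 > 0" "\<And>x z. dist z 0 < r1 \<Longrightarrow> \<bar>f1 (x + z) / h (x + z) - f1 x / h x\<bar> < d"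
    using nonneg_Cc_uniformly_continuous[OF h1 lc d(1)] by metis
  obtain r2 where r2: "r2 > 0" "\<And>x z. dist z 0 < r2 \<Longrightarrow> \<bar>f2 (x + z) / h (x + z) - f2 x / h x\<bar> < d"
    using nonneg_Cc_uniformly_continuous[OF h2 lc d(1)] by metis
  show thesis
  proof (rule that[of "min r1 r2"])
    show "0 < min r1 r2" using r1 r2 by simp
    fix \<phi> :: "'g \<Rightarrow> real" and y
    assume \<phi>: "\<phi> \<in> nonneg_Cc" "0 < \<phi> y" and small: "\<And>z. \<phi> z \<noteq> 0 \<Longrightarrow> dist z 0 < min r1 r2"
    let ?N = "\<lambda>k. covering_number k \<phi>"
    have R: "0 \<le> ?N f0" by (rule covering_number_nonneg[OF f0(1) \<phi>])
    have fle: "f1 x + f2 x \<le> h x" for x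
      using c nonneg_Cc_nonneg[OF g(1), of x] by (simp add: h_def)
    have "?N f1 + ?N f2 \<le> (1 + 2 * d) * ?N h"
      by (rule covering_number_almost_additive_partition[OF h \<phi> nonneg_Cc_nonneg[OF f(1)]
            nonneg_Cc_nonneg[OF f(2)] fle small d(1) r1(2) r2(2)]) auto
    also have "\<dots> \<le> (1 + 2 * d) * (?N ?f + c * ?N g)"
    proof (rule mult_left_mono)
      have "?N h \<le> ?N ?f + ?N (\<lambda>x. c * g x)"
        unfolding h_def[abs_def] using c by (intro covering_number_add[OF F _ \<phi>] nonneg_Cc_scale g) auto
      then show "?N h \<le> ?N ?f + c * ?N g"
        by (simp add: covering_number_scale[OF g(1) \<phi> c(1)])
    qed (use d in simp)
    also have "\<dots> = ?N ?f + 2 * d * ?N ?f + (1 + 2 * d) * c * ?N g"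
      by (simp add: algebra_simps)
    also have "\<dots> \<le> ?N ?f + 2 * d * (A * ?N f0) + 2 * c * (B * ?N f0)"
    proof -
      have "2 * d * ?N ?f \<le> 2 * d * (A * ?N f0)"
        unfolding A_def using d by (intro mult_left_mono covering_number_trans[OF F f0 \<phi>]) auto
      moreover have "((1 + 2 * d) * c) * ?N g \<le> (2 * c) * (B * ?N f0)"
        unfolding B_def
      proof (rule mult_mono)
        show "(1 + 2 * d) * c \<le> 2 * c" using c d by (intro mult_right_mono) auto
        show "?N g \<le> covering_number g f0 * ?N f0" by (rule covering_number_trans[OF g(1) f0 \<phi>])
        show "0 \<le> ?N g" by (rule covering_number_nonneg[OF g(1) \<phi>])
      qed (use c in simp)
      ultimately show ?thesis by linarith
    qed
    also have "\<dots> = ?N ?f + (2 * d * A) * ?N f0 + (2 * c * B) * ?N f0"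
      by simp
    also have "\<dots> \<le> ?N ?f + (e / 2) * ?N f0 + (e / 2) * ?N f0"
      by (intro add_mono order_refl mult_right_mono c d R)
    finally show "?N f1 + ?N f2 \<le> ?N ?f + e * ?N f0" by simp
  qed
qed

section \<open>A left-invariant functional\<close>

lemma bump_nonneg_Cc:
  assumes "compact (cball (0::'g::{metric_space, zero}) r0)" "r \<le> r0"
  shows "(\<lambda>z::'g::{metric_space, zero}. max 0 (r - dist z 0)) \<in> nonneg_Cc"
  by (rule nonneg_CcI[OF _ _ assms(1)]) (use assms(2) in \<open>auto simp: dist_commute intro!: continuous_intros\<close>)

text \<open>
  The defining properties of a left Haar integral. Only nonnegative functions occur, as for covering
  numbers; linear combinations with coefficients of either sign are handled by
  \<open>haar_functional_positive\<close>.
\<close>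
locale haar_functional =
  fixes I :: "('g::topological_group_add \<Rightarrow> real) \<Rightarrow> real"
  assumes add: "\<And>f g. f \<in> nonneg_Cc \<Longrightarrow> g \<in> nonneg_Cc \<Longrightarrow> I (\<lambda>x. f x + g x) = I f + I g"
    and scale: "\<And>f c. f \<in> nonneg_Cc \<Longrightarrow> 0 \<le> c \<Longrightarrow> I (\<lambda>x. c * f x) = c * I f"
    and mono: "\<And>f g. f \<in> nonneg_Cc \<Longrightarrow> g \<in> nonneg_Cc \<Longrightarrow> (\<And>x. f x \<le> g x) \<Longrightarrow> I f \<le> I g"
    and invariant: "\<And>f s. f \<in> nonneg_Cc \<Longrightarrow> I (translate s f) = I f"
    and pos: "\<And>f x. f \<in> nonneg_Cc \<Longrightarrow> 0 < f x \<Longrightarrow> 0 < I f"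

text \<open>
  The normalised covering numbers \<open>(f : \<phi>) / (f\<^sub>0 : \<phi>)\<close> lie in an interval depending only on
  \<open>f\<close>, so by Tychonoff's theorem they have a cluster point as the support of \<open>\<phi>\<close> shrinks to the
  neutral element. Sublinearity, monotonicity and invariance pass to the cluster point, and near
  additivity becomes additivity.
\<close>
lemma haar_functional_exists:
  assumes lc: "r0 > 0" "compact (cball (0::'g::{topological_group_add, metric_space}) r0)"
  obtains I :: "('g::{topological_group_add, metric_space} \<Rightarrow> real) \<Rightarrow> real" where "haar_functional I"
proof -
  define \<phi> :: "nat \<Rightarrow> 'g \<Rightarrow> real" where "\<phi> n z = max 0 (r0 / real (Suc n) - dist z 0)" for n z
  have \<phi>: "\<phi> n \<in> nonneg_Cc" "\<phi> n 0 > 0" for n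
  proof -
    have "r0 / real (Suc n) \<le> r0 / 1"
      using lc by (intro divide_left_mono) auto
    then show "\<phi> n \<in> nonneg_Cc"
      unfolding \<phi>_def[abs_def] by (intro bump_nonneg_Cc[OF lc(2)]) simp
    show "\<phi> n 0 > 0" using lc by (simp add: \<phi>_def)
  qed
  have small: "\<exists>N. \<forall>n\<ge>N. \<forall>z. \<phi> n z \<noteq> 0 \<longrightarrow> dist z 0 < r" if "r > 0" for r
  proof -
    have "(\<lambda>n. r0 / real (Suc n)) \<longlonglongrightarrow> 0"
      using LIMSEQ_inverse_real_of_nat tendsto_mult_right_zero[of "\<lambda>n. inverse (real (Suc n))" sequentially r0]
      by (simp add: divide_inverse)
    then have "\<forall>\<^sub>F n in sequentially. r0 / real (Suc n) < r"
      using that by (rule order_tendstoD(2))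
    then obtain N where "\<And>n. n \<ge> N \<Longrightarrow> r0 / real (Suc n) < r"
      by (auto simp: eventually_sequentially)
    then show ?thesis
      by (intro exI[of _ N]) (force simp: \<phi>_def max_def split: if_splits)
  qed
  define f0 where "f0 = \<phi> 0"
  have f0: "f0 \<in> nonneg_Cc" "f0 0 > 0" using \<phi> by (auto simp: f0_def)
  define b where "b f = (if f \<in> nonneg_Cc then covering_number f f0 else 0)" for f
  define I where "I n f = (if f \<in> nonneg_Cc then covering_number f (\<phi> n) / covering_number f0 (\<phi> n) else 0)" for n f
  have R: "0 < covering_number f0 (\<phi> n)" for n
    by (rule covering_number_pos[OF f0 \<phi>])
  have bound: "I n f \<in> {0..b f}" for n f
    using R[of n] covering_number_nonneg[OF _ \<phi>[of n], of f] covering_number_trans[OF _ f0 \<phi>[of n], of f]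
    by (auto simp: I_def b_def field_simps)
  have "compact (PiE UNIV (\<lambda>f. {0..b f}))"
    by (metis compactin_PiE compactin_euclidean_iff compact_Icc euclidean_product_topology)
  moreover have "filtermap I sequentially \<noteq> bot" by (simp add: filtermap_bot_iff)
  moreover have "\<forall>\<^sub>F J in filtermap I sequentially. J \<in> PiE UNIV (\<lambda>f. {0..b f})"
    using bound by (simp add: eventually_filtermap PiE_iff)
  ultimately obtain J where J: "inf (nhds J) (filtermap I sequentially) \<noteq> bot"
    unfolding compact_filter by blast
  \<comment> \<open>Along \<open>F\<close>, evaluation at each \<open>f\<close> converges to \<open>J f\<close>, and whatever holds for almost
    all \<open>I n\<close> holds eventually; so inequalities between values of the \<open>I n\<close> carry over
    to \<open>J\<close>.\<close>
  define F where "F = inf (nhds J) (filtermap I sequentially)"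
  have F: "F \<noteq> bot" "F \<le> nhds J" "F \<le> filtermap I sequentially"
    using J by (simp_all add: F_def)
  have lim: "((\<lambda>K. K f) \<longlongrightarrow> J f) F" for f
  proof -
    have "((\<lambda>K. K f) \<longlongrightarrow> J f) (nhds J)"
    proof (rule topological_tendstoI)
      fix S assume S: "open S" "J f \<in> S"
      have "open ((\<lambda>K. K f) -` S)"
        by (rule open_vimage[OF S(1) continuous_on_product_coordinates])
      then show "\<forall>\<^sub>F K in nhds J. K f \<in> S"
        using S(2) by (auto simp: eventually_nhds)
    qed
    then show ?thesis using F(2) by (rule tendsto_mono[rotated])
  qed
  have ev: "\<forall>\<^sub>F K in F. P K" if "\<forall>\<^sub>F n in sequentially. P (I n)" for P
    using that F(3) by (simp add: le_filter_def eventually_filtermap)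
  have le: "J f1 \<le> J f2 + J f3 + e" if "\<forall>\<^sub>F n in sequentially. I n f1 \<le> I n f2 + I n f3 + e" for f1 f2 f3 e
    by (rule tendsto_le[OF F(1) _ lim ev[OF that]]) (intro tendsto_intros lim)
  have eq: "J f1 = c * J f2" if "\<And>n. I n f1 = c * I n f2" for f1 f2 c
  proof (rule tendsto_unique[OF F(1)])
    show "((\<lambda>K. K f1) \<longlongrightarrow> J f1) F" by (rule lim)
    have "\<forall>\<^sub>F K in F. K f1 = c * K f2" by (rule ev) (simp add: that)
    moreover have "((\<lambda>K. c * K f2) \<longlongrightarrow> c * J f2) F" by (intro tendsto_intros lim)
    ultimately show "((\<lambda>K. K f1) \<longlongrightarrow> c * J f2) F"
      by (rule tendsto_cong[THEN iffD2])
  qed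
  have lower: "c \<le> J f" if "\<And>n. c \<le> I n f" for c f
    by (rule tendsto_lowerbound[OF lim _ F(1)]) (rule ev, simp add: that)
  have J0: "J (\<lambda>x. 0) = 0"
  proof -
    have "I n (\<lambda>x. 0) = 0" for n
    proof -
      have "covering_number (\<lambda>x. 0 * f0 x) (\<phi> n) \<le> 0 * covering_number f0 (\<phi> n)"
        by (rule covering_number_scale_le[OF f0(1) \<phi>]) simp
      then show ?thesis
        using covering_number_nonneg[OF nonneg_Cc_zero \<phi>[of n]] by (simp add: I_def)
    qed
    then show ?thesis using eq[of "\<lambda>x. 0" 0 "\<lambda>x. 0"] by simp
  qed
  have "J (\<lambda>x. f x + g x) = J f + J g" if f: "f \<in> nonneg_Cc" and g: "g \<in> nonneg_Cc" for f g
  proof (rule antisym)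
    have "I n (\<lambda>x. f x + g x) \<le> I n f + I n g + 0" for n
      using covering_number_add[OF f g \<phi>[of n]] R[of n]
      by (simp add: I_def f g nonneg_Cc_add divide_le_cancel flip: add_divide_distrib)
    then show "J (\<lambda>x. f x + g x) \<le> J f + J g"
      using le[of "\<lambda>x. f x + g x" f g 0] by simp
    show "J f + J g \<le> J (\<lambda>x. f x + g x)"
    proof (rule field_le_epsilon)
      fix e :: real assume e: "e > 0"
      obtain r where r: "r > 0" "\<And>\<phi> y. \<phi> \<in> nonneg_Cc \<Longrightarrow> \<phi> y > 0 \<Longrightarrow> (\<And>z. \<phi> z \<noteq> 0 \<Longrightarrow> dist z 0 < r) \<Longrightarrow>
          covering_number f \<phi> + covering_number g \<phi>
            \<le> covering_number (\<lambda>x. f x + g x) \<phi> + e * covering_number f0 \<phi>"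
        using covering_number_almost_additive[OF lc f g f0 e] by blast
      obtain N where N: "\<And>n z. n \<ge> N \<Longrightarrow> \<phi> n z \<noteq> 0 \<Longrightarrow> dist z 0 < r"
        using small[OF r(1)] by blast
      have "I n f + I n g \<le> I n (\<lambda>x. f x + g x) + e" if "n \<ge> N" for n
        using divide_right_mono[OF r(2)[OF \<phi>[of n] N[OF that]], of "covering_number f0 (\<phi> n)"] R[of n]
        by (simp add: I_def f g nonneg_Cc_add add_divide_distrib)
      then have "\<forall>\<^sub>F n in sequentially. I n f + I n g \<le> I n (\<lambda>x. f x + g x) + e"
        by (auto simp: eventually_sequentially)
      then have "\<forall>\<^sub>F K in F. K f + K g \<le> K (\<lambda>x. f x + g x) + e" by (rule ev)
      then show "J f + J g \<le> J (\<lambda>x. f x + g x) + e"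
        by (rule tendsto_le[OF F(1), rotated 2]) (intro tendsto_intros lim)+
    qed
  qed
  moreover have "J (\<lambda>x. c * f x) = c * J f" if f: "f \<in> nonneg_Cc" and c: "0 \<le> c" for f c
  proof (cases "c = 0")
    case False
    then show ?thesis
      using c by (intro eq) (simp add: I_def f nonneg_Cc_scale covering_number_scale[OF f \<phi>])
  qed (simp add: J0)
  moreover have "J f \<le> J g" if f: "f \<in> nonneg_Cc" and g: "g \<in> nonneg_Cc" "\<And>x. f x \<le> g x" for f g
  proof -
    have "I n f \<le> I n g + I n (\<lambda>x. 0) + 0" for n
      using covering_number_mono[OF g(1) \<phi>[of n] g(2)] R[of n] bound[of n "\<lambda>x. 0"]
      by (intro add_increasing2) (simp_all add: I_def f g divide_le_cancel)
    then show ?thesis using le[of f g "\<lambda>x. 0" 0] J0 by simp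
  qed
  moreover have "J (translate s f) = J f" if f: "f \<in> nonneg_Cc" for f s
    using eq[of "translate s f" 1 f] f
    by (simp add: I_def nonneg_Cc_translate covering_number_translate[OF f \<phi>])
  moreover have "0 < J f" if f: "f \<in> nonneg_Cc" "0 < f z" for f z
  proof -
    have "1 / covering_number f0 f \<le> J f"
    proof (rule lower)
      fix n
      show "1 / covering_number f0 f \<le> I n f"
        using covering_number_trans[OF f0(1) f \<phi>[of n]] R[of n] covering_number_pos[OF f0 f]
        by (simp add: I_def f field_simps)
    qed
    then show ?thesis
      using covering_number_pos[OF f0 f] by (meson less_le_trans zero_less_divide_1_iff)
  qed
  ultimately have "haar_functional J"
    by (rule haar_functional.intro)
  then show thesis by (rule that)
qed

lemma haar_functional_sum:
  assumes I: "haar_functional I" and "finite A"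
    and g: "\<And>i. i \<in> A \<Longrightarrow> g i \<in> nonneg_Cc" and c: "\<And>i. i \<in> A \<Longrightarrow> 0 \<le> c i"
  shows "(\<lambda>x. \<Sum>i\<in>A. c i * g i x) \<in> nonneg_Cc"
    "I (\<lambda>x. \<Sum>i\<in>A. c i * g i x) = (\<Sum>i\<in>A. c i * I (g i))"
proof -
  show "(\<lambda>x. \<Sum>i\<in>A. c i * g i x) \<in> nonneg_Cc"
    by (intro nonneg_Cc_sum nonneg_Cc_scale g c)
  have 0: "I (\<lambda>x. 0) = 0"
    using haar_functional.scale[OF I nonneg_Cc_zero, of 0] by simp
  show "I (\<lambda>x. \<Sum>i\<in>A. c i * g i x) = (\<Sum>i\<in>A. c i * I (g i))"
    using \<open>finite A\<close> g c
  proof (induction A rule: finite_induct)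
    case (insert i A)
    have "(\<lambda>x. c i * g i x) \<in> nonneg_Cc" "(\<lambda>x. \<Sum>i\<in>A. c i * g i x) \<in> nonneg_Cc"
      using insert.prems by (auto intro!: nonneg_Cc_sum nonneg_Cc_scale)
    then have "I (\<lambda>x. c i * g i x + (\<Sum>i\<in>A. c i * g i x)) = c i * I (g i) + I (\<lambda>x. \<Sum>i\<in>A. c i * g i x)"
      using insert.prems by (simp add: haar_functional.add[OF I] haar_functional.scale[OF I])
    then show ?case using insert by simp
  qed (simp add: 0)
qed

text \<open>
  Coefficients of either sign are allowed: the terms with negative coefficients are moved to the
  other side, where monotonicity applies. Thus \<open>I\<close> acts as a positive linear functional although it
  is only considered on nonnegative functions.
\<close>
lemma haar_functional_positive:
  assumes I: "haar_functional I" and A: "finite A"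
    and g: "\<And>i. i \<in> A \<Longrightarrow> g i \<in> nonneg_Cc"
    and pos: "\<And>x. 0 \<le> (\<Sum>i\<in>A. c i * g i x)"
  shows "0 \<le> (\<Sum>i\<in>A. c i * I (g i))"
proof -
  define p m where "p i = max 0 (c i)" and "m i = max 0 (- c i)" for i
  have c: "c i = p i - m i" for i by (auto simp: p_def m_def)
  have nn: "0 \<le> p i" "0 \<le> m i" for i by (auto simp: p_def m_def)
  have "(\<Sum>i\<in>A. m i * g i x) \<le> (\<Sum>i\<in>A. p i * g i x)" for x
    using pos[of x] by (simp add: c left_diff_distrib sum_subtractf)
  moreover have P: "(\<lambda>x. \<Sum>i\<in>A. p i * g i x) \<in> nonneg_Cc"
      "I (\<lambda>x. \<Sum>i\<in>A. p i * g i x) = (\<Sum>i\<in>A. p i * I (g i))"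
    by (rule haar_functional_sum[OF I A g nn(1)]; assumption)+
  moreover have M: "(\<lambda>x. \<Sum>i\<in>A. m i * g i x) \<in> nonneg_Cc"
      "I (\<lambda>x. \<Sum>i\<in>A. m i * g i x) = (\<Sum>i\<in>A. m i * I (g i))"
    by (rule haar_functional_sum[OF I A g nn(2)]; assumption)+
  ultimately have "I (\<lambda>x. \<Sum>i\<in>A. m i * g i x) \<le> I (\<lambda>x. \<Sum>i\<in>A. p i * g i x)"
    by (intro haar_functional.mono[OF I])
  then show ?thesis
    by (simp add: P(2) M(2) c left_diff_distrib sum_subtractf)
qed

section \<open>Positive semidefinite kernels\<close>

text \<open>
  Finite families may repeat points; this makes adjoining one more point a mere extension of the
  family.
\<close>
definition psd_kernel :: "('i \<Rightarrow> 'i \<Rightarrow> real) \<Rightarrow> bool" where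
  "psd_kernel k \<longleftrightarrow> (\<forall>s t. k s t = k t s) \<and>
     (\<forall>n c p. 0 \<le> (\<Sum>i<n. \<Sum>j<n. c i * c j * k (p (i::nat)) (p j)))"

text \<open>
  The kernel is \<open>k s t = I (L\<^sub>s f \<cdot> L\<^sub>t f)\<close> for a bump function \<open>f\<close> at the neutral element,
  that is, the Gram matrix of the translates of \<open>f\<close> in the square-integrable functions. The
  expression in the third conclusion is the squared distance of \<open>L\<^sub>s f\<close> and \<open>L\<^sub>t f\<close>; the fourth
  and fifth say that \<open>f \<noteq> 0\<close> and that \<open>L\<^sub>t\<^sub>0 f\<close> is orthogonal to \<open>f\<close>.
\<close>
lemma invariant_kernel_exists:
  fixes t0 :: "'g::{topological_group_add, metric_space}"
  assumes lc: "r0 > 0" "compact (cball (0::'g) r0)" and t0: "t0 \<noteq> 0"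
  obtains k :: "'g \<Rightarrow> 'g \<Rightarrow> real" where "psd_kernel k"
    "\<And>r s t. k (r + s) (r + t) = k s t"
    "\<And>e. e > 0 \<Longrightarrow> \<exists>r>0. \<forall>s t. dist (- s + t) 0 < r \<longrightarrow> k s s + k t t - 2 * k s t < e"
    "k 0 0 > 0" "k t0 0 = 0"
proof -
  obtain I :: "('g \<Rightarrow> real) \<Rightarrow> real" where I: "haar_functional I"
    using haar_functional_exists[OF lc] .
  define \<eta> where "\<eta> = dist (- t0) 0"
  have \<eta>: "\<eta> > 0" using t0 by (simp add: \<eta>_def)
  have "continuous_on UNIV (\<lambda>x. - t0 + x)" by (intro continuous_intros)
  then obtain r1 where r1: "r1 > 0" "\<And>x. dist x 0 < r1 \<Longrightarrow> dist (- t0 + x) (- t0) < \<eta> / 2"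
    using \<eta> unfolding continuous_on_iff
    by (metis UNIV_I add.right_neutral half_gt_zero)
  \<comment> \<open>The radius is so small that translation by \<open>t0\<close> moves the ball of radius \<open>r\<close> off
    itself.\<close>
  define r where "r = Min {r0, r1, \<eta> / 2}"
  have r: "0 < r" "r \<le> r0" "r \<le> r1" "r \<le> \<eta> / 2"
    using r1 lc \<eta> by (auto simp: r_def)
  define f where "f z = max 0 (r - dist z 0)" for z :: 'g
  have f: "f \<in> nonneg_Cc"
    unfolding f_def[abs_def] by (rule bump_nonneg_Cc[OF lc(2) r(2)])
  define k where "k s t = I (\<lambda>x. translate s f x * translate t f x)" for s t
  have T: "translate s f \<in> nonneg_Cc" for s by (intro nonneg_Cc_translate f)
  have TT: "(\<lambda>x. translate s f x * translate t f x) \<in> nonneg_Cc" for s t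
    by (intro nonneg_Cc_mult T)
  have sym: "k s t = k t s" for s t by (simp add: k_def mult.commute)
  have psd: "0 \<le> (\<Sum>i<n. \<Sum>j<n. c i * c j * k (p (i::nat)) (p j))" for n c p
  proof -
    have "0 \<le> (\<Sum>q\<in>{..<n} \<times> {..<n}. (c (fst q) * c (snd q)) * k (p (fst q)) (p (snd q)))"
      unfolding k_def
    proof (rule haar_functional_positive[OF I _ TT])
      fix x
      have "(\<Sum>q\<in>{..<n} \<times> {..<n}. c (fst q) * c (snd q) * (translate (p (fst q)) f x * translate (p (snd q)) f x))
          = (\<Sum>i<n. c i * translate (p i) f x) * (\<Sum>j<n. c j * translate (p j) f x)"
        unfolding sum_product sum.cartesian_product by (intro sum.cong) auto
      then show "0 \<le> (\<Sum>q\<in>{..<n} \<times> {..<n}. c (fst q) * c (snd q) * (translate (p (fst q)) f x * translate (p (snd q)) f x))"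
        by simp
    qed simp
    then show ?thesis
      by (simp add: sum.cartesian_product case_prod_beta)
  qed
  have inv: "k (u + s) (u + t) = k s t" for u s t
  proof -
    have "(\<lambda>x. translate (u + s) f x * translate (u + t) f x) = translate u (\<lambda>x. translate s f x * translate t f x)"
      unfolding translate_translate[symmetric] by (simp add: translate_def)
    then show ?thesis
      unfolding k_def by (simp only: haar_functional.invariant[OF I TT])
  qed
  obtain K where K: "compact K" "\<And>x. x \<notin> K \<Longrightarrow> f x = 0" using nonneg_CcE[OF f] by blast
  \<comment> \<open>The set \<open>K \<union> L\<close> contains the supports of all translates of \<open>f\<close> by elements of the
    ball, and \<open>g\<close> dominates its indicator function.\<close>
  define L where "L = (\<lambda>q. fst q + snd q) ` (cball (0::'g) r0 \<times> K)"
  have "compact (K \<union> L)"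
    unfolding L_def by (intro compact_Un K compact_continuous_image compact_Times lc continuous_intros)
  moreover have f0: "f 0 > 0" using r by (simp add: f_def)
  ultimately obtain ps where ps: "\<And>p. p \<in> set ps \<Longrightarrow> 0 \<le> fst p"
    "\<And>x. x \<in> K \<union> L \<Longrightarrow> 1 \<le> weighted_translates ps f x"
    using covers_compact[OF f] by blast
  define g where "g = weighted_translates ps f"
  have g: "g \<in> nonneg_Cc" "\<And>x. x \<in> K \<union> L \<Longrightarrow> 1 \<le> g x"
    using ps by (auto simp: g_def intro: nonneg_Cc_weighted_translates[OF f])
  have near0: "k 0 0 + k v v - 2 * k 0 v \<le> e\<^sup>2 * I g"
    if v: "dist v 0 < r0" and fv: "\<And>x. \<bar>f (v + x) - f x\<bar> < e" for v e
  proof -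
    \<comment> \<open>Positivity of \<open>I\<close> is applied to \<open>e\<^sup>2 g - (f - L\<^sub>v f)\<^sup>2 \<ge> 0\<close>, expanded into
      four terms.\<close>
    define h :: "nat \<Rightarrow> 'g \<Rightarrow> real" where
      "h i x = [g x, f x * f x, translate v f x * translate v f x, f x * translate v f x] ! i" for i x
    define c :: "nat \<Rightarrow> real" where "c i = [e\<^sup>2, -1, -1, 2] ! i" for i
    have S: "(\<Sum>i<4. w i) = w 0 + w 1 + w 2 + w 3" for w :: "nat \<Rightarrow> real"
      by (simp add: eval_nat_numeral)
    have "0 \<le> (\<Sum>i<4. c i * I (h i))"
    proof (rule haar_functional_positive[OF I])
      fix i :: nat assume "i \<in> {..<4}"
      then consider "i = 0" | "i = 1" | "i = 2" | "i = 3" by fastforce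
      then show "h i \<in> nonneg_Cc"
        by cases (simp_all add: h_def[abs_def] g nonneg_Cc_mult f T)
    next
      fix x
      have "(f x - translate v f x)\<^sup>2 \<le> e\<^sup>2 * g x"
      proof (cases "x \<in> K \<union> L")
        case True
        have "v + (- v + x) = x" by (simp add: add.assoc[symmetric])
        then have "\<bar>f x - translate v f x\<bar> < e"
          using fv[of "- v + x"] by (simp add: translate_def)
        then have "(f x - translate v f x)\<^sup>2 \<le> e\<^sup>2"
          by (intro power2_le_iff_abs_le[THEN iffD2]) auto
        also have "\<dots> \<le> e\<^sup>2 * g x"
          using g(2)[OF True] mult_left_mono[of 1 "g x" "e\<^sup>2"] by simp
        finally show ?thesis .
      next
        case False
        have "- v + x \<notin> K"
        proof
          assume "- v + x \<in> K"
          then have "v + (- v + x) \<in> L"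
            using v unfolding L_def
            by (intro image_eqI[where x = "(v, - v + x)"]) (auto simp: dist_commute)
          then show False using False by (simp add: add.assoc[symmetric])
        qed
        then have "f x = 0" "translate v f x = 0"
          using False K(2) by (auto simp: translate_def)
        then show ?thesis using nonneg_Cc_nonneg[OF g(1), of x] by simp
      qed
      then show "0 \<le> (\<Sum>i<4. c i * h i x)"
        by (simp add: S c_def h_def power2_eq_square algebra_simps)
    qed simp
    moreover have "I (h 0) = I g" "I (h 1) = k 0 0" "I (h 2) = k v v" "I (h 3) = k 0 v"
      by (simp_all add: h_def[abs_def] k_def)
    ultimately show ?thesis by (simp add: S c_def)
  qed
  have cont: "\<exists>d>0. \<forall>s t. dist (- s + t) 0 < d \<longrightarrow> k s s + k t t - 2 * k s t < e" if e: "e > 0" for e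
  proof -
    have Ig: "0 < I g"
    proof -
      have "0 \<in> K" using K(2)[of 0] f0 by fastforce
      then have "0 < g 0" using g(2)[of 0] by auto
      then show ?thesis by (rule haar_functional.pos[OF I g(1)])
    qed
    define d where "d = sqrt (e / (2 * I g))"
    have d: "d > 0" "d\<^sup>2 * I g < e" using e Ig by (auto simp: d_def)
    obtain r2 where r2: "r2 > 0" "\<And>x z. dist z 0 < r2 \<Longrightarrow> \<bar>f (z + x) - f x\<bar> < d"
      using nonneg_Cc_uniformly_continuous[OF f lc d(1)] by metis
    have "k s s + k t t - 2 * k s t < e" if st: "dist (- s + t) 0 < min r0 r2" for s t
    proof -
      have "k 0 0 + k (- s + t) (- s + t) - 2 * k 0 (- s + t) \<le> d\<^sup>2 * I g"
        using st r2(2) by (intro near0) auto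
      moreover have "k s s = k 0 0" "k s t = k 0 (- s + t)" "k t t = k (- s + t) (- s + t)"
        using inv[of s 0 0] inv[of s 0 "- s + t"] inv[of s "- s + t" "- s + t"]
        by (simp_all add: add.assoc[symmetric])
      ultimately show ?thesis using d(2) by simp
    qed
    then show ?thesis using lc r2 by (intro exI[of _ "min r0 r2"]) auto
  qed
  have "0 < k 0 0"
  proof -
    have "(\<lambda>x. f x * f x) \<in> nonneg_Cc" "0 < f 0 * f 0"
      using nonneg_Cc_mult[OF f f] f0 by auto
    then show ?thesis unfolding k_def translate_0 by (rule haar_functional.pos[OF I])
  qed
  moreover have "k t0 0 = 0"
  proof -
    have "translate t0 f x * translate 0 f x = 0" for x
    proof (cases "dist x 0 < r")
      case True
      then have "dist (- t0 + x) (- t0) < \<eta> / 2" using r1(2) r(3) by simp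
      then have "\<eta> / 2 \<le> dist (- t0 + x) 0"
        using dist_triangle[of "- t0" 0 "- t0 + x"] by (simp add: \<eta>_def dist_commute)
      then show ?thesis using r(4) by (simp add: f_def translate_def)
    qed (simp add: f_def)
    moreover have "I (\<lambda>x. 0) = 0"
      using haar_functional_sum(2)[OF I, of "{}"] by simp
    ultimately show ?thesis by (simp only: k_def)
  qed
  ultimately show thesis
    using that[of k] psd sym inv cont unfolding psd_kernel_def by blast
qed

lemma psd_kernel_sym: "psd_kernel k \<Longrightarrow> k s t = k t s"
  by (simp add: psd_kernel_def)

lemma psd_kernel_form: "psd_kernel k \<Longrightarrow> 0 \<le> (\<Sum>i<n. \<Sum>j<n. c i * c j * k (p (i::nat)) (p j))"
  by (simp add: psd_kernel_def)

lemma psd_kernel_diag: "psd_kernel k \<Longrightarrow> 0 \<le> k s s"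
  using psd_kernel_form[of k "\<lambda>_. 1" "\<lambda>_. s" 1] by simp

text \<open>
  The quadratic form after adjoining the point \<open>d\<close> with coefficient \<open>\<mu>\<close>; minimising over \<open>\<mu>\<close> yields
  the Schur complement.
\<close>
lemma psd_kernel_append:
  assumes k: "psd_kernel k"
  shows "0 \<le> (\<Sum>i<n. \<Sum>j<n. c i * c j * k (p (i::nat)) (p j))
    + 2 * \<mu> * (\<Sum>i<n. c i * k (p i) d) + \<mu>\<^sup>2 * k d d"
proof -
  have "0 \<le> (\<Sum>i<Suc n. \<Sum>j<Suc n. (c(n := \<mu>)) i * (c(n := \<mu>)) j * k ((p(n := d)) i) ((p(n := d)) j))"
    by (rule psd_kernel_form[OF k])
  also have "\<dots> = (\<Sum>i<n. (\<Sum>j<n. c i * c j * k (p i) (p j)) + c i * \<mu> * k (p i) d)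
      + ((\<Sum>j<n. \<mu> * c j * k d (p j)) + \<mu> * \<mu> * k d d)"
    by simp
  also have "\<dots> = (\<Sum>i<n. \<Sum>j<n. c i * c j * k (p i) (p j))
    + 2 * \<mu> * (\<Sum>i<n. c i * k (p i) d) + \<mu>\<^sup>2 * k d d"
    by (simp add: sum.distrib psd_kernel_sym[OF k, of d "p _"] sum_distrib_left power2_eq_square mult_ac)
  finally show ?thesis .
qed

text \<open>
  The Gram kernel of the components orthogonal to the vector at \<open>d\<close>. For \<open>k d d = 0\<close> the
  quotient is \<open>0\<close> by the convention for division, which agrees with there being nothing to project
  away.
\<close>
definition schur_complement :: "('i \<Rightarrow> 'i \<Rightarrow> real) \<Rightarrow> 'i \<Rightarrow> 'i \<Rightarrow> 'i \<Rightarrow> real" where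
  "schur_complement k d s t = k s t - k s d * k t d / k d d"

lemma psd_kernel_null:
  assumes k: "psd_kernel k" and 0: "k d d = 0"
  shows "k s d = 0"
proof (rule ccontr)
  assume ne: "k s d \<noteq> 0"
  have "0 \<le> k s s + 2 * \<mu> * k s d" for \<mu>
    using psd_kernel_append[OF k, of "\<lambda>_. 1" "\<lambda>_. s" 1 \<mu> d] 0 by simp
  from this[of "- (k s s + 1) / (2 * k s d)"] show False
    using ne by (simp add: field_simps)
qed

lemma psd_kernel_schur_complement:
  assumes k: "psd_kernel k"
  shows "psd_kernel (schur_complement k d)"
  unfolding psd_kernel_def
proof (intro conjI allI)
  show "schur_complement k d s t = schur_complement k d t s" for s t
    by (simp add: schur_complement_def psd_kernel_sym[OF k, of s t] mult.commute)
  fix n and c :: "nat \<Rightarrow> real" and p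
  define b where "b = (\<Sum>i<n. c i * k (p i) d)"
  let ?Q = "\<Sum>i<n. \<Sum>j<n. c i * c j * k (p i) (p j)"
  have "(\<Sum>i<n. \<Sum>j<n. c i * c j * schur_complement k d (p i) (p j)) = ?Q - b * b / k d d"
    unfolding b_def sum_product
    by (simp add: schur_complement_def right_diff_distrib sum_subtractf sum_divide_distrib mult_ac)
  also have "\<dots> \<ge> 0"
  proof (cases "k d d = 0")
    case True
    then show ?thesis using psd_kernel_form[OF k] by simp
  next
    case False
    then show ?thesis
      using psd_kernel_append[OF k, of c p n "- b / k d d" d]
      by (simp add: b_def[symmetric] power2_eq_square)
  qed
  finally show "0 \<le> (\<Sum>i<n. \<Sum>j<n. c i * c j * schur_complement k d (p i) (p j))" .
qed

lemma psd_kernel_Cauchy_Schwarz: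
  assumes k: "psd_kernel k"
  shows "(k s t)\<^sup>2 \<le> k s s * k t t"
proof (cases "k t t = 0")
  case True
  then show ?thesis using psd_kernel_null[OF k] by simp
next
  case False
  then have "0 < k t t" using psd_kernel_diag[OF k, of t] by simp
  moreover have "0 \<le> schur_complement k t s s"
    by (rule psd_kernel_diag[OF psd_kernel_schur_complement[OF k]])
  ultimately show ?thesis
    by (simp add: schur_complement_def power2_eq_square field_simps)
qed

primrec iterated_complement :: "('i \<Rightarrow> 'i \<Rightarrow> real) \<Rightarrow> (nat \<Rightarrow> 'i) \<Rightarrow> nat \<Rightarrow> 'i \<Rightarrow> 'i \<Rightarrow> real" where
  "iterated_complement k d 0 = k"
| "iterated_complement k d (Suc n) = schur_complement (iterated_complement k d n) (d n)"

text \<open>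
  The coordinate of the vector at \<open>s\<close> along the \<open>n\<close>-th normalised pivot. A pivot that depends on its
  predecessors gives \<open>0\<close>.
\<close>
definition cholesky_coeff :: "('i \<Rightarrow> 'i \<Rightarrow> real) \<Rightarrow> (nat \<Rightarrow> 'i) \<Rightarrow> nat \<Rightarrow> 'i \<Rightarrow> real" where
  "cholesky_coeff k d n s = iterated_complement k d n s (d n) / sqrt (iterated_complement k d n (d n) (d n))"

lemma psd_iterated_complement: "psd_kernel k \<Longrightarrow> psd_kernel (iterated_complement k d n)"
  by (induction n) (simp_all add: psd_kernel_schur_complement)

lemma iterated_complement_Suc_eq:
  assumes "psd_kernel k"
  shows "iterated_complement k d (Suc n) s t
    = iterated_complement k d n s t - cholesky_coeff k d n s * cholesky_coeff k d n t"
  using psd_kernel_diag[OF psd_iterated_complement[OF assms], of d n "d n"]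
  by (simp add: schur_complement_def cholesky_coeff_def)

lemma cholesky_decomposition:
  assumes "psd_kernel k"
  shows "k s t = (\<Sum>i<n. cholesky_coeff k d i s * cholesky_coeff k d i t) + iterated_complement k d n s t"
proof (induction n)
  case (Suc n)
  then show ?case
    using iterated_complement_Suc_eq[OF assms, of d n s t] by simp
qed simp

text \<open>
  A Schur complement makes the row of its pivot vanish and preserves rows that vanish already.
\<close>
lemma iterated_complement_pivot:
  assumes k: "psd_kernel k"
  shows "j < n \<Longrightarrow> iterated_complement k d n s (d j) = 0"
proof (induction n arbitrary: s)
  case (Suc n)
  note P = psd_iterated_complement[OF k, of d n]
  show ?case
  proof (cases "j = n")
    case True
    show ?thesis
      using psd_kernel_null[OF P, of "d n" s] True by (simp add: schur_complement_def)
  next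
    case False
    then have "iterated_complement k d n s (d j) = 0" for s using Suc by simp
    then show ?thesis
      using psd_kernel_sym[OF P, of "d j" "d n"] by (simp add: schur_complement_def)
  qed
qed simp

text \<open>
  Squared distances decrease under projection, and for \<open>j < n\<close> the projected vector at \<open>d j\<close> is
  zero.
\<close>
lemma iterated_complement_le_distance:
  assumes k: "psd_kernel k" and j: "j < n"
  shows "iterated_complement k d n s s \<le> k s s + k (d j) (d j) - 2 * k s (d j)"
proof -
  let ?a = "cholesky_coeff k d"
  have "k s s + k (d j) (d j) - 2 * k s (d j)
      = (\<Sum>i<n. (?a i s - ?a i (d j))\<^sup>2) + iterated_complement k d n s s
        + iterated_complement k d n (d j) (d j) - 2 * iterated_complement k d n s (d j)"
    unfolding cholesky_decomposition[OF k, of s s d n] cholesky_decomposition[OF k, of "d j" "d j" d n]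
      cholesky_decomposition[OF k, of s "d j" d n] power2_diff
    by (simp add: sum.distrib sum_subtractf sum_distrib_left power2_eq_square mult.assoc)
  then show ?thesis
    by (simp add: iterated_complement_pivot[OF k j] sum_nonneg)
qed

text \<open>
  The Cholesky coefficients with pivots along \<open>d\<close> serve as coordinates with respect to \<open>e\<close>. Density
  of the pivots forces the iterated complements to tend to \<open>0\<close>, on the diagonal by
  \<open>iterated_complement_le_distance\<close> and elsewhere by Cauchy-Schwarz.
\<close>
lemma kernel_vectors:
  fixes e :: "nat \<Rightarrow> 'h::chilbert_space" and d :: "nat \<Rightarrow> 'i"
  assumes e: "orthogonal_system e" "\<And>n. norm (e n) = 1" and k: "psd_kernel k"
    and dense: "\<And>s r. 0 < r \<Longrightarrow> \<exists>j. k s s + k (d j) (d j) - 2 * k s (d j) < r"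
  obtains v :: "'i \<Rightarrow> 'h" where "\<And>s t. cinner (v s) (v t) = of_real (k s t)"
proof -
  let ?a = "cholesky_coeff k d" and ?k = "iterated_complement k d"
  note P = psd_iterated_complement[OF k, of d]
  have "(\<Sum>i\<le>n. (cmod (of_real (?a i s)))\<^sup>2) \<le> k s s" for n s
    using cholesky_decomposition[OF k, of s s d "Suc n"] psd_kernel_diag[OF P, of "Suc n" s]
    unfolding lessThan_Suc_atMost by (simp add: power2_eq_square)
  then have "summable (\<lambda>i. (cmod (of_real (?a i s)))\<^sup>2)" for s
    by (intro bounded_imp_summable[where B = "k s s"]) auto
  then have sums: "(\<lambda>i. of_real (?a i s) *\<^sub>C e i) sums (\<Sum>i. of_real (?a i s) *\<^sub>C e i)" for s
    using summable_orthogonal_system[OF e(1)] by (simp add: summable_sums)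
  define v where "v s = (\<Sum>i. of_real (?a i s) *\<^sub>C e i)" for s
  have E: "cinner (e m) (e n) = (if m = n then 1 else 0)" for m n
    using orthogonal_system_cinner[OF e(1), of m n] by (simp add: e(2))
  have coeff: "cinner (e n) (v s) = of_real (?a n s)" for n s
  proof -
    have "(\<lambda>i. cinner (e n) (of_real (?a i s) *\<^sub>C e i)) sums cinner (e n) (v s)"
      unfolding v_def by (intro bounded_linear.sums[OF bounded_linear_cinner_right] sums)
    moreover have "(\<lambda>i. if i = n then of_real (?a n s) else 0) sums complex_of_real (?a n s)"
      by (rule sums_single)
    moreover have "cinner (e n) (of_real (?a i s) *\<^sub>C e i) = (if i = n then of_real (?a n s) else 0)" for i
      by (simp add: cinner_simps E)
    ultimately show ?thesis using sums_unique2 by force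
  qed
  have res0: "(\<lambda>n. ?k n s s) \<longlonglongrightarrow> 0" for s
  proof (rule LIMSEQ_I)
    fix r :: real assume "0 < r"
    then obtain j where j: "k s s + k (d j) (d j) - 2 * k s (d j) < r"
      using dense by blast
    have "norm (?k n s s - 0) < r" if "n \<ge> Suc j" for n
      using iterated_complement_le_distance[OF k, of j n d s] that j psd_kernel_diag[OF P, of n s] by simp
    then show "\<exists>N. \<forall>n\<ge>N. norm (?k n s s - 0) < r" by blast
  qed
  have res: "(\<lambda>n. ?k n s t) \<longlonglongrightarrow> 0" for s t
  proof (rule Lim_null_comparison)
    have "norm (?k n s t) \<le> sqrt (?k n s s * ?k n t t)" for n
      using real_sqrt_le_mono[OF psd_kernel_Cauchy_Schwarz[OF P, of n s t]] by simp
    then show "\<forall>\<^sub>F n in sequentially. norm (?k n s t) \<le> sqrt (?k n s s * ?k n t t)" by simp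
    have "(\<lambda>n. sqrt (?k n s s * ?k n t t)) \<longlonglongrightarrow> sqrt (0 * 0)"
      by (intro tendsto_intros res0)
    then show "(\<lambda>n. sqrt (?k n s s * ?k n t t)) \<longlonglongrightarrow> 0" by simp
  qed
  show thesis
  proof (rule that)
    fix s t
    have "(\<lambda>i. cinner (of_real (?a i s) *\<^sub>C e i) (v t)) sums cinner (v s) (v t)"
      unfolding v_def[of s] by (intro bounded_linear.sums[OF bounded_linear_cinner_left] sums)
    then have "(\<lambda>n. \<Sum>i<n. complex_of_real (?a i s * ?a i t)) \<longlonglongrightarrow> cinner (v s) (v t)"
      by (simp add: sums_def cinner_simps coeff)
    moreover have "(\<lambda>n. complex_of_real (k s t - ?k n s t)) \<longlonglongrightarrow> of_real (k s t - 0)"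
      by (intro tendsto_intros res)
    moreover have "(\<Sum>i<n. complex_of_real (?a i s * ?a i t)) = of_real (k s t - ?k n s t)" for n
      using cholesky_decomposition[OF k, of s t d n] by simp
    ultimately show "cinner (v s) (v t) = of_real (k s t)"
      using LIMSEQ_unique by fastforce
  qed
qed

section \<open>A nontrivial contractive semigroup\<close>

text \<open>
  Every vector splits into its projection onto the closed span of \<open>f\<close>, which lies in the closed span
  of \<open>v\<close>, and a vector annihilated by that projection.
\<close>
lemma dense_span_induct:
  fixes v :: "'i \<Rightarrow> 'a::chilbert_space" and Q :: "'a set"
  assumes f: "orthogonal_system f" "\<And>n. f n \<in> complex_vector.span (range v)"
    and Q: "complex_vector.subspace Q" "closed Q" "\<And>s. v s \<in> Q" "\<And>y. partial_isometry f f y = 0 \<Longrightarrow> y \<in> Q"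
  shows "x \<in> Q"
proof -
  have span: "complex_vector.span (range v) \<subseteq> Q"
    using Q by (intro complex_vector.span_minimal) auto
  have "partial_isometry f f x \<in> Q"
  proof (rule Lim_in_closed_set[OF Q(2)])
    show "(\<lambda>N. \<Sum>n<N. cinner x (f n) *\<^sub>C f n) \<longlonglongrightarrow> partial_isometry f f x"
      using partial_isometry_sums[OF f(1) f(1), of x] by (simp add: sums_def)
    show "\<forall>\<^sub>F N in sequentially. (\<Sum>n<N. cinner x (f n) *\<^sub>C f n) \<in> Q"
      using span f(2)
      by (intro always_eventually allI complex_vector.subspace_sum[OF Q(1)]
          complex_vector.subspace_scale[OF Q(1)]) auto
  qed simp
  moreover have "x - partial_isometry f f x \<in> Q"
    by (intro Q(4)) (simp add: blinfun.diff_right partial_isometry_compose f)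
  ultimately have "partial_isometry f f x + (x - partial_isometry f f x) \<in> Q"
    by (rule complex_vector.subspace_add[OF Q(1)])
  then show ?thesis by simp
qed

text \<open>
  Orthogonalising the vectors \<open>v (d n)\<close> along a dense sequence \<open>d\<close>, and likewise their translates
  \<open>v (t + d n)\<close>, gives two systems that correspond because the Gram matrices agree. The
  resulting partial isometry maps \<open>v s\<close> to \<open>v (t + s)\<close>, first for \<open>s\<close> in the sequence and then
  by continuity for all \<open>s\<close>. The identity on the complement is added so that the neutral element
  acts as the identity. The homomorphism property and strong continuity need only be checked on the
  \<open>v s\<close> and on that complement.
\<close>
lemma orbit_representation:
  fixes v :: "'g::{topological_group_add, second_countable_topology} \<Rightarrow> 'h::chilbert_space"
  assumes cont: "continuous_on UNIV v"
    and inv: "\<And>r s t. cinner (v (r + s)) (v (r + t)) = cinner (v s) (v t)"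
  obtains U :: "'g \<Rightarrow> 'h \<Rightarrow>\<^sub>L 'h" where
    "\<And>t. U t \<in> contractions" "U 0 = id_blinfun" "\<And>s t. U (s + t) = U s o\<^sub>L U t"
    "\<And>x. continuous_on UNIV (\<lambda>t. U t x)" "\<And>s t. U t (v s) = v (t + s)"
proof -
  obtain D :: "'g set" where D: "countable D" "\<And>X. open X \<Longrightarrow> X \<noteq> {} \<Longrightarrow> \<exists>d\<in>D. d \<in> X"
    using countable_dense_setE by blast
  then have "D \<noteq> {}" by (metis UNIV_not_empty empty_iff open_UNIV)
  define d where "d = from_nat_into D"
  have d: "range d = D"
    unfolding d_def by (rule range_from_nat_into[OF \<open>D \<noteq> {}\<close> D(1)])
  have dense: "closed S \<Longrightarrow> range d \<subseteq> S \<Longrightarrow> S = UNIV" for S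
    using D(2)[of "- S"] d by (auto simp: open_Compl)
  define f where "f t = gram_schmidt (\<lambda>n. v (t + d n))" for t
  have F: "orthogonal_system (f t)" for t
    unfolding f_def by (rule orthogonal_system_gram_schmidt)
  have span: "f t n \<in> complex_vector.span (range v)" for t n
    using gram_schmidt_in_span[of "\<lambda>n. v (t + d n)" n]
      complex_vector.span_mono[of "range (\<lambda>n. v (t + d n))" "range v"] by (auto simp: f_def)
  let ?P = "partial_isometry (f 0) (f 0)"
  have TV: "partial_isometry (f 0) (f t) (v s) = v (t + s)" for s t
  proof -
    have "closed {s. partial_isometry (f 0) (f t) (v s) = v (t + s)}"
      by (intro closed_Collect_eq bounded_linear.continuous_on[OF blinfun.bounded_linear_right]
          cont continuous_on_compose2[OF cont] continuous_intros) auto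
    moreover have "partial_isometry (f 0) (f t) (v (0 + d n)) = v (t + d n)" for n
      unfolding f_def by (rule partial_isometry_gram_schmidt) (simp add: inv)
    then have "range d \<subseteq> {s. partial_isometry (f 0) (f t) (v s) = v (t + s)}" by auto
    ultimately have "{s. partial_isometry (f 0) (f t) (v s) = v (t + s)} = UNIV" by (rule dense)
    then show ?thesis by blast
  qed
  have PV: "?P (v s) = v s" for s using TV[of 0 s] by simp
  have Pf: "partial_isometry (f 0) (f t) (?P x) = partial_isometry (f 0) (f t) x" for t x
    by (rule partial_isometry_compose[OF F F F]) simp
  have perp: "cinner (f t n) y = 0" if "?P y = 0" for t n y
  proof -
    have "cinner (v s) y = 0" for s
      using partial_isometry_adjoint[OF F F, of 0 0 "v s" y] that by (simp add: PV)
    then have "range v \<subseteq> {x. cinner x y = 0}" by auto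
    moreover have "complex_vector.subspace {x. cinner x y = 0}"
      by (auto simp: complex_vector.subspace_def cinner_simps)
    ultimately have "complex_vector.span (range v) \<subseteq> {x. cinner x y = 0}"
      by (rule complex_vector.span_minimal)
    then show ?thesis using span by blast
  qed
  define U where "U t = partial_isometry (f 0) (f t) + (id_blinfun - ?P)" for t
  have U: "U t x = partial_isometry (f 0) (f t) x + (x - ?P x)" for t x
    by (simp add: U_def blinfun.add_left blinfun.diff_left)
  have UV: "U t (v s) = v (t + s)" for s t
    by (simp add: U TV PV)
  have Uperp: "U t y = y" if "?P y = 0" for t y
    using Pf[of t y] that by (simp add: U)
  have contr: "U t \<in> contractions" for t
  proof (rule contractionsI)
    show "U t (c *\<^sub>C x) = c *\<^sub>C U t x" for c x
      by (simp add: U partial_isometry_scaleC F complex_vector.scale_right_distrib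
          complex_vector.scale_right_diff_distrib)
    fix x
    have P0: "?P (x - ?P x) = 0" by (simp add: blinfun.diff_right Pf)
    have "cinner (partial_isometry (f 0) (f t) x) (x - ?P x) = 0"
      by (intro cinner_partial_isometry_0 F perp P0)
    then have "(norm (U t x))\<^sup>2 = (norm (partial_isometry (f 0) (f t) x))\<^sup>2 + (norm (x - ?P x))\<^sup>2"
      unfolding U by (rule pythagoras)
    also have "\<dots> \<le> (norm (?P x))\<^sup>2 + (norm (x - ?P x))\<^sup>2"
      unfolding Pf[of t x, symmetric]
      by (intro add_right_mono power_mono contractions_norm_le partial_isometry_contraction F) simp
    also have "\<dots> = (norm (?P x + (x - ?P x)))\<^sup>2"
      by (rule pythagoras[symmetric]) (intro cinner_partial_isometry_0 F perp P0)
    finally have "(norm (U t x))\<^sup>2 \<le> (norm x)\<^sup>2" by simp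
    then show "norm (U t x) \<le> norm x"
      by (rule power2_le_imp_le) simp
  qed
  have lin: "complex_vector.subspace {x. A x = B x}" if "A \<in> contractions" "B \<in> contractions"
    for A B :: "'h \<Rightarrow>\<^sub>L 'h"
    using that by (auto simp: complex_vector.subspace_def contractions_def bounded_operators_scaleC blinfun.add_right)
  have ext: "A = B" if A: "A \<in> contractions" and B: "B \<in> contractions"
    and eq: "\<And>s. A (v s) = B (v s)" "\<And>y. ?P y = 0 \<Longrightarrow> A y = B y" for A B :: "'h \<Rightarrow>\<^sub>L 'h"
  proof (rule blinfun_eqI)
    fix x
    have "x \<in> {x. A x = B x}"
      by (rule dense_span_induct[OF F[of 0] span lin[OF A B]])
        (auto simp: eq intro!: closed_Collect_eq continuous_intros)
    then show "A x = B x" by simp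
  qed
  have id: "id_blinfun \<in> contractions" by (rule contractionsI) auto
  have "continuous_on UNIV (\<lambda>t. U t x)" for x
  proof -
    let ?Q = "{x. continuous_on UNIV (\<lambda>t. U t x)}"
    have "x \<in> ?Q"
    proof (rule dense_span_induct[OF F[of 0] span])
      show "complex_vector.subspace ?Q"
        using contr
        by (auto simp: complex_vector.subspace_def blinfun.add_right contractions_def bounded_operators_scaleC
            intro!: continuous_on_add bounded_linear.continuous_on[OF bounded_linear_scaleC_right])
      show "v s \<in> ?Q" for s
        by (auto simp: UV intro!: continuous_on_compose2[OF cont] continuous_intros)
      show "y \<in> ?Q" if "?P y = 0" for y
        using that by (simp add: Uperp)
      show "closed ?Q"
      proof (subst closed_sequential_limits, intro allI impI, elim conjE)
        fix y and x :: "nat \<Rightarrow> 'h"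
        assume yQ: "\<forall>n. x n \<in> ?Q" and lim: "x \<longlonglongrightarrow> y"
        have "uniform_limit UNIV (\<lambda>n t. U t (x n)) (\<lambda>t. U t y) sequentially"
        proof (rule uniform_limitI)
          fix r :: real assume "0 < r"
          with lim have "\<forall>\<^sub>F n in sequentially. dist (x n) y < r" by (rule tendstoD)
          then show "\<forall>\<^sub>F n in sequentially. \<forall>t\<in>UNIV. dist (U t (x n)) (U t y) < r"
          proof eventually_elim
            case (elim n)
            have "dist (U t (x n)) (U t y) \<le> dist (x n) y" for t
              using contractions_norm_le[OF contr, of t "x n - y"] by (simp add: dist_norm blinfun.diff_right)
            then show ?case using elim by (meson le_less_trans)
          qed
        qed
        then have "continuous_on UNIV (\<lambda>t. U t y)"
          by (rule uniform_limit_theorem[rotated]) (use yQ in auto)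
        then show "y \<in> ?Q" by simp
      qed
    qed
    then show ?thesis by simp
  qed
  moreover have "U 0 = id_blinfun"
    by (rule ext[OF contr id]) (simp_all add: UV Uperp)
  moreover have "U (s + t) = U s o\<^sub>L U t" for s t
    by (rule ext[OF contr contractions_compose[OF contr contr]]) (simp_all add: UV Uperp add.assoc)
  ultimately show thesis by (intro that[of U] contr UV)
qed

lemma nontrivial_semigroup_exists:
  fixes t0 :: "'g::{topological_group_add, polish_space}" and M :: "'g set"
    and e :: "nat \<Rightarrow> 'h::chilbert_space"
  assumes e: "orthogonal_system e" "\<And>n. norm (e n) = 1"
    and lc: "locally_compact_space (euclidean :: 'g topology)"
    and M: "submonoid_add M" and t0: "t0 \<in> M" "t0 \<noteq> 0"
  obtains T :: "'g \<Rightarrow> 'h \<Rightarrow>\<^sub>L 'h"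
    where "T \<in> contractive_semigroups M" "T t0 \<noteq> id_blinfun"
proof -
  have "\<exists>W K. openin euclidean W \<and> compactin euclidean K \<and> (0::'g) \<in> W \<and> W \<subseteq> K"
    using lc by (simp only: locally_compact_space_def topspace_euclidean ball_UNIV)
  then obtain W K where W: "open W" "compact K" "(0::'g) \<in> W" "W \<subseteq> K"
    by (metis open_openin compactin_euclidean_iff)
  then obtain r0 where r0: "r0 > 0" "cball (0::'g) r0 \<subseteq> W"
    using open_contains_cball by blast
  have "compact (K \<inter> cball (0::'g) r0)" using W by (intro compact_Int_closed) auto
  moreover have "K \<inter> cball (0::'g) r0 = cball 0 r0" using r0 W by auto
  ultimately have cb: "compact (cball (0::'g) r0)" by simp
  obtain k :: "'g \<Rightarrow> 'g \<Rightarrow> real" where k: "psd_kernel k"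
    and inv: "\<And>r s t. k (r + s) (r + t) = k s t"
    and small: "\<And>r. r > 0 \<Longrightarrow> \<exists>\<delta>>0. \<forall>s t. dist (- s + t) 0 < \<delta> \<longrightarrow> k s s + k t t - 2 * k s t < r"
    and k0: "k 0 0 > 0" "k t0 0 = 0"
    using invariant_kernel_exists[OF r0(1) cb t0(2)] by metis
  have near: "\<exists>X. open X \<and> s \<in> X \<and> (\<forall>t\<in>X. k s s + k t t - 2 * k s t < r)" if r: "0 < r" for s r
  proof -
    obtain \<delta> where \<delta>: "\<delta> > 0" "\<And>t. dist (- s + t) 0 < \<delta> \<Longrightarrow> k s s + k t t - 2 * k s t < r"
      using small[OF r] by blast
    have "open {t. dist (- s + t) 0 < \<delta>}"
      by (intro open_Collect_less continuous_intros)
    then show ?thesis using \<delta> by (intro exI[of _ "{t. dist (- s + t) 0 < \<delta>}"]) auto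
  qed
  obtain D :: "'g set" where D: "countable D" "\<And>X. open X \<Longrightarrow> X \<noteq> {} \<Longrightarrow> \<exists>d\<in>D. d \<in> X"
    using countable_dense_setE by blast
  then have "D \<noteq> {}" by (metis UNIV_not_empty empty_iff open_UNIV)
  have "\<exists>j. k s s + k (from_nat_into D j) (from_nat_into D j) - 2 * k s (from_nat_into D j) < r"
    if r: "0 < r" for s r
  proof -
    obtain X where X: "open X" "s \<in> X" "\<forall>t\<in>X. k s s + k t t - 2 * k s t < r"
      using near[OF r] by blast
    then obtain d where "d \<in> D" "d \<in> X" using D(2)[of X] by blast
    then show ?thesis using X range_from_nat_into[OF \<open>D \<noteq> {}\<close> D(1)] by (metis imageE)
  qed
  from kernel_vectors[OF e k this] obtain v :: "'g \<Rightarrow> 'h"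
    where v: "\<And>s t. cinner (v s) (v t) = of_real (k s t)" by blast
  have dv: "(norm (v s - v t))\<^sup>2 = k s s + k t t - 2 * k s t" for s t
    by (simp add: norm_sq_cinner cinner_simps v psd_kernel_sym[OF k, of t s])
  have "continuous_on UNIV v"
  proof (subst continuous_on_topological, intro ballI allI impI)
    fix s B assume B: "open B" "v s \<in> B"
    then obtain r where r: "r > 0" "ball (v s) r \<subseteq> B"
      using open_contains_ball by blast
    obtain X where X: "open X" "s \<in> X" "\<forall>t\<in>X. k s s + k t t - 2 * k s t < r\<^sup>2"
      using near[of "r\<^sup>2" s] r by auto
    have "v t \<in> B" if "t \<in> X" for t
    proof -
      have "(norm (v s - v t))\<^sup>2 < r\<^sup>2" using X(3) that by (simp add: dv)
      then have "dist (v s) (v t) < r"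
        unfolding dist_norm by (rule power2_less_imp_less) (use r in simp)
      then show ?thesis using r(2) by auto
    qed
    then show "\<exists>A. open A \<and> s \<in> A \<and> (\<forall>y\<in>UNIV. y \<in> A \<longrightarrow> v y \<in> B)" using X by blast
  qed
  moreover have "cinner (v (r + s)) (v (r + t)) = cinner (v s) (v t)" for r s t
    by (simp add: v inv)
  ultimately obtain U :: "'g \<Rightarrow> 'h \<Rightarrow>\<^sub>L 'h" where U:
    "\<And>t. U t \<in> contractions" "U 0 = id_blinfun" "\<And>s t. U (s + t) = U s o\<^sub>L U t"
    "\<And>x. continuous_on UNIV (\<lambda>t. U t x)" "\<And>s t. U t (v s) = v (t + s)"
    using orbit_representation by blast
  define T where "T = restrict U M"
  have "continuous_on M (\<lambda>t. T t x)" for x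
    using continuous_on_subset[OF U(4), of M x] by (auto simp: T_def intro: continuous_on_eq)
  then have "T \<in> contractive_semigroups M"
    using U M by (auto simp: contractive_semigroups_def submonoid_add_def T_def
        continuous_on_strong_operator_topo_iff_coordinatewise)
  moreover have "T t0 \<noteq> id_blinfun"
  proof
    assume "T t0 = id_blinfun"
    then have "v t0 = v 0" using U(5)[of t0 0] t0 by (simp add: T_def)
    then have "complex_of_real (k 0 0) = of_real (k t0 0)" using v[of 0 0] v[of t0 0] by simp
    then show False using k0 by simp
  qed
  ultimately show thesis by (rule that)
qed

section \<open>Failure of convexity\<close>

text \<open>
  With \<open>y = A x - x\<close> the hypothesis says \<open>A y = y\<close>, so \<open>A\<^sup>n x = x + n y\<close> stays bounded
  only if \<open>y = 0\<close>.
\<close>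
lemma contraction_unipotent_imp_id:
  assumes A: "A \<in> contractions" and sq: "(id_blinfun - A) o\<^sub>L (id_blinfun - A) = 0"
  shows "A = id_blinfun"
proof (rule blinfun_eqI)
  fix x
  define y where "y = A x - x"
  have "(id_blinfun - A) ((id_blinfun - A) x) = 0"
    using sq by (metis blinfun_apply_blinfun_compose zero_blinfun.rep_eq)
  then have Ay: "A y = y"
    by (simp add: y_def blinfun.diff_left blinfun.diff_right algebra_simps)
  have pow: "(blinfun_apply A ^^ n) x = x + real n *\<^sub>R y" for n
  proof (induction n)
    case (Suc n)
    have "A x = x + y" by (simp add: y_def)
    then show ?case
      using Suc by (simp add: blinfun.add_right blinfun.scaleR_right Ay algebra_simps)
  qed simp
  have le: "norm ((blinfun_apply A ^^ n) x) \<le> norm x" for n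
    by (induction n) (auto intro: order_trans[OF contractions_norm_le[OF A]])
  have "real n * norm y \<le> 2 * norm x" for n
  proof -
    have "real n * norm y = norm ((x + real n *\<^sub>R y) - x)" by simp
    also have "\<dots> \<le> norm (x + real n *\<^sub>R y) + norm x" by (rule norm_triangle_ineq4)
    also have "\<dots> \<le> 2 * norm x" using le[of n] by (simp add: pow)
    finally show ?thesis .
  qed
  then have "norm y = 0"
    using real_archimedian_rdiv_eq_0[of "norm y" "2 * norm x"] by simp
  then show "A x = id_blinfun x" by (simp add: y_def)
qed

text \<open>
  Comparing \<open>(T (2 t) + I) / 2\<close> with the square of \<open>(T t + I) / 2\<close> gives
  \<open>(I - T t)\<^sup>2 = 0\<close>.
\<close>
lemma midpoint_with_identity_not_semigroup:
  assumes T: "T \<in> contractive_semigroups M" and M: "submonoid_add M" and t: "t \<in> M"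
    and mid: "(\<lambda>s\<in>M. (1/2) *\<^sub>R T s + (1/2) *\<^sub>R id_blinfun) \<in> contractive_semigroups M"
  shows "T t = id_blinfun"
proof (rule contraction_unipotent_imp_id)
  show "T t \<in> contractions" using T t by (auto simp: contractive_semigroups_def)
  have tt: "t + t \<in> M" using M t by (simp add: submonoid_add_def)
  have eq: "(1/2) *\<^sub>R T (t + t) + (1/2) *\<^sub>R id_blinfun
      = ((1/2) *\<^sub>R T t + (1/2) *\<^sub>R id_blinfun) o\<^sub>L ((1/2) *\<^sub>R T t + (1/2) *\<^sub>R id_blinfun)"
  proof -
    let ?R = "\<lambda>s\<in>M. (1/2) *\<^sub>R T s + (1/2) *\<^sub>R (id_blinfun :: 'b \<Rightarrow>\<^sub>L 'b)"
    have "\<forall>s\<in>M. \<forall>r\<in>M. ?R (s + r) = ?R s o\<^sub>L ?R r"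
      using mid by (simp add: contractive_semigroups_def)
    then have "?R (t + t) = ?R t o\<^sub>L ?R t" using t by blast
    then show ?thesis using t tt by simp
  qed
  have TT: "T (t + t) = T t o\<^sub>L T t"
    using T t by (simp add: contractive_semigroups_def)
  show "(id_blinfun - T t) o\<^sub>L (id_blinfun - T t) = 0"
  proof (rule blinfun_eqI)
    fix x
    have "(1/2) *\<^sub>R T t (T t x) + (1/2) *\<^sub>R x
        = (1/2) *\<^sub>R (T t ((1/2) *\<^sub>R T t x + (1/2) *\<^sub>R x)) + (1/2) *\<^sub>R ((1/2) *\<^sub>R T t x + (1/2) *\<^sub>R x)"
      using arg_cong[OF eq, of "\<lambda>A. blinfun_apply A x"]
      by (simp add: TT blinfun.add_left blinfun.scaleR_left)
    then have "4 *\<^sub>R ((1/2) *\<^sub>R T t (T t x) + (1/2) *\<^sub>R x)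
        = 4 *\<^sub>R ((1/2) *\<^sub>R (T t ((1/2) *\<^sub>R T t x + (1/2) *\<^sub>R x)) + (1/2) *\<^sub>R ((1/2) *\<^sub>R T t x + (1/2) *\<^sub>R x))"
      by simp
    then have "2 *\<^sub>R T t (T t x) + 2 *\<^sub>R x = T t (T t x) + T t x + (T t x + x)"
      by (simp add: blinfun.add_right blinfun.scaleR_right scaleR_add_right)
    then show "((id_blinfun - T t) o\<^sub>L (id_blinfun - T t)) x = blinfun_apply 0 x"
      by (simp add: blinfun.diff_left blinfun.diff_right scaleR_2 algebra_simps)
  qed
qed

lemma trivial_semigroup:
  assumes "submonoid_add M"
  shows "(\<lambda>t\<in>M. id_blinfun) \<in> contractive_semigroups M"
proof -
  have "id_blinfun \<in> contractions" by (rule contractionsI) auto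
  moreover have "continuous_map (top_of_set M) strong_operator_topology (\<lambda>t\<in>M. id_blinfun)"
    by (auto simp: continuous_on_strong_operator_topo_iff_coordinatewise
        intro: continuous_on_eq[OF continuous_on_const])
  ultimately show ?thesis
    using assms by (auto simp: contractive_semigroups_def submonoid_add_def blinfun_eqI)
qed

theorem corollary3p13:
  fixes M :: "'g::{topological_group_add, polish_space} set"
  assumes "separable_space (euclidean :: 'h::chilbert_space topology)"
    and "\<nexists>B :: 'h set. finite B \<and> complex_vector.span B = UNIV"
    and "locally_compact_space (euclidean :: 'g topology)"
    and "submonoid_add M"
    and "M \<noteq> {0}"
  shows "pointwise_convex M
           (kwot M closure_of (contractive_semigroups M :: ('g \<Rightarrow> ('h \<Rightarrow>\<^sub>L 'h)) set))
       \<and> \<not> pointwise_convex M (contractive_semigroups M :: ('g \<Rightarrow> ('h \<Rightarrow>\<^sub>L 'h)) set)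
       \<and> \<not> closedin (kwot M) (contractive_semigroups M :: ('g \<Rightarrow> ('h \<Rightarrow>\<^sub>L 'h)) set)"
proof -
  let ?C = "contractive_semigroups M :: ('g \<Rightarrow> ('h \<Rightarrow>\<^sub>L 'h)) set"
  obtain e :: "nat \<Rightarrow> 'h" where e: "orthogonal_system e" "\<And>n. norm (e n) = 1" "partial_isometry e e = id_blinfun"
    using orthonormal_basis_exists[OF assms(1,2)] by blast
  have "pointwise_convex M (kwot M closure_of ?C)"
  proof (rule closure_of_pointwise_convex)
    fix S T :: "'g \<Rightarrow> 'h \<Rightarrow>\<^sub>L 'h" and u v :: real
    assume ST: "S \<in> ?C" "T \<in> ?C" and uv: "0 \<le> u" "0 \<le> v" "u + v = 1"
    obtain R where R: "\<And>k. R k \<in> ?C"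
      "limitin (kwot M) R (\<lambda>t\<in>M. u *\<^sub>R S t + v *\<^sub>R T t) sequentially"
      using convex_combination_limit_of_semigroups[OF e ST assms(4) uv] by blast
    have "R k \<in> kwot M closure_of ?C" for k
      using closure_of_subset[of ?C "kwot M"] contractive_semigroups_subset[of M] R(1)
      by (auto simp: topspace_kwot)
    then show "(\<lambda>t\<in>M. u *\<^sub>R S t + v *\<^sub>R T t) \<in> kwot M closure_of ?C"
      by (intro limitin_closedin[OF R(2) closedin_closure_of]) auto
  qed
  moreover have nonconvex: "\<not> pointwise_convex M ?C"
  proof
    assume convex: "pointwise_convex M ?C"
    obtain t0 where t0: "t0 \<in> M" "t0 \<noteq> 0"
      using assms(4,5) by (auto simp: submonoid_add_def)
    obtain T :: "'g \<Rightarrow> 'h \<Rightarrow>\<^sub>L 'h" where T: "T \<in> ?C" "T t0 \<noteq> id_blinfun"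
      using nontrivial_semigroup_exists[OF e(1,2) assms(3,4) t0] by blast
    have "(\<lambda>t\<in>M. (1/2) *\<^sub>R T t + (1/2) *\<^sub>R (\<lambda>t\<in>M. id_blinfun) t) \<in> ?C"
      by (rule convex[unfolded pointwise_convex_def, rule_format, OF T(1) trivial_semigroup[OF assms(4)]]) auto
    moreover have "(\<lambda>t\<in>M. (1/2) *\<^sub>R T t + (1/2) *\<^sub>R (\<lambda>t\<in>M. id_blinfun) t)
        = (\<lambda>t\<in>M. (1/2) *\<^sub>R T t + (1/2) *\<^sub>R id_blinfun)"
      by auto
    ultimately show False
      using midpoint_with_identity_not_semigroup[OF T(1) assms(4) t0(1)] T(2) by simp
  qed
  moreover have "\<not> closedin (kwot M) ?C"
    using calculation by (metis closure_of_closedin)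
  ultimately show ?thesis by blast
qed

end
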